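(* Let $n\in\mathbb{N}$ and $m\in\{1,2\}$. For $l=1,2$ let $$V_l(x)=a_{l0}+\sum_{j=1}^{m}\left(\lambda_{lj}e^{i2\pi k_{lj}\cdot x}+\overline{\lambda_{lj}}e^{-i2\pi k_{lj}\cdot x}\right),$$ where $a_{l0}\in\mathbb{R}$, $\lambda_{lj}\in\mathbb{C}\setminus\{0\}$, $k_{lj}\in\mathbb{Z}^n\setminus\{0\}$ for $1\le j\le m$, and for each $l$ the vectors $k_{lj}$, $1\le j\le m$, are pairwise non-parallel. Let $\overline{H}_l$ be the effective Hamiltonian associated with the Hamiltonian $\frac12|p|^2+V_l(x)$. Then: (1) If $m=1$, then $$\overline{H}_1\equiv\overline{H}_2\quad\Longleftrightarrow\quad V_1(x)=V_2\left(\frac{x}{c}+x_0\right)\ \text{ for all }x\in\mathbb{T}^n,$$ for some $c\in\mathbb{Q}\setminus\{0\}$ and $x_0\in\mathbb{T}^n$. (2) If $m=2$, then there are two cases. (i) If $k_{11}\perp k_{12}$, then $\overline{H}_1\equiv\overline{H}_2$ if and only if for $j=1,2$, $$k_{1j}\parallel k_{2j}\quad\text{and}\quad|\lambda_{1j}|=|\lambda_{2j}|.$$ (ii) If $k_{11}$ is not perpendicular to $k_{12}$, then $$\overline{H}_1\equiv\overline{H}_2\quad\Longleftrightarrow\quad V_1(x)=V_2\left(\frac{x}{c}+x_0\right)\ \text{ for all }x\in\mathbb{T}^n,$$ for some $c\in\mathbb{Q}\setminus\{0\}$ and $x_0\in\mathbb{T}^n$.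
   Context: $\mathbb{T}^n=\mathbb{R}^n/\mathbb{Z}^n$ is the flat torus, and $\overline{\lambda}$ denotes the complex conjugate of a complex number $\lambda$. For a continuous $\mathbb{Z}^n$-periodic $V:\mathbb{R}^n\to\mathbb{R}$, the effective Hamiltonian $\overline{H}:\mathbb{R}^n\to\mathbb{R}$ associated with $\frac12|p|^2+V(x)$ is defined as follows: for each $p\in\mathbb{R}^n$, $\overline{H}(p)$ is the unique constant $\mu\in\mathbb{R}$ such that the cell problem $\frac12|p+Dv|^2+V(x)=\mu$ in $\mathbb{T}^n$ has a continuous ($\mathbb{Z}^n$-periodic) viscosity solution $v$. Vectors $u,w$ are parallel ($u\parallel w$) if they are linearly dependent; $u\perp w$ means $u\cdot w=0$. The identity $V_1(x)=V_2(x/c+x_0)$ is understood with $V_1,V_2$ regarded as $\mathbb{Z}^n$-periodic functions on $\mathbb{R}^n$.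
   Formalization: In (2)(i) the right-hand side also requires a_10 = a_20, and the conditions k_1j ∥ k_2j and |λ_1j| = |λ_2j| are taken up to relabelling the two modes of V_2; as printed, V_2 = V_1 + 1 or V_2 = V_1 with its modes swapped is a counterexample. *)

theory Defs
  imports "HOL-Analysis.Analysis"
begin

definition of_int_vec :: "int ^ 'n \<Rightarrow> real ^ 'n" where
  "of_int_vec z = (\<chi> i. of_int (z $ i))"

(* Functions on the torus R^n / Z^n are represented by Z^n-periodic functions on R^n. *)
definition Zn_periodic :: "(real ^ 'n \<Rightarrow> 'b) \<Rightarrow> bool" where
  "Zn_periodic f \<longleftrightarrow> (\<forall>x z. f (x + of_int_vec z) = f x)"

(* Linear dependence of the pair (u, w). The library predicate "dependent {u, w}" would not do:
   it speaks about a set, so it fails for u = w \<noteq> 0. *)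
definition parallel :: "'a::real_vector \<Rightarrow> 'a \<Rightarrow> bool" where
  "parallel u w \<longleftrightarrow> (\<exists>a b. (a \<noteq> 0 \<or> b \<noteq> 0) \<and> a *\<^sub>R u + b *\<^sub>R w = 0)"

definition C1_with_gradient :: "('a::euclidean_space \<Rightarrow> real) \<Rightarrow> ('a \<Rightarrow> 'a) \<Rightarrow> bool" where
  "C1_with_gradient \<phi> D\<phi> \<longleftrightarrow> (\<forall>x. GDERIV \<phi> x :> D\<phi> x) \<and> continuous_on UNIV D\<phi>"

(* Viscosity sub-/super-solutions of F(x, Du(x)) = 0 in the whole space, tested with C^1
   functions touching u locally from above / below (up to an additive constant). *)
definition viscosity_subsolution ::
    "('a::euclidean_space \<Rightarrow> 'a \<Rightarrow> real) \<Rightarrow> ('a \<Rightarrow> real) \<Rightarrow> bool" where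
  "viscosity_subsolution F u \<longleftrightarrow>
     (\<forall>\<phi> D\<phi> x. C1_with_gradient \<phi> D\<phi> \<longrightarrow>
        (\<forall>\<^sub>F y in nhds x. u y - \<phi> y \<le> u x - \<phi> x) \<longrightarrow> F x (D\<phi> x) \<le> 0)"

definition viscosity_supersolution ::
    "('a::euclidean_space \<Rightarrow> 'a \<Rightarrow> real) \<Rightarrow> ('a \<Rightarrow> real) \<Rightarrow> bool" where
  "viscosity_supersolution F u \<longleftrightarrow>
     (\<forall>\<phi> D\<phi> x. C1_with_gradient \<phi> D\<phi> \<longrightarrow>
        (\<forall>\<^sub>F y in nhds x. u y - \<phi> y \<ge> u x - \<phi> x) \<longrightarrow> F x (D\<phi> x) \<ge> 0)"

definition continuous_viscosity_solution ::
    "('a::euclidean_space \<Rightarrow> 'a \<Rightarrow> real) \<Rightarrow> ('a \<Rightarrow> real) \<Rightarrow> bool" where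
  "continuous_viscosity_solution F u \<longleftrightarrow>
     continuous_on UNIV u \<and> viscosity_subsolution F u \<and> viscosity_supersolution F u"

definition cell_problem_solution ::
    "(real ^ 'n \<Rightarrow> real) \<Rightarrow> real ^ 'n \<Rightarrow> real \<Rightarrow> (real ^ 'n \<Rightarrow> real) \<Rightarrow> bool" where
  "cell_problem_solution V p \<mu> v \<longleftrightarrow>
     Zn_periodic v \<and>
     continuous_viscosity_solution (\<lambda>x q. 1/2 * (norm (p + q))\<^sup>2 + V x - \<mu>) v"

(* Meaningful for continuous Zn-periodic V, where the constant exists and is unique. *)
definition effective_Hamiltonian :: "(real ^ 'n \<Rightarrow> real) \<Rightarrow> real ^ 'n \<Rightarrow> real" where
  "effective_Hamiltonian V p = (THE \<mu>. \<exists>v. cell_problem_solution V p \<mu> v)"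

(* The trigonometric sum is real (see of_real_trig_potential), so Re only changes its type. *)
definition trig_potential ::
    "nat \<Rightarrow> real \<Rightarrow> (nat \<Rightarrow> complex) \<Rightarrow> (nat \<Rightarrow> int ^ 'n) \<Rightarrow> real ^ 'n \<Rightarrow> real" where
  "trig_potential m a lam k x =
     Re (of_real a + (\<Sum>j=1..m. lam j * exp (\<i> * of_real (2 * pi * (of_int_vec (k j) \<bullet> x)))
                              + cnj (lam j) * exp (- \<i> * of_real (2 * pi * (of_int_vec (k j) \<bullet> x)))))"

lemma of_real_trig_potential:
  "complex_of_real (trig_potential m a lam k x) =
     of_real a + (\<Sum>j=1..m. lam j * exp (\<i> * of_real (2 * pi * (of_int_vec (k j) \<bullet> x)))
                          + cnj (lam j) * exp (- \<i> * of_real (2 * pi * (of_int_vec (k j) \<bullet> x))))"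
  by (auto simp: trig_potential_def complex_eq_iff Im_exp Re_exp intro!: sum.neutral)

end

theory Submission
  imports Defs "HOL-Complex_Analysis.Great_Picard"
begin

text \<open>
  In polar form a potential reads V = a + 2 A1 cos \<theta>1 + 2 A2 cos \<theta>2 with phases
  \<theta>_j = 2\<pi> k_j \<bullet> x + \<alpha>_j and amplitudes A_j = |\<lambda>_j|; a single
  mode is the case A2 = 0. The effective Hamiltonian is identified as the only level at which the
  cell problem has a solution (\<open>cell_problem_solvable\<close>,
  \<open>cell_levels_compare\<close>). Comparing an unknown solution with explicit smooth
  functions bounds the level from both sides (\<open>critical_level_le\<close>,
  \<open>critical_level_ge\<close>), which turns formal perturbation theory for large momenta p =
  t q into rigorous expansions.

  If q is orthogonal to none of k1, k2, k1 \<plusminus> k2, two correctors \<phi>1/t + \<phi>2/t^3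
  give H(tq) = t^2|q|^2/2 + a + c(q)/t^2 + O(t^(-4)) with c(q) = \<Sum>_j A_j^2 |k_j|^2/(q
  \<bullet> k_j)^2 (\<open>nonresonant_expansion\<close>). So H determines a, and since c has a
  double pole of weight A_j^2 along the hyperplane orthogonal to k_j, it determines the directions
  of the k_j and the A_j (\<open>equal_levels_imp_equal_weights\<close>). For one mode, and for
  two orthogonal modes, this is all the information there is.

  For two modes that are not orthogonal only the ratio |k1|/|k2| is missing. The quadratic term
  |\<nabla>\<phi>1|^2/2 contains the mode k1 + k2 with a coefficient proportional to k1 \<bullet>
  k2, and that mode cannot be removed when q is orthogonal to k1 + k2: there H exceeds the
  nonresonant value by a fixed positive multiple of t^(-2) (\<open>resonant_lower_bound\<close>).
  A potential with modes r1 k1, r2 k2 is nonresonant at such a q unless |r1| = |r2|, so equality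
  of the Hamiltonians forces |r1| = |r2| (\<open>equal_levels_imp_equal_dilations\<close>), and
  the phases are adjusted by a translation.

  Conversely, a dilation by c > 0 carries solutions to solutions that are periodic only on a
  coarser lattice; levels are still unique there, because the comparison argument works for every
  cocompact set of periods. Negative c is reduced to positive c since these potentials are even
  about some point. For orthogonal modes the cell problem splits into one-dimensional problems
  that see only A_j and the component of p along k_j
  (\<open>critical_level_orthogonal_sum\<close>).
\<close>

section \<open>Periodic functions and uniqueness of the critical level\<close>

text \<open>
  Only two features of a lattice matter: functions are invariant under it, and every point can be
  moved into a fixed ball. Stating them for an arbitrary set of translations covers Z^n, its
  sublattices NZ^n, and Z in dimension one at once.
\<close>

definition cocompact :: "'a::real_normed_vector set \<Rightarrow> bool" where
  "cocompact \<Lambda> \<longleftrightarrow> (\<exists>R. \<forall>x. \<exists>z\<in>\<Lambda>. norm (x + z) \<le> R)"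

definition periodic_under :: "'a::real_normed_vector set \<Rightarrow> ('a \<Rightarrow> 'b) \<Rightarrow> bool" where
  "periodic_under \<Lambda> f \<longleftrightarrow> (\<forall>x. \<forall>z\<in>\<Lambda>. f (x + z) = f x)"

abbreviation cell_operator ::
    "('a::euclidean_space \<Rightarrow> real) \<Rightarrow> 'a \<Rightarrow> real \<Rightarrow> 'a \<Rightarrow> 'a \<Rightarrow> real" where
  "cell_operator V p \<mu> \<equiv> \<lambda>x q. 1/2 * (norm (p + q))\<^sup>2 + V x - \<mu>"

lemma periodic_attains_max:
  fixes f :: "'a::euclidean_space \<Rightarrow> real"
  assumes "cocompact \<Lambda>" "periodic_under \<Lambda> f" "continuous_on UNIV f"
  obtains x where "\<And>y. f y \<le> f x"
proof -
  obtain R where R: "\<And>x. \<exists>z\<in>\<Lambda>. norm (x + z) \<le> R"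
    using assms(1) by (auto simp: cocompact_def)
  have "cball (0::'a) R \<noteq> {}"
    using R[of 0] by (metis dual_order.trans norm_ge_zero cball_eq_empty not_le)
  then obtain x where x: "\<And>y. y \<in> cball 0 R \<Longrightarrow> f y \<le> f x"
    using continuous_attains_sup[of "cball (0::'a) R" f] continuous_on_subset[OF assms(3)]
    by (metis compact_cball subset_UNIV)
  have "f y \<le> f x" for y
  proof -
    obtain z where "z \<in> \<Lambda>" "norm (y + z) \<le> R" using R by blast
    then show ?thesis using x[of "y + z"] assms(2) by (simp add: periodic_under_def)
  qed
  then show ?thesis using that by blast
qed

lemma periodic_attains_min:
  fixes f :: "'a::euclidean_space \<Rightarrow> real"
  assumes "cocompact \<Lambda>" "periodic_under \<Lambda> f" "continuous_on UNIV f"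
  obtains x where "\<And>y. f x \<le> f y"
proof -
  have "periodic_under \<Lambda> (\<lambda>x. - f x)" using assms(2) by (simp add: periodic_under_def)
  moreover have "continuous_on UNIV (\<lambda>x. - f x)" using assms(3) by (intro continuous_intros)
  ultimately show ?thesis
    by (metis assms(1) neg_le_iff_le periodic_attains_max that)
qed

lemma periodic_bounded:
  fixes f :: "'a::euclidean_space \<Rightarrow> real"
  assumes "cocompact \<Lambda>" "periodic_under \<Lambda> f" "continuous_on UNIV f"
  obtains B where "\<And>x. \<bar>f x\<bar> \<le> B"
proof -
  obtain x where x: "\<And>y. f y \<le> f x" using periodic_attains_max[OF assms] by blast
  obtain w where w: "\<And>y. f w \<le> f y" using periodic_attains_min[OF assms] by blast
  have "\<bar>f y\<bar> \<le> max \<bar>f x\<bar> \<bar>f w\<bar>" for y using x[of y] w[of y] by linarith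
  then show ?thesis using that by blast
qed

lemma C1_add:
  assumes "C1_with_gradient \<phi> D\<phi>" "C1_with_gradient \<psi> D\<psi>"
  shows "C1_with_gradient (\<lambda>x. \<phi> x + \<psi> x) (\<lambda>x. D\<phi> x + D\<psi> x)"
  using assms unfolding C1_with_gradient_def by (auto intro: GDERIV_add continuous_on_add)

lemma C1_scale:
  assumes "C1_with_gradient \<phi> D\<phi>"
  shows "C1_with_gradient (\<lambda>x. c * \<phi> x) (\<lambda>x. c *\<^sub>R D\<phi> x)"
proof -
  have "GDERIV (\<lambda>x. c * \<phi> x) x :> c *\<^sub>R D\<phi> x" for x
    using GDERIV_mult[OF GDERIV_const[of c x], of \<phi> "D\<phi> x"] assms
    by (simp add: C1_with_gradient_def)
  then show ?thesis using assms unfolding C1_with_gradient_def by (auto intro: continuous_on_scaleR continuous_on_const)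
qed

lemma C1_ridge:
  assumes "\<And>s. (g has_real_derivative g' s) (at s)" "continuous_on UNIV g'"
  shows "C1_with_gradient (\<lambda>x. g (k \<bullet> x)) (\<lambda>x. g' (k \<bullet> x) *\<^sub>R k)"
proof -
  have "GDERIV (\<lambda>x. g (k \<bullet> x)) x :> g' (k \<bullet> x) *\<^sub>R k" for x
  proof (rule GDERIV_DERIV_compose[of "(\<bullet>) k"])
    show "GDERIV ((\<bullet>) k) x :> k"
      unfolding gderiv_def by (auto intro!: derivative_eq_intros simp: inner_commute)
    show "DERIV g (k \<bullet> x) :> g' (k \<bullet> x)" by (rule assms(1))
  qed
  moreover have "continuous_on UNIV (\<lambda>x. g' (k \<bullet> x) *\<^sub>R k)"
    by (intro continuous_intros continuous_on_compose2[OF assms(2)]) auto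
  ultimately show ?thesis unfolding C1_with_gradient_def by blast
qed

lemma C1_square_dist:
  "C1_with_gradient (\<lambda>x. c * (norm (x - a))\<^sup>2) (\<lambda>x. (2 * c) *\<^sub>R (x - a))"
proof -
  have "GDERIV (\<lambda>x. (norm (x - a))\<^sup>2) x :> 2 *\<^sub>R (x - a)" for x :: 'a
    unfolding gderiv_def power2_norm_eq_inner
    by (auto intro!: derivative_eq_intros simp: inner_commute algebra_simps)
  then have "C1_with_gradient (\<lambda>x. (norm (x - a))\<^sup>2) (\<lambda>x. 2 *\<^sub>R (x - a))"
    unfolding C1_with_gradient_def by (intro conjI allI continuous_intros) auto
  from C1_scale[OF this, of c] show ?thesis by (simp add: mult.commute)
qed

lemma C1_continuous: "C1_with_gradient \<phi> D\<phi> \<Longrightarrow> continuous_on S \<phi>"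
  unfolding C1_with_gradient_def gderiv_def
  by (meson continuous_at_imp_continuous_on has_derivative_continuous)

text \<open>
  Doubling of variables. The quadratic Hamiltonian is the same at both touching points, because
  the penalty e|x-y|^2 has the same gradient in x as minus its gradient in y. Subtracting the two
  viscosity inequalities therefore leaves only \<nu> - \<mu> \<le> V(y) - V(x), and the touching
  points merge as e grows. Since u and v are periodic under the same \<Lambda>, the penalised
  difference is invariant under joint translations and attains its maximum.
\<close>

lemma cell_levels_compare:
  fixes V :: "'a::euclidean_space \<Rightarrow> real"
  assumes \<Lambda>: "cocompact \<Lambda>"
    and u: "periodic_under \<Lambda> u" "continuous_on UNIV u"
    and v: "periodic_under \<Lambda> v" "continuous_on UNIV v"
    and V: "\<And>x y. \<bar>V x - V y\<bar> \<le> M * norm (x - y)"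
    and sub: "viscosity_subsolution (cell_operator V p \<mu>) u"
    and sup: "viscosity_supersolution (cell_operator V p \<nu>) v"
  shows "\<nu> \<le> \<mu>"
proof (rule ccontr)
  assume "\<not> \<nu> \<le> \<mu>"
  then have gap: "0 < \<nu> - \<mu>" by simp
  obtain R where R: "\<And>x. \<exists>z\<in>\<Lambda>. norm (x + z) \<le> R" using \<Lambda> by (auto simp: cocompact_def)
  have R0: "0 \<le> R" using R[of 0] norm_ge_zero order_trans by blast
  obtain Bu where Bu: "\<And>x. \<bar>u x\<bar> \<le> Bu" using periodic_bounded[OF \<Lambda> u] by blast
  obtain Bv where Bv: "\<And>x. \<bar>v x\<bar> \<le> Bv" using periodic_bounded[OF \<Lambda> v] by blast
  define B where "B = Bu + Bv + 1"
  have B: "\<bar>u x\<bar> + \<bar>v y\<bar> \<le> B" "\<bar>u x\<bar> \<le> B" "\<bar>v x\<bar> \<le> B" for x y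
    using Bu[of x] Bv[of y] Bv[of x] by (auto simp: B_def)
  have B1: "1 \<le> B" using Bu[of 0] Bv[of 0] by (auto simp: B_def)
  have est: "(\<nu> - \<mu>)\<^sup>2 \<le> M\<^sup>2 * (2 * B * (1 / e))" if e: "0 < e" for e
  proof -
    define \<Phi> where "\<Phi> = (\<lambda>w. u (fst w) - v (snd w) - e * (norm (fst w - snd w))\<^sup>2)"
    \<comment> \<open>Beyond this distance the penalty outweighs the oscillation of u and v, so the maximum may be
      sought on a compact set.\<close>
    define r where "r = sqrt (2 * B / e)"
    have r: "0 \<le> r" "e * r\<^sup>2 = 2 * B" using e B1 by (auto simp: r_def)
    let ?K = "cball (0::'a) R \<times> cball (0::'a) (R + r)"
    have cont: "continuous_on UNIV \<Phi>" unfolding \<Phi>_def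
      by (intro continuous_intros continuous_on_compose2[OF u(2)] continuous_on_compose2[OF v(2)]) auto
    have ne: "?K \<noteq> {}" using R0 r by auto
    have comp: "compact ?K" by (intro compact_Times compact_cball)
    obtain w where w: "w \<in> ?K" "\<And>w'. w' \<in> ?K \<Longrightarrow> \<Phi> w' \<le> \<Phi> w"
      using continuous_attains_sup[OF comp ne continuous_on_subset[OF cont subset_UNIV]] by blast
    obtain x y where xy: "w = (x, y)" by fastforce
    have max: "\<Phi> (a, b) \<le> \<Phi> (x, y)" for a b
    proof -
      obtain z where z: "z \<in> \<Lambda>" "norm (a + z) \<le> R" using R by blast
      have sh: "\<Phi> (a + z, b + z) = \<Phi> (a, b)" for b
        using u(1) v(1) z(1) by (simp add: \<Phi>_def periodic_under_def)
      show ?thesis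
      proof (cases "norm (a - b) \<le> r")
        case True
        have "norm (b + z) \<le> norm (a + z) + norm (b - a)"
          using norm_triangle_ineq[of "a + z" "b - a"] by (simp add: algebra_simps)
        then have "(a + z, b + z) \<in> ?K" using z True by (auto simp: norm_minus_commute)
        then show ?thesis using w(2) sh xy by metis
      next
        case False
        then have "r\<^sup>2 \<le> (norm (a - b))\<^sup>2" using r(1) by (intro power_mono) auto
        then have "e * r\<^sup>2 \<le> e * (norm (a - b))\<^sup>2" using e by simp
        then have "\<Phi> (a, b) \<le> - B" using B(1)[of a b] r(2) by (simp add: \<Phi>_def)
        also have "\<dots> \<le> \<Phi> (a, a)" using B(1)[of a a] by (simp add: \<Phi>_def)
        also have "\<dots> = \<Phi> (a + z, a + z)" using sh by simp
        also have "\<dots> \<le> \<Phi> w" using z r by (intro w(2)) auto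
        finally show ?thesis using xy by simp
      qed
    qed
    have "\<forall>\<^sub>F a in nhds x. u a - e * (norm (a - y))\<^sup>2 \<le> u x - e * (norm (x - y))\<^sup>2"
      using max[of _ y] by (intro always_eventually allI) (simp add: \<Phi>_def algebra_simps)
    from sub[unfolded viscosity_subsolution_def, rule_format, OF C1_square_dist this]
    have 1: "1/2 * (norm (p + (2 * e) *\<^sub>R (x - y)))\<^sup>2 + V x - \<mu> \<le> 0" .
    have "\<forall>\<^sub>F b in nhds y. v b - - e * (norm (b - x))\<^sup>2 \<ge> v y - - e * (norm (y - x))\<^sup>2"
      using max[of x] by (intro always_eventually allI) (simp add: \<Phi>_def algebra_simps norm_minus_commute)
    from sup[unfolded viscosity_supersolution_def, rule_format, OF C1_square_dist this]
    have "0 \<le> 1/2 * (norm (p + (2 * - e) *\<^sub>R (y - x)))\<^sup>2 + V y - \<nu>" .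
    also have "p + (2 * - e) *\<^sub>R (y - x) = p + (2 * e) *\<^sub>R (x - y)" by (simp add: algebra_simps)
    finally have 2: "\<nu> - \<mu> \<le> V y - V x" using 1 by linarith
    have "e * (norm (x - y))\<^sup>2 \<le> v x - v y" using max[of x x] by (simp add: \<Phi>_def)
    then have "e * (norm (x - y))\<^sup>2 \<le> 2 * B" using B(3)[of x] B(3)[of y] by linarith
    then have 3: "(norm (x - y))\<^sup>2 \<le> 2 * B * (1 / e)" using e by (simp add: field_simps)
    have "\<nu> - \<mu> \<le> M * norm (y - x)" using 2 V[of y x] by linarith
    then have "(\<nu> - \<mu>)\<^sup>2 \<le> (M * norm (x - y))\<^sup>2"
      using gap by (intro power_mono) (auto simp: norm_minus_commute)
    also have "\<dots> \<le> M\<^sup>2 * (2 * B * (1 / e))"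
      unfolding power_mult_distrib using 3 by (intro mult_left_mono) auto
    finally show ?thesis .
  qed
  \<comment> \<open>With this penalty the bound \<open>est\<close> bounds (\<nu>-\<mu>)^2 by a multiple less than
    one of itself.\<close>
  define e where "e = (2 * M\<^sup>2 * B + 1) / (\<nu> - \<mu>)\<^sup>2"
  have pos: "0 < 2 * M\<^sup>2 * B + 1"
    by (smt (verit) B1 mult_nonneg_nonneg zero_le_power2)
  then have "e > 0" using gap by (simp add: e_def)
  from est[OF this] have "(\<nu> - \<mu>)\<^sup>2 \<le> 2 * M\<^sup>2 * B * (\<nu> - \<mu>)\<^sup>2 / (2 * M\<^sup>2 * B + 1)"
    by (simp add: e_def mult_ac)
  then have "(\<nu> - \<mu>)\<^sup>2 * (2 * M\<^sup>2 * B + 1) \<le> 2 * M\<^sup>2 * B * (\<nu> - \<mu>)\<^sup>2"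
    using pos by (simp add: pos_le_divide_eq)
  then have "(\<nu> - \<mu>)\<^sup>2 \<le> 0" by (simp add: algebra_simps)
  then show False using gap by simp
qed

section \<open>Limits of discrete dynamic programming equations\<close>

text \<open>
  By the mean value theorem the quotient is a gradient at a point that tends to x0, so continuity
  of the gradient suffices even though base point, direction and step all vary.
\<close>

lemma C1_difference_quotient:
  fixes \<phi> :: "'a::euclidean_space \<Rightarrow> real"
  assumes C1: "C1_with_gradient \<phi> D\<phi>"
    and x: "x \<longlonglongrightarrow> x0" and h: "h \<longlonglongrightarrow> 0" "\<And>j. 0 < h j" and \<xi>: "\<xi> \<longlonglongrightarrow> \<xi>0"
  shows "(\<lambda>j. (\<phi> (x j) - \<phi> (x j - h j *\<^sub>R \<xi> j)) / h j) \<longlonglongrightarrow> D\<phi> x0 \<bullet> \<xi>0"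
proof -
  have "\<exists>\<theta>. 0 < \<theta> \<and> \<theta> < 1 \<and>
      (\<phi> (x j) - \<phi> (x j - h j *\<^sub>R \<xi> j)) / h j = D\<phi> (x j - (\<theta> * h j) *\<^sub>R \<xi> j) \<bullet> \<xi> j" for j
  proof -
    let ?g = "\<lambda>t. - \<phi> (x j - (t * h j) *\<^sub>R \<xi> j)"
    let ?g' = "\<lambda>t. D\<phi> (x j - (t * h j) *\<^sub>R \<xi> j) \<bullet> (h j *\<^sub>R \<xi> j)"
    have der: "DERIV ?g t :> ?g' t" for t
    proof -
      have 1: "((\<lambda>t. x j - (t * h j) *\<^sub>R \<xi> j) has_derivative (\<lambda>t. - (t * h j) *\<^sub>R \<xi> j)) (at t)"
        by (auto intro!: derivative_eq_intros)
      have 2: "(\<phi> has_derivative (\<lambda>v. v \<bullet> D\<phi> (x j - (t * h j) *\<^sub>R \<xi> j)))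
          (at (x j - (t * h j) *\<^sub>R \<xi> j))"
        using C1 by (simp add: C1_with_gradient_def gderiv_def)
      have "(?g has_derivative (\<lambda>t'. - ((- (t' * h j) *\<^sub>R \<xi> j) \<bullet> D\<phi> (x j - (t * h j) *\<^sub>R \<xi> j)))) (at t)"
        by (rule has_derivative_minus[OF has_derivative_compose[OF 1 2]])
      then show ?thesis
        by (simp add: has_field_derivative_def inner_commute mult_ac mult_commute_abs)
    qed
    have "\<exists>\<theta>. 0 < \<theta> \<and> \<theta> < 1 \<and> ?g 1 - ?g 0 = (1 - 0) * ?g' \<theta>"
      by (rule MVT2) (use der in auto)
    then obtain \<theta> where "0 < \<theta>" "\<theta> < 1" and eq: "?g 1 - ?g 0 = ?g' \<theta>" by auto
    moreover have "\<phi> (x j) - \<phi> (x j - h j *\<^sub>R \<xi> j) = h j * (D\<phi> (x j - (\<theta> * h j) *\<^sub>R \<xi> j) \<bullet> \<xi> j)"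
      using eq by simp
    ultimately show ?thesis using h(2)[of j] by (intro exI[of _ \<theta>]) simp
  qed
  then obtain \<theta> where \<theta>: "\<And>j. 0 < \<theta> j" "\<And>j. \<theta> j < 1"
      "\<And>j. (\<phi> (x j) - \<phi> (x j - h j *\<^sub>R \<xi> j)) / h j = D\<phi> (x j - (\<theta> j * h j) *\<^sub>R \<xi> j) \<bullet> \<xi> j"
    by metis
  have "(\<lambda>j. \<theta> j * h j) \<longlonglongrightarrow> 0"
  proof (rule tendsto_sandwich[OF _ _ tendsto_const h(1)])
    show "\<forall>\<^sub>F j in sequentially. 0 \<le> \<theta> j * h j"
      using \<theta>(1) h(2) by (intro always_eventually allI mult_nonneg_nonneg less_imp_le)
    show "\<forall>\<^sub>F j in sequentially. \<theta> j * h j \<le> h j"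
      using \<theta>(2) h(2) by (intro always_eventually allI) (simp add: less_imp_le mult_left_le_one_le \<theta>(1))
  qed
  from tendsto_diff[OF x tendsto_scaleR[OF this \<xi>]]
  have "(\<lambda>j. x j - (\<theta> j * h j) *\<^sub>R \<xi> j) \<longlonglongrightarrow> x0" by simp
  moreover have "isCont D\<phi> x0"
    using C1 by (simp add: C1_with_gradient_def continuous_on_eq_continuous_at)
  ultimately have "(\<lambda>j. D\<phi> (x j - (\<theta> j * h j) *\<^sub>R \<xi> j)) \<longlonglongrightarrow> D\<phi> x0"
    by (rule isCont_tendsto_compose[rotated])
  from tendsto_inner[OF this \<xi>] show ?thesis by (simp only: \<theta>(3))
qed

text \<open>
  Adding |y - x0|^2 makes the maximum at x0 strict without changing the gradient of the test
  function there; maxima of uniformly close functions must then be near x0.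
\<close>

lemma perturbed_maximum_points_converge:
  fixes w :: "nat \<Rightarrow> 'a::euclidean_space \<Rightarrow> real"
  assumes lim: "uniform_limit UNIV w W sequentially"
    and w: "\<And>j. continuous_on UNIV (w j)" and \<phi>: "continuous_on UNIV \<phi>"
    and max: "\<forall>\<^sub>F y in nhds x0. W y - \<phi> y \<le> W x0 - \<phi> x0"
  obtains x r where "0 < r" "x \<longlonglongrightarrow> x0"
    "\<And>j y. dist x0 y \<le> r \<Longrightarrow>
       w j y - (\<phi> y + (norm (y - x0))\<^sup>2) \<le> w j (x j) - (\<phi> (x j) + (norm (x j - x0))\<^sup>2)"
proof -
  obtain d where d: "d > 0" "\<And>y. dist y x0 < d \<Longrightarrow> W y - \<phi> y \<le> W x0 - \<phi> x0"
    using max unfolding eventually_nhds_metric by blast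
  define r where "r = d / 2"
  have r: "r > 0" "\<And>y. dist x0 y \<le> r \<Longrightarrow> W y - \<phi> y \<le> W x0 - \<phi> x0"
    using d by (auto simp: r_def dist_commute)
  have "\<exists>x. dist x0 x \<le> r \<and> (\<forall>y. dist x0 y \<le> r \<longrightarrow>
       w j y - (\<phi> y + (norm (y - x0))\<^sup>2) \<le> w j x - (\<phi> x + (norm (x - x0))\<^sup>2))" for j
  proof -
    have "continuous_on (cball x0 r) (\<lambda>y. w j y - (\<phi> y + (norm (y - x0))\<^sup>2))"
      by (intro continuous_intros continuous_on_subset[OF w] continuous_on_subset[OF \<phi>] subset_UNIV)
    moreover have "cball x0 r \<noteq> {}" using r by simp
    ultimately show ?thesis
      using continuous_attains_sup[of "cball x0 r" "\<lambda>y. w j y - (\<phi> y + (norm (y - x0))\<^sup>2)"]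
      by (auto simp: Ball_def)
  qed
  then obtain x where x: "\<And>j. dist x0 (x j) \<le> r"
    "\<And>j y. dist x0 y \<le> r \<Longrightarrow>
       w j y - (\<phi> y + (norm (y - x0))\<^sup>2) \<le> w j (x j) - (\<phi> (x j) + (norm (x j - x0))\<^sup>2)"
    by metis
  have "x \<longlonglongrightarrow> x0"
  proof (rule tendstoI)
    fix e :: real assume e: "0 < e"
    have "\<forall>\<^sub>F j in sequentially. \<forall>y\<in>UNIV. dist (w j y) (W y) < e\<^sup>2 / 2"
      using uniform_limitD[OF lim, of "e\<^sup>2 / 2"] e by simp
    then show "\<forall>\<^sub>F j in sequentially. dist (x j) x0 < e"
    proof eventually_elim
      case (elim j)
      have "\<bar>w j (x j) - W (x j)\<bar> < e\<^sup>2 / 2" "\<bar>w j x0 - W x0\<bar> < e\<^sup>2 / 2"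
        using elim by (auto simp: dist_real_def)
      moreover have "W (x j) - \<phi> (x j) \<le> W x0 - \<phi> x0" using r(2)[OF x(1)] .
      moreover have "w j x0 - \<phi> x0 \<le> w j (x j) - (\<phi> (x j) + (norm (x j - x0))\<^sup>2)"
        using x(2)[of x0 j] r(1) by simp
      ultimately have "(norm (x j - x0))\<^sup>2 < e\<^sup>2" by linarith
      then show ?case using e by (simp add: dist_norm power2_less_imp_less)
    qed
  qed
  then show ?thesis using that[OF r(1) _ x(2)] by blast
qed

text \<open>
  The hypotheses say that w_j satisfies, up to \<delta>_j, the dynamic programming equation w(x) =
  min over \<xi> of w(x - h\<xi>) + h L(x,\<xi>) with Lagrangian L = |\<xi>|^2/2 - p \<bullet>
  \<xi> - V + \<mu>. Any admissible \<xi> gives the subsolution inequality in the limit, an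
  optimal one the supersolution inequality, and |p + q|^2/2 = max over \<xi> of (p+q) \<bullet>
  \<xi> - |\<xi>|^2/2 turns them into the cell equation. Restricting to speeds |\<xi>| \<le> R
  keeps all minima on compact sets; it is harmless because a momentum larger than R would violate
  the bound on \<mu> - V.
\<close>

lemma discrete_solutions_converge_to_viscosity_solution:
  fixes w :: "nat \<Rightarrow> 'a::euclidean_space \<Rightarrow> real"
  assumes h: "h \<longlonglongrightarrow> 0" "\<And>j. 0 < h j" and \<delta>: "\<delta> \<longlonglongrightarrow> 0"
    and lim: "uniform_limit UNIV w W sequentially"
    and w: "\<And>j. continuous_on UNIV (w j)" and V: "continuous_on UNIV V"
    and le: "\<And>j x \<xi>. norm \<xi> \<le> R \<Longrightarrow>
        w j x - w j (x - h j *\<^sub>R \<xi>) \<le> h j * ((norm \<xi>)\<^sup>2 / 2 - p \<bullet> \<xi> - V x + \<mu> + \<delta> j)"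
    and ge: "\<And>j x. \<exists>\<xi>. norm \<xi> \<le> R \<and>
        h j * ((norm \<xi>)\<^sup>2 / 2 - p \<bullet> \<xi> - V x + \<mu> - \<delta> j) \<le> w j x - w j (x - h j *\<^sub>R \<xi>)"
    and R: "0 \<le> R" "\<And>x. \<mu> - V x < R\<^sup>2 / 2"
  shows "continuous_viscosity_solution (cell_operator V p \<mu>) W"
  unfolding continuous_viscosity_solution_def
proof (intro conjI)
  show "continuous_on UNIV W"
    by (rule uniform_limit_theorem[OF _ lim]) (use w in auto)
  have Vlim: "(\<lambda>j. V (x j)) \<longlonglongrightarrow> V x0" if "x \<longlonglongrightarrow> x0" for x x0
    using continuous_on_tendsto_compose[OF V that] by simp
  show "viscosity_subsolution (cell_operator V p \<mu>) W"
    unfolding viscosity_subsolution_def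
  proof (intro allI impI)
    fix \<phi> D\<phi> x0
    assume C1: "C1_with_gradient \<phi> D\<phi>" and max: "\<forall>\<^sub>F y in nhds x0. W y - \<phi> y \<le> W x0 - \<phi> x0"
    obtain x r where r: "0 < r" and x: "x \<longlonglongrightarrow> x0" and
      top: "\<And>j y. dist x0 y \<le> r \<Longrightarrow>
       w j y - (\<phi> y + (norm (y - x0))\<^sup>2) \<le> w j (x j) - (\<phi> (x j) + (norm (x j - x0))\<^sup>2)"
      by (rule perturbed_maximum_points_converge[OF lim w C1_continuous[OF C1] max]) blast
    let ?\<psi> = "\<lambda>y. \<phi> y + 1 * (norm (y - x0))\<^sup>2"
    note C1\<psi> = C1_add[OF C1 C1_square_dist[of 1 x0]]
    define q where "q = p + D\<phi> x0"
    have bound: "q \<bullet> \<xi> \<le> (norm \<xi>)\<^sup>2 / 2 - V x0 + \<mu>" if \<xi>: "norm \<xi> \<le> R" for \<xi>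
    proof -
      have l: "(\<lambda>j. (?\<psi> (x j) - ?\<psi> (x j - h j *\<^sub>R \<xi>)) / h j) \<longlonglongrightarrow> D\<phi> x0 \<bullet> \<xi>"
        using C1_difference_quotient[OF C1\<psi> x h tendsto_const[of \<xi>]]
        by (simp only: diff_self scaleR_zero_right add_0_right)
      have u: "(\<lambda>j. (norm \<xi>)\<^sup>2 / 2 - p \<bullet> \<xi> - V (x j) + \<mu> + \<delta> j)
          \<longlonglongrightarrow> (norm \<xi>)\<^sup>2 / 2 - p \<bullet> \<xi> - V x0 + \<mu> + 0"
        by (intro tendsto_intros Vlim x \<delta>)
      have "(\<lambda>j. x j - h j *\<^sub>R \<xi>) \<longlonglongrightarrow> x0"
        using tendsto_diff[OF x tendsto_scaleR[OF h(1) tendsto_const[of \<xi>]]] by simp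
      then have "\<forall>\<^sub>F j in sequentially. dist (x j - h j *\<^sub>R \<xi>) x0 < r"
        using r by (rule tendstoD)
      then have ev: "\<forall>\<^sub>F j in sequentially. (?\<psi> (x j) - ?\<psi> (x j - h j *\<^sub>R \<xi>)) / h j
          \<le> (norm \<xi>)\<^sup>2 / 2 - p \<bullet> \<xi> - V (x j) + \<mu> + \<delta> j"
      proof eventually_elim
        case (elim j)
        then have "?\<psi> (x j) - ?\<psi> (x j - h j *\<^sub>R \<xi>) \<le> w j (x j) - w j (x j - h j *\<^sub>R \<xi>)"
          using top[of "x j - h j *\<^sub>R \<xi>" j] by (simp add: dist_commute)
        also note le[OF \<xi>]
        finally show ?case using h(2)[of j] by (simp add: pos_divide_le_eq mult.commute)
      qed
      have "D\<phi> x0 \<bullet> \<xi> \<le> (norm \<xi>)\<^sup>2 / 2 - p \<bullet> \<xi> - V x0 + \<mu> + 0"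
        by (rule tendsto_le[OF _ u l ev]) simp
      then show ?thesis by (simp add: q_def inner_add_left)
    qed
    have "norm q \<le> R"
    proof (rule ccontr)
      assume "\<not> norm q \<le> R"
      then have qR: "R < norm q" by simp
      then have q0: "norm q > 0" using R(1) by linarith
      \<comment> \<open>The largest admissible speed in direction q already gains R|q| - R^2/2 \<ge> R^2/2 > \<mu> - V.\<close>
      let ?\<xi> = "(R / norm q) *\<^sub>R q"
      have n: "norm ?\<xi> = R" using q0 R(1) by simp
      have "q \<bullet> ?\<xi> = R * norm q"
        using q0 by (simp add: dot_square_norm power2_eq_square)
      with bound[of ?\<xi>] n have "R * norm q \<le> R\<^sup>2 / 2 - V x0 + \<mu>" by simp
      moreover have "R\<^sup>2 \<le> R * norm q"
        using qR R(1) by (simp add: power2_eq_square mult_left_mono)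
      ultimately show False using R(2)[of x0] by linarith
    qed
    from bound[OF this] have "(norm q)\<^sup>2 \<le> (norm q)\<^sup>2 / 2 - V x0 + \<mu>"
      by (simp add: dot_square_norm)
    then show "1/2 * (norm (p + D\<phi> x0))\<^sup>2 + V x0 - \<mu> \<le> 0" by (simp add: q_def)
  qed
  show "viscosity_supersolution (cell_operator V p \<mu>) W"
    unfolding viscosity_supersolution_def
  proof (intro allI impI)
    fix \<phi> D\<phi> x0
    assume C1: "C1_with_gradient \<phi> D\<phi>" and min: "\<forall>\<^sub>F y in nhds x0. W x0 - \<phi> x0 \<le> W y - \<phi> y"
    have lim': "uniform_limit UNIV (\<lambda>j y. - w j y) (\<lambda>y. - W y) sequentially"
      by (rule uniform_limit_uminus[OF lim])
    have w': "continuous_on UNIV (\<lambda>y. - w j y)" for j by (intro continuous_intros w)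
    have \<phi>': "continuous_on UNIV (\<lambda>y. - \<phi> y)" by (intro continuous_intros C1_continuous[OF C1])
    have max: "\<forall>\<^sub>F y in nhds x0. - W y - - \<phi> y \<le> - W x0 - - \<phi> x0"
      using min by eventually_elim simp
    obtain x r where r: "0 < r" and x: "x \<longlonglongrightarrow> x0" and
      top: "\<And>j y. dist x0 y \<le> r \<Longrightarrow>
       - w j y - (- \<phi> y + (norm (y - x0))\<^sup>2) \<le> - w j (x j) - (- \<phi> (x j) + (norm (x j - x0))\<^sup>2)"
      by (rule perturbed_maximum_points_converge[OF lim' w' \<phi>' max]) blast
    have "\<forall>j. \<exists>\<xi>. norm \<xi> \<le> R \<and>
        h j * ((norm \<xi>)\<^sup>2 / 2 - p \<bullet> \<xi> - V (x j) + \<mu> - \<delta> j) \<le> w j (x j) - w j (x j - h j *\<^sub>R \<xi>)"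
      using ge by blast
    then obtain \<xi> where \<xi>: "\<And>j. norm (\<xi> j) \<le> R" and
      \<xi>ge: "\<And>j. h j * ((norm (\<xi> j))\<^sup>2 / 2 - p \<bullet> \<xi> j - V (x j) + \<mu> - \<delta> j)
          \<le> w j (x j) - w j (x j - h j *\<^sub>R \<xi> j)"
      unfolding choice_iff by blast
    have "\<forall>j. \<xi> j \<in> cball 0 R" using \<xi> by simp
    with compact_cball[of "0::'a" R, unfolded compact_def, rule_format, of \<xi>]
    obtain \<xi>0 \<rho> where \<rho>: "strict_mono (\<rho> :: nat \<Rightarrow> nat)" and \<xi>0: "(\<xi> \<circ> \<rho>) \<longlonglongrightarrow> \<xi>0"
      by blast
    note sub = LIMSEQ_subseq_LIMSEQ[OF _ \<rho>, unfolded comp_def]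
    let ?\<psi> = "\<lambda>y. \<phi> y + (-1) * (norm (y - x0))\<^sup>2"
    note C1\<psi> = C1_add[OF C1 C1_square_dist[of "-1" x0]]
    have \<xi>0': "(\<lambda>j. \<xi> (\<rho> j)) \<longlonglongrightarrow> \<xi>0" using \<xi>0 by (simp add: comp_def)
    have l: "(\<lambda>j. (?\<psi> (x (\<rho> j)) - ?\<psi> (x (\<rho> j) - h (\<rho> j) *\<^sub>R \<xi> (\<rho> j))) / h (\<rho> j)) \<longlonglongrightarrow> D\<phi> x0 \<bullet> \<xi>0"
      using C1_difference_quotient[OF C1\<psi> sub[OF x] sub[OF h(1)] h(2) \<xi>0']
      by (simp only: diff_self scaleR_zero_right add_0_right)
    have u: "(\<lambda>j. (norm (\<xi> (\<rho> j)))\<^sup>2 / 2 - p \<bullet> \<xi> (\<rho> j) - V (x (\<rho> j)) + \<mu> - \<delta> (\<rho> j))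
          \<longlonglongrightarrow> (norm \<xi>0)\<^sup>2 / 2 - p \<bullet> \<xi>0 - V x0 + \<mu> - 0"
      by (intro tendsto_intros Vlim sub[OF x] sub[OF \<delta>] \<xi>0') simp
    have "(\<lambda>j. x (\<rho> j) - h (\<rho> j) *\<^sub>R \<xi> (\<rho> j)) \<longlonglongrightarrow> x0"
      using tendsto_diff[OF sub[OF x] tendsto_scaleR[OF sub[OF h(1)] \<xi>0']] by simp
    then have "\<forall>\<^sub>F j in sequentially. dist (x (\<rho> j) - h (\<rho> j) *\<^sub>R \<xi> (\<rho> j)) x0 < r"
      using r by (rule tendstoD)
    then have ev: "\<forall>\<^sub>F j in sequentially.
          (norm (\<xi> (\<rho> j)))\<^sup>2 / 2 - p \<bullet> \<xi> (\<rho> j) - V (x (\<rho> j)) + \<mu> - \<delta> (\<rho> j)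
          \<le> (?\<psi> (x (\<rho> j)) - ?\<psi> (x (\<rho> j) - h (\<rho> j) *\<^sub>R \<xi> (\<rho> j))) / h (\<rho> j)"
    proof eventually_elim
      case (elim j)
      let ?i = "\<rho> j"
      note \<xi>ge[of ?i]
      also have "w ?i (x ?i) - w ?i (x ?i - h ?i *\<^sub>R \<xi> ?i)
          \<le> ?\<psi> (x ?i) - ?\<psi> (x ?i - h ?i *\<^sub>R \<xi> ?i)"
        using top[of "x ?i - h ?i *\<^sub>R \<xi> ?i" ?i] elim by (simp add: dist_commute)
      finally show ?case using h(2)[of ?i] by (simp add: pos_le_divide_eq mult.commute)
    qed
    have "(norm \<xi>0)\<^sup>2 / 2 - p \<bullet> \<xi>0 - V x0 + \<mu> - 0 \<le> D\<phi> x0 \<bullet> \<xi>0"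
      by (rule tendsto_le[OF _ l u ev]) simp
    moreover have "(p + D\<phi> x0) \<bullet> \<xi>0 \<le> (norm (p + D\<phi> x0))\<^sup>2 / 2 + (norm \<xi>0)\<^sup>2 / 2"
    proof -
      have "0 \<le> (norm (p + D\<phi> x0 - \<xi>0))\<^sup>2" by simp
      then show ?thesis by (simp add: power2_norm_eq_inner inner_diff_left inner_diff_right inner_commute)
    qed
    ultimately show "0 \<le> 1/2 * (norm (p + D\<phi> x0))\<^sup>2 + V x0 - \<mu>"
      by (simp add: inner_add_left)
  qed
qed

section \<open>Existence of periodic viscosity solutions\<close>

lemma tendsto_apply_bcontfun:
  "f \<longlonglongrightarrow> l \<Longrightarrow> (\<lambda>n. apply_bcontfun (f n) x) \<longlonglongrightarrow> apply_bcontfun l x"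
  by (rule tendsto_uniform_limitI[OF tendsto_bcontfun_uniform_limit]) auto

lemma lipschitz_continuous:
  fixes u :: "'a::real_normed_vector \<Rightarrow> real"
  assumes "\<And>x y. \<bar>u x - u y\<bar> \<le> L * norm (x - y)"
  shows "continuous_on S u"
proof -
  have "0 \<le> L * norm (x - y)" for x y :: 'a
    using assms[of x y] abs_ge_zero order_trans by blast
  then have "\<bar>u x - u y\<bar> \<le> \<bar>L\<bar> * norm (x - y)" for x y
    using assms[of x y] by (metis abs_mult abs_norm_cancel abs_of_nonneg)
  then have "\<bar>L\<bar>-lipschitz_on S u"
    by (auto simp: lipschitz_on_def dist_norm)
  then show ?thesis by (rule lipschitz_on_continuous_on)
qed

text \<open>
  The dynamic programming equation with time step s^2 and discount factor 1 - s^3, as an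
  inequality for every admissible speed together with equality for an optimal one, and bounds of
  order 1/s.
\<close>

abbreviation discounted_value_function ::
    "'a::euclidean_space set \<Rightarrow> ('a \<Rightarrow> real) \<Rightarrow> 'a \<Rightarrow> real \<Rightarrow> real \<Rightarrow> real \<Rightarrow> real \<Rightarrow> ('a \<Rightarrow> real) \<Rightarrow> bool" where
  "discounted_value_function \<Lambda> V p M D R s u \<equiv>
    periodic_under \<Lambda> u \<and> (\<forall>x y. \<bar>u x - u y\<bar> \<le> M / s * norm (x - y)) \<and>
    (\<forall>x. \<bar>u x\<bar> \<le> D / s) \<and>
    (\<forall>x \<xi>. norm \<xi> \<le> R \<longrightarrow>
       u x \<le> (1 - s^3) * u (x - s\<^sup>2 *\<^sub>R \<xi>) + s\<^sup>2 * ((norm \<xi>)\<^sup>2 / 2 - p \<bullet> \<xi> - V x)) \<and>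
    (\<forall>x. \<exists>\<xi>. norm \<xi> \<le> R \<and>
       u x = (1 - s^3) * u (x - s\<^sup>2 *\<^sub>R \<xi>) + s\<^sup>2 * ((norm \<xi>)\<^sup>2 / 2 - p \<bullet> \<xi> - V x))"

text \<open>
  Banach's fixed point theorem: discounting makes the minimisation over one time step a
  contraction. The set of Lipschitz functions with constant M/s is invariant since (1-s^3) M/s +
  s^2 M = M/s, and the same computation preserves the bound.
\<close>

lemma discounted_value_function_exists:
  fixes V :: "'a::euclidean_space \<Rightarrow> real"
  assumes per: "periodic_under \<Lambda> V" and lip: "\<And>x y. \<bar>V x - V y\<bar> \<le> M * norm (x - y)"
    and B: "\<And>x. \<bar>V x\<bar> \<le> B" and s: "0 < s" "s \<le> 1" and R: "0 \<le> R"
  shows "\<exists>u. discounted_value_function \<Lambda> V p M (B + (norm p)\<^sup>2 / 2) R s u"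
proof -
  define D where "D = B + (norm p)\<^sup>2 / 2"
  define G where "G = (\<lambda>u x \<xi>. (1 - s^3) * u (x - s\<^sup>2 *\<^sub>R \<xi>) + s\<^sup>2 * ((norm \<xi>)\<^sup>2 / 2 - p \<bullet> \<xi> - V x))"
  define T where "T = (\<lambda>u x. Inf (G u x ` cball 0 R))"
  have b: "0 \<le> 1 - s^3" "1 - s^3 < 1" using s by (auto simp: power_le_one)
  have s3: "s^3 = s * s\<^sup>2" by (simp add: power3_eq_cube power2_eq_square)
  have T_attained: "\<exists>\<xi>. norm \<xi> \<le> R \<and> T u x = G u x \<xi> \<and> (\<forall>\<eta>. norm \<eta> \<le> R \<longrightarrow> T u x \<le> G u x \<eta>)"
    if u: "continuous_on UNIV u" for u x
  proof -
    have "continuous_on (cball 0 R) (G u x)"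
      unfolding G_def by (intro continuous_intros continuous_on_compose2[OF u]) auto
    moreover have "cball (0::'a) R \<noteq> {}" using R by simp
    ultimately obtain \<xi> where \<xi>: "\<xi> \<in> cball 0 R" "\<And>\<eta>. \<eta> \<in> cball 0 R \<Longrightarrow> G u x \<xi> \<le> G u x \<eta>"
      using continuous_attains_inf[OF compact_cball] by blast
    have "T u x = G u x \<xi>" unfolding T_def by (rule cInf_eq_minimum) (use \<xi> in auto)
    then show ?thesis using \<xi> by (intro exI[of _ \<xi>]) auto
  qed
  have T_mono: "T u x \<le> T v y + c"
    if "continuous_on UNIV u" "continuous_on UNIV v"
      "\<And>\<xi>. norm \<xi> \<le> R \<Longrightarrow> G u x \<xi> \<le> G v y \<xi> + c" for u v x y c
    using T_attained[OF that(1), of x] T_attained[OF that(2), of y] that(3) by fastforce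
  define S where "S = {f :: 'a \<Rightarrow>\<^sub>C real. periodic_under \<Lambda> (apply_bcontfun f) \<and>
     (\<forall>x y. \<bar>apply_bcontfun f x - apply_bcontfun f y\<bar> \<le> M / s * norm (x - y)) \<and>
     (\<forall>x. \<bar>apply_bcontfun f x\<bar> \<le> D / s)}"
  have "closed S" unfolding closed_sequential_limits
  proof (intro allI impI, elim conjE)
    fix f l assume f: "\<forall>n. f n \<in> S" and l: "f \<longlonglongrightarrow> l"
    note lim = tendsto_apply_bcontfun[OF l]
    have "apply_bcontfun l (x + z) = apply_bcontfun l x" if "z \<in> \<Lambda>" for x z
      by (rule LIMSEQ_unique[OF lim]) (use lim[of x] f that in \<open>simp add: S_def periodic_under_def\<close>)
    moreover have "\<bar>apply_bcontfun l x - apply_bcontfun l y\<bar> \<le> M / s * norm (x - y)" for x y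
      by (rule LIMSEQ_le_const2[OF tendsto_rabs[OF tendsto_diff[OF lim lim]]])
        (use f in \<open>auto simp: S_def\<close>)
    moreover have "\<bar>apply_bcontfun l x\<bar> \<le> D / s" for x
      by (rule LIMSEQ_le_const2[OF tendsto_rabs[OF lim]]) (use f in \<open>auto simp: S_def\<close>)
    ultimately show "l \<in> S" by (simp add: S_def periodic_under_def)
  qed
  then have complete: "complete S" by (simp add: complete_eq_closed)
  have M: "0 \<le> M"
  proof -
    obtain b :: 'a where "b \<in> Basis" using nonempty_Basis by blast
    then have "\<bar>V b - V 0\<bar> \<le> M" using lip[of b 0] by simp
    then show ?thesis using abs_ge_zero order_trans by blast
  qed
  have B0: "0 \<le> B" using B[of 0] abs_ge_zero order_trans by blast
  then have D: "0 \<le> D" "B \<le> D" by (auto simp: D_def)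
  have "0 \<in> S" using M s D by (simp add: S_def periodic_under_def)
  then have ne: "S \<noteq> {}" by blast
  have TS: "periodic_under \<Lambda> (T (apply_bcontfun f)) \<and>
     (\<forall>x y. \<bar>T (apply_bcontfun f) x - T (apply_bcontfun f) y\<bar> \<le> M / s * norm (x - y)) \<and>
     (\<forall>x. \<bar>T (apply_bcontfun f) x\<bar> \<le> D / s)" if f: "f \<in> S" for f
  proof (intro conjI allI)
    let ?u = "apply_bcontfun f"
    have cont: "continuous_on UNIV ?u" by simp
    have "G ?u (x + z) = G ?u x" if "z \<in> \<Lambda>" for x z
    proof
      fix \<xi>
      have "?u (x + z - s\<^sup>2 *\<^sub>R \<xi>) = ?u ((x - s\<^sup>2 *\<^sub>R \<xi>) + z)" by (simp add: algebra_simps)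
      also have "\<dots> = ?u (x - s\<^sup>2 *\<^sub>R \<xi>)" using f that unfolding S_def periodic_under_def by blast
      finally show "G ?u (x + z) \<xi> = G ?u x \<xi>"
        using per that by (simp add: G_def periodic_under_def)
    qed
    then show "periodic_under \<Lambda> (T ?u)" by (simp add: periodic_under_def T_def)
    have le: "T ?u x \<le> T ?u y + M / s * norm (x - y)" for x y
    proof (rule T_mono[OF cont cont])
      fix \<xi>
      have "?u (x - s\<^sup>2 *\<^sub>R \<xi>) - ?u (y - s\<^sup>2 *\<^sub>R \<xi>) \<le> M / s * norm (x - y)"
      proof -
        have "\<bar>?u (x - s\<^sup>2 *\<^sub>R \<xi>) - ?u (y - s\<^sup>2 *\<^sub>R \<xi>)\<bar>
            \<le> M / s * norm ((x - s\<^sup>2 *\<^sub>R \<xi>) - (y - s\<^sup>2 *\<^sub>R \<xi>))"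
          using f unfolding S_def by blast
        moreover have "(x - s\<^sup>2 *\<^sub>R \<xi>) - (y - s\<^sup>2 *\<^sub>R \<xi>) = x - y" by simp
        ultimately show ?thesis by (simp only: abs_le_iff)
      qed
      then have "(1 - s^3) * (?u (x - s\<^sup>2 *\<^sub>R \<xi>) - ?u (y - s\<^sup>2 *\<^sub>R \<xi>)) \<le> (1 - s^3) * (M / s * norm (x - y))"
        using b(1) by (rule mult_left_mono)
      moreover have "s\<^sup>2 * (V y - V x) \<le> s\<^sup>2 * (M * norm (x - y))"
        using lip[of x y] by (intro mult_left_mono) auto
      moreover have "(1 - s^3) * (M / s * norm (x - y)) + s\<^sup>2 * (M * norm (x - y)) = M / s * norm (x - y)"
        using s(1) by (simp add: s3 field_simps)
      ultimately show "G ?u x \<xi> \<le> G ?u y \<xi> + M / s * norm (x - y)"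
        by (simp add: G_def algebra_simps)
    qed
    show "\<bar>T ?u x - T ?u y\<bar> \<le> M / s * norm (x - y)" for x y
      using le[of x y] le[of y x] norm_minus_commute[of x y] by (simp add: abs_le_iff)
    show "\<bar>T ?u x\<bar> \<le> D / s" for x
    proof -
      obtain \<xi> where \<xi>: "T ?u x = G ?u x \<xi>" "T ?u x \<le> G ?u x 0"
        using T_attained[OF cont, of x] R by (metis norm_zero)
      have eq: "(1 - s^3) * (D / s) + s\<^sup>2 * D = D / s" using s(1) by (simp add: s3 field_simps)
      have bd: "\<bar>(1 - s^3) * ?u y\<bar> \<le> (1 - s^3) * (D / s)" for y
      proof -
        have ub: "\<bar>?u y\<bar> \<le> D / s" using f unfolding S_def by blast
        have "\<bar>(1 - s^3) * ?u y\<bar> = (1 - s^3) * \<bar>?u y\<bar>" using b(1) by (simp add: abs_mult)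
        also have "\<dots> \<le> (1 - s^3) * (D / s)" by (rule mult_left_mono[OF ub b(1)])
        finally show ?thesis .
      qed
      have "- V x \<le> D" using B[of x] D(2) by linarith
      then have "s\<^sup>2 * - V x \<le> s\<^sup>2 * D" by (intro mult_left_mono) auto
      then have up: "T ?u x \<le> D / s" using \<xi>(2) bd[of x] eq by (simp add: G_def)
      have "0 \<le> (norm (\<xi> - p))\<^sup>2" by simp
      then have "- D \<le> (norm \<xi>)\<^sup>2 / 2 - p \<bullet> \<xi> - V x"
        using B[of x] unfolding D_def
        by (simp add: power2_norm_eq_inner inner_diff_left inner_diff_right inner_commute)
      then have "s\<^sup>2 * - D \<le> s\<^sup>2 * ((norm \<xi>)\<^sup>2 / 2 - p \<bullet> \<xi> - V x)" by (intro mult_left_mono) auto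
      then have "- (D / s) \<le> T ?u x" using \<xi>(1) bd[of "x - s\<^sup>2 *\<^sub>R \<xi>"] eq by (simp add: G_def)
      with up show ?thesis by linarith
    qed
  qed
  define F where "F = (\<lambda>f. Bcontfun (T (apply_bcontfun f)))"
  have F: "apply_bcontfun (F f) = T (apply_bcontfun f)" if "f \<in> S" for f
    unfolding F_def
  proof (rule Bcontfun_inverse, rule bcontfun_normI)
    show "continuous_on UNIV (T (apply_bcontfun f))"
      using TS[OF that] by (intro lipschitz_continuous[of _ "M / s"]) blast
    show "norm (T (apply_bcontfun f) x) \<le> D / s" for x using TS[OF that] by simp
  qed
  have "F ` S \<subseteq> S" using TS F by (auto simp: S_def)
  moreover have "dist (F f) (F g) \<le> (1 - s^3) * dist f g" if "f \<in> S" "g \<in> S" for f g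
  proof (rule dist_bound)
    fix x
    have le: "T (apply_bcontfun f) x \<le> T (apply_bcontfun g) x + (1 - s^3) * dist f g" for f g :: "'a \<Rightarrow>\<^sub>C real"
    proof (rule T_mono)
      fix \<xi>
      have "apply_bcontfun f y - apply_bcontfun g y \<le> dist f g" for y
        using dist_bounded[of f y g] by (simp add: dist_real_def)
      from mult_left_mono[OF this[of "x - s\<^sup>2 *\<^sub>R \<xi>"] b(1)]
      show "G (apply_bcontfun f) x \<xi> \<le> G (apply_bcontfun g) x \<xi> + (1 - s^3) * dist f g"
        by (simp add: G_def algebra_simps)
    qed auto
    from le[of f g] le[of g f] show "dist (F f x) (F g x) \<le> (1 - s^3) * dist f g"
      by (simp add: F that dist_real_def dist_commute abs_le_iff)
  qed
  ultimately obtain f where f: "f \<in> S" "F f = f"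
    using Banach_fix[OF complete ne b, of F] by blast
  let ?u = "apply_bcontfun f"
  have fixed: "T ?u = ?u" using F[OF f(1)] f(2) by simp
  have att: "\<exists>\<xi>. norm \<xi> \<le> R \<and> ?u x = G ?u x \<xi> \<and> (\<forall>\<eta>. norm \<eta> \<le> R \<longrightarrow> ?u x \<le> G ?u x \<eta>)" for x
    using T_attained[of ?u x] unfolding fixed by simp
  show ?thesis
    using f(1) att unfolding S_def G_def D_def by (intro exI[of _ ?u]) blast
qed

text \<open>
  A bound on increments at the scale h gives a bound at every larger scale by subdividing the
  segment.
\<close>

lemma chain_bound:
  fixes u :: "'a::real_normed_vector \<Rightarrow> real"
  assumes step: "\<And>x y. norm (x - y) \<le> h \<Longrightarrow> u x - u y \<le> c"
  shows "norm (x - y) \<le> real n * h \<Longrightarrow> u x - u y \<le> real n * c"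
proof (induction n arbitrary: x)
  case 0
  then show ?case by simp
next
  case (Suc n)
  define z where "z = x + (1 / real (Suc n)) *\<^sub>R (y - x)"
  have "x - z = (1 / real (Suc n)) *\<^sub>R (x - y)" by (simp add: z_def algebra_simps)
  then have "norm (x - z) = norm (x - y) / real (Suc n)" by simp
  also have "\<dots> \<le> h" using Suc.prems by (simp add: pos_divide_le_eq mult.commute del: of_nat_Suc)
  finally have 1: "u x - u z \<le> c" by (rule step)
  have "z - y = (1 - 1 / real (Suc n)) *\<^sub>R (x - y)"
    unfolding z_def by (simp add: algebra_simps del: of_nat_Suc)
  also have "1 - 1 / real (Suc n) = real n / real (Suc n)" by (simp add: field_simps)
  finally have "z - y = (real n / real (Suc n)) *\<^sub>R (x - y)" .
  then have "norm (z - y) = real n * (norm (x - y) / real (Suc n))" by simp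
  also have "\<dots> \<le> real n * h"
    using Suc.prems by (intro mult_left_mono) (auto simp: pos_divide_le_eq mult.commute simp del: of_nat_Suc)
  finally have "u z - u y \<le> real n * c" by (rule Suc.IH)
  with 1 show ?case by (simp add: algebra_simps)
qed

text \<open>
  The discounted solutions with s = 1/(j+1) are equicontinuous, so after subtracting their values
  at 0 a subsequence converges uniformly; the discounted constants s u(0) converge to minus the
  critical level. Equicontinuity comes from two estimates. At distances above the time step s^2,
  moving at unit speed shows that u is Lipschitz with a constant 2C free of s. At distances below
  s^2 the Lipschitz constant M/s is used, and (M/s) d \<le> M sqrt d when sqrt d \<le> s. This is
  why the step is s^2 while the discount rate is s.
\<close>

theorem cell_problem_solvable:
  fixes V :: "'a::euclidean_space \<Rightarrow> real"
  assumes \<Lambda>: "cocompact \<Lambda>" and per: "periodic_under \<Lambda> V"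
    and lip: "\<And>x y. \<bar>V x - V y\<bar> \<le> M * norm (x - y)"
  shows "\<exists>\<mu> v. periodic_under \<Lambda> v \<and> continuous_viscosity_solution (cell_operator V p \<mu>) v"
proof -
  have contV: "continuous_on UNIV V" by (rule lipschitz_continuous[OF lip])
  obtain B where B: "\<And>x. \<bar>V x\<bar> \<le> B" by (rule periodic_bounded[OF \<Lambda> per contV]) blast
  have B0: "0 \<le> B" using B[of 0] by simp
  have M: "0 \<le> M"
  proof -
    obtain b :: 'a where "b \<in> Basis" using nonempty_Basis by blast
    then have "\<bar>V b - V 0\<bar> \<le> M" using lip[of b 0] by simp
    then show ?thesis using abs_ge_zero order_trans by blast
  qed
  define D where "D = B + (norm p)\<^sup>2 / 2"
  have D0: "0 \<le> D" using B0 by (simp add: D_def)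
  \<comment> \<open>Critical levels lie in [-D, D] and |V| \<le> B, so this is large enough for the truncation of
    speeds.\<close>
  define R where "R = sqrt (2 * (D + B)) + 1"
  have R: "1 \<le> R" "D + B < R\<^sup>2 / 2"
  proof -
    define q where "q = sqrt (2 * (D + B))"
    have "0 \<le> q" "q\<^sup>2 = 2 * (D + B)" using B0 D0 by (auto simp: q_def)
    moreover have "R = q + 1" by (simp add: R_def q_def)
    ultimately show "1 \<le> R" "D + B < R\<^sup>2 / 2" by (auto simp: power2_sum)
  qed
  define s where "s = (\<lambda>j. inverse (real (Suc j)))"
  have s: "0 < s j" "s j \<le> 1" for j by (auto simp: s_def divide_simps)
  have slim: "s \<longlonglongrightarrow> 0" unfolding s_def by (rule LIMSEQ_inverse_real_of_nat)
  have "\<forall>j. \<exists>u. discounted_value_function \<Lambda> V p M D R (s j) u"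
    unfolding D_def using R(1) by (intro allI discounted_value_function_exists per lip B s) simp
  from choice[OF this] obtain u where "\<forall>j. discounted_value_function \<Lambda> V p M D R (s j) (u j)"
    by (elim exE)
  then have uper: "\<And>j. periodic_under \<Lambda> (u j)"
    and ulip: "\<And>j x y. \<bar>u j x - u j y\<bar> \<le> M / s j * norm (x - y)"
    and ubd: "\<And>j x. \<bar>u j x\<bar> \<le> D / s j"
    and ule: "\<And>j x \<xi>. norm \<xi> \<le> R \<Longrightarrow>
       u j x \<le> (1 - s j^3) * u j (x - (s j)\<^sup>2 *\<^sub>R \<xi>) + (s j)\<^sup>2 * ((norm \<xi>)\<^sup>2 / 2 - p \<bullet> \<xi> - V x)"
    and uge: "\<And>j x. \<exists>\<xi>. norm \<xi> \<le> R \<and>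
       u j x = (1 - s j^3) * u j (x - (s j)\<^sup>2 *\<^sub>R \<xi>) + (s j)\<^sup>2 * ((norm \<xi>)\<^sup>2 / 2 - p \<bullet> \<xi> - V x)"
    by blast+
  define C where "C = D + 1/2 + norm p + B"
  have C: "0 \<le> C" using D0 B0 by (simp add: C_def)
  have near: "u j x - u j y \<le> (s j)\<^sup>2 * C" if xy: "norm (x - y) \<le> (s j)\<^sup>2" for j x y
  proof -
    let ?\<xi> = "(1 / (s j)\<^sup>2) *\<^sub>R (x - y)"
    have s2: "0 < (s j)\<^sup>2" using s(1)[of j] by simp
    have n: "norm ?\<xi> \<le> 1" using xy s2 by simp
    have eq: "x - (s j)\<^sup>2 *\<^sub>R ?\<xi> = y" using s2 by simp
    have "u j x \<le> (1 - s j^3) * u j y + (s j)\<^sup>2 * ((norm ?\<xi>)\<^sup>2 / 2 - p \<bullet> ?\<xi> - V x)"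
      using ule[of ?\<xi> j x] n R(1) unfolding eq by linarith
    moreover have "(s j)\<^sup>2 * ((norm ?\<xi>)\<^sup>2 / 2 - p \<bullet> ?\<xi> - V x) \<le> (s j)\<^sup>2 * (1/2 + norm p + B)"
    proof (intro mult_left_mono)
      have "(norm ?\<xi>)\<^sup>2 \<le> 1" using n by (simp add: power_le_one del: norm_scaleR)
      moreover have "- (p \<bullet> ?\<xi>) \<le> norm p"
        using Cauchy_Schwarz_ineq2[of p ?\<xi>] mult_left_mono[OF n norm_ge_zero[of p]] by linarith
      ultimately show "(norm ?\<xi>)\<^sup>2 / 2 - p \<bullet> ?\<xi> - V x \<le> 1/2 + norm p + B" using B[of x] by linarith
    qed simp
    moreover have "- (s j^3 * u j y) \<le> (s j)\<^sup>2 * D"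
    proof -
      have "- (s j^3 * u j y) \<le> s j^3 * \<bar>u j y\<bar>"
        using mult_left_mono[OF abs_ge_minus_self[of "u j y"], of "s j^3"] s(1)[of j] by simp
      also have "\<dots> \<le> s j^3 * (D / s j)"
        using s(1)[of j] ubd by (intro mult_left_mono) (auto intro: less_imp_le)
      also have "\<dots> = (s j)\<^sup>2 * D" using s(1)[of j] by (simp add: power3_eq_cube power2_eq_square)
      finally show ?thesis .
    qed
    ultimately show ?thesis by (simp add: C_def algebra_simps)
  qed
  have modulus: "\<bar>u j x - u j y\<bar> \<le> 2 * C * norm (x - y) + M * sqrt (norm (x - y))" for j x y
  proof (cases "(s j)\<^sup>2 \<le> norm (x - y)")
    case True
    have far: "u j x - u j y \<le> 2 * C * norm (x - y)" if le: "(s j)\<^sup>2 \<le> norm (x - y)" for x y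
    proof -
      have s2: "0 < (s j)\<^sup>2" using s(1)[of j] by simp
      define n where "n = nat \<lceil>norm (x - y) / (s j)\<^sup>2\<rceil>"
      have n: "norm (x - y) / (s j)\<^sup>2 \<le> real n" "real n \<le> norm (x - y) / (s j)\<^sup>2 + 1"
        using s2 unfolding n_def by (auto simp: of_nat_nat)
      have "norm (x - y) \<le> real n * (s j)\<^sup>2" using n(1) s2 by (simp add: pos_divide_le_eq)
      then have "u j x - u j y \<le> real n * ((s j)\<^sup>2 * C)" by (rule chain_bound[where u = "u j" and h = "(s j)\<^sup>2" and c = "(s j)\<^sup>2 * C", rotated]) (rule near)
      also have "\<dots> \<le> (norm (x - y) / (s j)\<^sup>2 + 1) * ((s j)\<^sup>2 * C)"
        using n(2) s2 C by (intro mult_right_mono) auto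
      also have "\<dots> = (norm (x - y) + (s j)\<^sup>2) * C" using s2 by (simp add: field_simps)
      also have "\<dots> \<le> (2 * norm (x - y)) * C" using le C by (intro mult_right_mono) auto
      finally show ?thesis by (simp add: mult_ac)
    qed
    have "0 \<le> M * sqrt (norm (x - y))" using M by simp
    then show ?thesis using far[OF True] far[of y x] True by (simp add: norm_minus_commute abs_le_iff)
  next
    case False
    have "sqrt (norm (x - y)) \<le> s j"
      using False s(1)[of j] by (simp add: real_le_lsqrt)
    then have "norm (x - y) \<le> s j * sqrt (norm (x - y))"
      using mult_right_mono[of "sqrt (norm (x - y))" "s j" "sqrt (norm (x - y))"] by simp
    then have "norm (x - y) / s j \<le> sqrt (norm (x - y))"
      using s(1)[of j] by (simp add: pos_divide_le_eq mult.commute)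
    then have "M * (norm (x - y) / s j) \<le> M * sqrt (norm (x - y))" using M by (intro mult_left_mono)
    moreover have "0 \<le> 2 * C * norm (x - y)" using C by simp
    ultimately show ?thesis using ulip[of j x y] by simp
  qed
  obtain r where r: "\<And>x. \<exists>z\<in>\<Lambda>. norm (x + z) \<le> r" using \<Lambda> by (auto simp: cocompact_def)
  have r0: "0 \<le> r" using r[of 0] norm_ge_zero order_trans by blast
  define w where "w = (\<lambda>j x. u j x - u j 0)"
  have wper: "w j (x + z) = w j x" if "z \<in> \<Lambda>" for j x z
    using uper that by (simp add: w_def periodic_under_def)
  define Bw where "Bw = 2 * C * r + M * sqrt r"
  have wbd0: "\<bar>w j x\<bar> \<le> Bw" if "norm x \<le> r" for j x
  proof -
    have "\<bar>w j x\<bar> \<le> 2 * C * norm x + M * sqrt (norm x)" using modulus[of j x 0] by (simp add: w_def)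
    also have "\<dots> \<le> Bw" unfolding Bw_def using that C M by (intro add_mono mult_left_mono) auto
    finally show ?thesis .
  qed
  have wbd: "\<bar>w j x\<bar> \<le> Bw" for j x using r[of x] wper wbd0 by metis
  have equi: "\<exists>d. 0 < d \<and> (\<forall>n y. y \<in> cball 0 r \<and> norm (x - y) < d \<longrightarrow> norm (w n x - w n y) < e)"
    if "0 < e" for x e
  proof -
    have "isCont (\<lambda>t. 2 * C * t + M * sqrt t) 0" by (intro continuous_intros)
    then obtain d where d: "d > 0" "\<And>t. \<bar>t\<bar> < d \<Longrightarrow> \<bar>2 * C * t + M * sqrt t\<bar> < e"
      using \<open>0 < e\<close> unfolding continuous_at_eps_delta dist_real_def by fastforce
    have "norm (w n x - w n y) < e" if "norm (x - y) < d" for n y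
    proof -
      have "norm (w n x - w n y) \<le> 2 * C * norm (x - y) + M * sqrt (norm (x - y))"
        using modulus[of n x y] by (simp add: w_def)
      also have "\<dots> < e" using d(2)[of "norm (x - y)"] that by simp
      finally show ?thesis .
    qed
    then show ?thesis using d(1) by blast
  qed
  obtain g k where "continuous_on (cball 0 r) g" and k: "strict_mono (k :: nat \<Rightarrow> nat)"
    and g: "\<And>e. 0 < e \<Longrightarrow> \<exists>N. \<forall>n x. n \<ge> N \<and> x \<in> cball 0 r \<longrightarrow> norm (w (k n) x - g x) < e"
    by (rule Arzela_Ascoli[of "cball 0 r" w Bw]) (use wbd equi in auto)
  obtain z where z: "\<And>x. z x \<in> \<Lambda>" "\<And>x. norm (x + z x) \<le> r" using r by metis
  define W where "W = (\<lambda>x. g (x + z x))"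
  have unif: "uniform_limit UNIV (\<lambda>n. w (k n)) W sequentially"
    unfolding uniform_limit_sequentially_iff
  proof (intro allI impI)
    fix e :: real assume "0 < e"
    from g[OF this] obtain N where N: "\<forall>n x. n \<ge> N \<and> x \<in> cball 0 r \<longrightarrow> norm (w (k n) x - g x) < e" by blast
    have "dist (w (k n) x) (W x) < e" if "n \<ge> N" for n x
    proof -
      have "norm (w (k n) (x + z x) - g (x + z x)) < e" using N that z(2)[of x] by simp
      then show ?thesis using wper[OF z(1)] by (simp add: W_def dist_norm)
    qed
    then show "\<exists>N. \<forall>n\<ge>N. \<forall>x\<in>UNIV. dist (w (k n) x) (W x) < e" by blast
  qed
  have Wper: "periodic_under \<Lambda> W" unfolding periodic_under_def
  proof (intro allI ballI)
    fix x y assume "y \<in> \<Lambda>"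
    then have "(\<lambda>n. w (k n) (x + y)) = (\<lambda>n. w (k n) x)" using wper by simp
    then show "W (x + y) = W x"
      using tendsto_uniform_limitI[OF unif, of x] tendsto_uniform_limitI[OF unif, of "x + y"]
      by (auto intro: LIMSEQ_unique)
  qed
  define m where "m = (\<lambda>n. s (k n) * u (k n) 0)"
  have "\<forall>n. m n \<in> {-D..D}"
  proof
    fix n
    have "\<bar>m n\<bar> = s (k n) * \<bar>u (k n) 0\<bar>" using s(1)[of "k n"] by (simp add: m_def abs_mult)
    also have "\<dots> \<le> s (k n) * (D / s (k n))" using s(1)[of "k n"] ubd by (intro mult_left_mono) auto
    also have "\<dots> = D" using s(1)[of "k n"] by simp
    finally show "m n \<in> {-D..D}" by auto
  qed
  with compact_Icc[of "-D" D, unfolded compact_def, rule_format, of m]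
  obtain m0 l where m0: "m0 \<in> {-D..D}" and l: "strict_mono (l :: nat \<Rightarrow> nat)" and ml: "(m \<circ> l) \<longlonglongrightarrow> m0"
    by blast
  define i where "i = (\<lambda>n. k (l n))"
  have i: "strict_mono i" using k l by (simp add: i_def strict_mono_def)
  have si: "(\<lambda>n. s (i n)) \<longlonglongrightarrow> 0" using LIMSEQ_subseq_LIMSEQ[OF slim i] by (simp add: comp_def)
  \<comment> \<open>The discount term at step n is s u(y) = s u(0) + s w(y), within this distance of its limit.\<close>
  define \<delta> where "\<delta> = (\<lambda>n. \<bar>m (l n) - m0\<bar> + s (i n) * Bw)"
  have \<delta>: "\<delta> \<longlonglongrightarrow> 0"
  proof -
    have "(\<lambda>n. \<bar>m (l n) - m0\<bar> + s (i n) * Bw) \<longlonglongrightarrow> \<bar>m0 - m0\<bar> + 0 * Bw"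
      using ml by (intro tendsto_intros si) (simp add: comp_def)
    then show ?thesis by (simp add: \<delta>_def)
  qed
  have disc: "\<bar>s (i n) * u (i n) y - m0\<bar> \<le> \<delta> n" for n y
  proof -
    have "s (i n) * u (i n) y - m0 = (m (l n) - m0) + s (i n) * w (i n) y"
      by (simp add: m_def w_def i_def algebra_simps)
    moreover have "\<bar>s (i n) * w (i n) y\<bar> \<le> s (i n) * Bw"
      using s(1)[of "i n"] wbd[of "i n" y] by (simp add: abs_mult)
    ultimately show ?thesis unfolding \<delta>_def by linarith
  qed
  have cube: "s j ^ 3 = (s j)\<^sup>2 * s j" for j by (simp add: power3_eq_cube power2_eq_square)
  have "continuous_viscosity_solution (cell_operator V p (- m0)) W"
  proof (rule discrete_solutions_converge_to_viscosity_solution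
      [where w = "\<lambda>n. w (i n)" and h = "\<lambda>n. (s (i n))\<^sup>2" and R = R and \<delta> = \<delta>])
    show "(\<lambda>n. (s (i n))\<^sup>2) \<longlonglongrightarrow> 0" using tendsto_power[OF si, of 2] by simp
    show "0 < (s (i n))\<^sup>2" for n using s(1)[of "i n"] by simp
    show "uniform_limit UNIV (\<lambda>n. w (i n)) W sequentially"
      using filterlim_compose[OF unif filterlim_subseq[OF l]]
      by (simp add: i_def)
    show "continuous_on UNIV (w (i n))" for n
      unfolding w_def by (intro continuous_intros lipschitz_continuous[OF ulip])
    show "- m0 - V x < R\<^sup>2 / 2" for x using m0 B[of x] R(2) by auto
    show "0 \<le> R" using R by simp
    show "w (i n) x - w (i n) (x - (s (i n))\<^sup>2 *\<^sub>R \<xi>)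
        \<le> (s (i n))\<^sup>2 * ((norm \<xi>)\<^sup>2 / 2 - p \<bullet> \<xi> - V x + - m0 + \<delta> n)" if "norm \<xi> \<le> R" for n x \<xi>
    proof -
      let ?y = "x - (s (i n))\<^sup>2 *\<^sub>R \<xi>"
      have "w (i n) x - w (i n) ?y
          \<le> (s (i n))\<^sup>2 * ((norm \<xi>)\<^sup>2 / 2 - p \<bullet> \<xi> - V x - s (i n) * u (i n) ?y)"
        using ule[OF that, of "i n" x] by (simp add: w_def cube algebra_simps)
      also have "\<dots> \<le> (s (i n))\<^sup>2 * ((norm \<xi>)\<^sup>2 / 2 - p \<bullet> \<xi> - V x + - m0 + \<delta> n)"
        using disc[of n ?y] by (intro mult_left_mono) auto
      finally show ?thesis .
    qed
    show "\<exists>\<xi>. norm \<xi> \<le> R \<and>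
        (s (i n))\<^sup>2 * ((norm \<xi>)\<^sup>2 / 2 - p \<bullet> \<xi> - V x + - m0 - \<delta> n)
        \<le> w (i n) x - w (i n) (x - (s (i n))\<^sup>2 *\<^sub>R \<xi>)" for n x
    proof -
      obtain \<xi> where \<xi>: "norm \<xi> \<le> R" and
        eq: "u (i n) x = (1 - s (i n)^3) * u (i n) (x - (s (i n))\<^sup>2 *\<^sub>R \<xi>) + (s (i n))\<^sup>2 * ((norm \<xi>)\<^sup>2 / 2 - p \<bullet> \<xi> - V x)"
        using uge by blast
      let ?y = "x - (s (i n))\<^sup>2 *\<^sub>R \<xi>"
      have "(s (i n))\<^sup>2 * ((norm \<xi>)\<^sup>2 / 2 - p \<bullet> \<xi> - V x + - m0 - \<delta> n)
         \<le> (s (i n))\<^sup>2 * ((norm \<xi>)\<^sup>2 / 2 - p \<bullet> \<xi> - V x - s (i n) * u (i n) ?y)"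
        using disc[of n ?y] by (intro mult_left_mono) auto
      also have "\<dots> = w (i n) x - w (i n) ?y"
        unfolding w_def eq by (simp add: cube algebra_simps)
      finally show ?thesis using \<xi> by blast
    qed
  qed (use \<delta> contV in auto)
  then show ?thesis using Wper by blast
qed

section \<open>Bounds on critical levels from smooth test functions\<close>

definition critical_level ::
    "'a::euclidean_space set \<Rightarrow> ('a \<Rightarrow> real) \<Rightarrow> 'a \<Rightarrow> real \<Rightarrow> bool" where
  "critical_level \<Lambda> V p \<mu> \<longleftrightarrow>
     (\<exists>v. periodic_under \<Lambda> v \<and> continuous_viscosity_solution (cell_operator V p \<mu>) v)"

text \<open>
  At a minimum of v - \<phi> the function \<phi> is a test function for the supersolution
  property.
\<close>

lemma critical_level_le:
  assumes \<Lambda>: "cocompact \<Lambda>" and \<mu>: "critical_level \<Lambda> V p \<mu>"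
    and C1: "C1_with_gradient \<phi> D\<phi>" and per: "periodic_under \<Lambda> \<phi>"
    and le: "\<And>x. (norm (p + D\<phi> x))\<^sup>2 / 2 + V x \<le> c"
  shows "\<mu> \<le> c"
proof -
  obtain v where v: "periodic_under \<Lambda> v" "continuous_on UNIV v"
      "viscosity_supersolution (cell_operator V p \<mu>) v"
    using \<mu> by (auto simp: critical_level_def continuous_viscosity_solution_def)
  have "periodic_under \<Lambda> (\<lambda>x. v x - \<phi> x)" using v(1) per by (simp add: periodic_under_def)
  moreover have "continuous_on UNIV (\<lambda>x. v x - \<phi> x)"
    by (intro continuous_intros v C1_continuous[OF C1])
  ultimately obtain x where x: "\<And>y. v x - \<phi> x \<le> v y - \<phi> y"
    by (rule periodic_attains_min[OF \<Lambda>]) blast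
  from x have "\<forall>\<^sub>F y in nhds x. v x - \<phi> x \<le> v y - \<phi> y" by simp
  with v(3) C1 have "0 \<le> cell_operator V p \<mu> x (D\<phi> x)"
    unfolding viscosity_supersolution_def by blast
  then show ?thesis using le[of x] by simp
qed

text \<open>
  At a maximum of v - min(\<phi>_+, \<phi>_-) the branch that attains the minimum touches v from
  above, so it may be tested although the minimum is not differentiable. Only the minimum has to
  be periodic; the resonant corrector needs this freedom, since its two smooth branches are
  exchanged by periods.
\<close>

lemma critical_level_ge:
  assumes \<Lambda>: "cocompact \<Lambda>" and \<mu>: "critical_level \<Lambda> V p \<mu>"
    and C1: "\<And>\<sigma>. C1_with_gradient (\<phi> \<sigma>) (D\<phi> \<sigma>)"
    and per: "periodic_under \<Lambda> (\<lambda>x. min (\<phi> True x) (\<phi> False x))"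
    and ge: "\<And>\<sigma> x. c \<le> (norm (p + D\<phi> \<sigma> x))\<^sup>2 / 2 + V x"
  shows "c \<le> \<mu>"
proof -
  obtain v where v: "periodic_under \<Lambda> v" "continuous_on UNIV v"
      "viscosity_subsolution (cell_operator V p \<mu>) v"
    using \<mu> by (auto simp: critical_level_def continuous_viscosity_solution_def)
  let ?m = "\<lambda>x. min (\<phi> True x) (\<phi> False x)"
  have "periodic_under \<Lambda> (\<lambda>x. v x - ?m x)" using v(1) per by (simp add: periodic_under_def)
  moreover have "continuous_on UNIV (\<lambda>x. v x - ?m x)"
    by (intro continuous_intros v C1_continuous[OF C1])
  ultimately obtain x where x: "\<And>y. v y - ?m y \<le> v x - ?m x"
    by (rule periodic_attains_max[OF \<Lambda>]) blast
  obtain \<sigma> where \<sigma>: "?m x = \<phi> \<sigma> x" by (metis min_def)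
  have "v y - \<phi> \<sigma> y \<le> v x - \<phi> \<sigma> x" for y
    using x[of y] \<sigma> by (cases \<sigma>) auto
  then have "\<forall>\<^sub>F y in nhds x. v y - \<phi> \<sigma> y \<le> v x - \<phi> \<sigma> x" by simp
  with v(3) C1 have "cell_operator V p \<mu> x (D\<phi> \<sigma> x) \<le> 0"
    unfolding viscosity_subsolution_def by blast
  then show ?thesis using ge[of \<sigma> x] by simp
qed

text \<open>
  With momentum t q and corrector gradient G1/t + G2/t^3, the energy terms of order 1 and t^(-2)
  are exactly q \<bullet> G1 and q \<bullet> G2 + |G1|^2/2.
\<close>

lemma kinetic_energy_expansion:
  fixes q G1 G2 :: "'a::real_inner"
  assumes t: "1 \<le> t" and K: "norm G1 \<le> K" "norm G2 \<le> K"
  shows "\<bar>(norm (t *\<^sub>R q + (inverse t *\<^sub>R G1 + inverse t ^ 3 *\<^sub>R G2)))\<^sup>2 / 2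
      - (t\<^sup>2 * (norm q)\<^sup>2 / 2 + q \<bullet> G1 + (q \<bullet> G2 + (norm G1)\<^sup>2 / 2) / t\<^sup>2)\<bar> \<le> 2 * K\<^sup>2 / t ^ 4"
proof -
  define i where "i = inverse t"
  have i: "0 < i" "i \<le> 1" "t * i = 1" using t by (auto simp: i_def divide_simps)
  have "(norm (t *\<^sub>R q + (i *\<^sub>R G1 + i ^ 3 *\<^sub>R G2)))\<^sup>2 / 2
     = t\<^sup>2 * (norm q)\<^sup>2 / 2 + (t * i) * (q \<bullet> G1) + (t * i) * i\<^sup>2 * (q \<bullet> G2) + i\<^sup>2 * (norm G1)\<^sup>2 / 2
       + i ^ 4 * (G1 \<bullet> G2) + i ^ 6 * (norm G2)\<^sup>2 / 2"
    unfolding power2_norm_eq_inner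
    by (simp add: inner_add_left inner_add_right inner_commute power2_eq_square algebra_simps
        power3_eq_cube power4_eq_xxxx numeral_eq_Suc)
  then have eq: "(norm (t *\<^sub>R q + (i *\<^sub>R G1 + i ^ 3 *\<^sub>R G2)))\<^sup>2 / 2
      - (t\<^sup>2 * (norm q)\<^sup>2 / 2 + q \<bullet> G1 + (q \<bullet> G2 + (norm G1)\<^sup>2 / 2) * i\<^sup>2)
     = i ^ 4 * (G1 \<bullet> G2) + i ^ 6 * ((norm G2)\<^sup>2 / 2)"
    unfolding i(3) by (simp add: algebra_simps)
  have K0: "0 \<le> K" using K(1) norm_ge_zero order_trans by blast
  have "\<bar>G1 \<bullet> G2\<bar> \<le> K * K"
    using Cauchy_Schwarz_ineq2[of G1 G2] mult_mono[OF K K0 norm_ge_zero] by linarith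
  then have "i ^ 4 * \<bar>G1 \<bullet> G2\<bar> \<le> i ^ 4 * K\<^sup>2"
    using i by (intro mult_left_mono) (auto simp: power2_eq_square)
  moreover have "i ^ 6 * ((norm G2)\<^sup>2 / 2) \<le> i ^ 4 * K\<^sup>2"
  proof (rule mult_mono)
    show "i ^ 6 \<le> i ^ 4" using i by (intro power_decreasing) auto
    have "(norm G2)\<^sup>2 \<le> K\<^sup>2" using K(2) by (intro power_mono) auto
    moreover have "0 \<le> (norm G2)\<^sup>2" by simp
    ultimately show "(norm G2)\<^sup>2 / 2 \<le> K\<^sup>2" by linarith
  qed (use i in auto)
  moreover have "\<bar>i ^ 4 * (G1 \<bullet> G2)\<bar> + \<bar>i ^ 6 * ((norm G2)\<^sup>2 / 2)\<bar>
      = i ^ 4 * \<bar>G1 \<bullet> G2\<bar> + i ^ 6 * ((norm G2)\<^sup>2 / 2)"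
    using i by (simp add: abs_mult)
  ultimately have "\<bar>i ^ 4 * (G1 \<bullet> G2)\<bar> + \<bar>i ^ 6 * ((norm G2)\<^sup>2 / 2)\<bar> \<le> 2 * (i ^ 4 * K\<^sup>2)"
    by linarith
  then have "\<bar>i ^ 4 * (G1 \<bullet> G2) + i ^ 6 * ((norm G2)\<^sup>2 / 2)\<bar> \<le> 2 * (i ^ 4 * K\<^sup>2)" by linarith
  moreover have "x / t ^ n = x * i ^ n" for x n by (simp add: i_def divide_inverse power_inverse)
  ultimately show ?thesis unfolding i_def[symmetric] using eq by (simp only: mult.assoc mult.commute[of _ "i ^ 4"])
qed

abbreviation sin_mode :: "'a::real_inner \<Rightarrow> real \<Rightarrow> 'a \<Rightarrow> real" where
  "sin_mode k \<alpha> x \<equiv> sin (2 * pi * (k \<bullet> x) + \<alpha>)"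

abbreviation cos_mode :: "'a::real_inner \<Rightarrow> real \<Rightarrow> 'a \<Rightarrow> real" where
  "cos_mode k \<alpha> x \<equiv> cos (2 * pi * (k \<bullet> x) + \<alpha>)"

text \<open>
  Boundedness of the values makes the class closed under products, boundedness of the gradient
  makes the error terms of the expansions uniform.
\<close>

definition C1_bounded :: "('a::euclidean_space \<Rightarrow> real) \<Rightarrow> ('a \<Rightarrow> 'a) \<Rightarrow> bool" where
  "C1_bounded \<phi> D\<phi> \<longleftrightarrow> C1_with_gradient \<phi> D\<phi> \<and> bounded (range \<phi>) \<and> bounded (range D\<phi>)"

lemma C1_bounded_add:
  "C1_bounded \<phi> D\<phi> \<Longrightarrow> C1_bounded \<psi> D\<psi> \<Longrightarrow>
     C1_bounded (\<lambda>x. \<phi> x + \<psi> x) (\<lambda>x. D\<phi> x + D\<psi> x)"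
  unfolding C1_bounded_def by (auto intro: C1_add bounded_plus_comp)

lemma bounded_scaleR_range:
  fixes f :: "'a \<Rightarrow> real" and g :: "'a \<Rightarrow> 'b::real_normed_vector"
  assumes "bounded (range f)" "bounded (range g)"
  shows "bounded (range (\<lambda>x. f x *\<^sub>R g x))"
proof -
  obtain B C where "\<And>x. \<bar>f x\<bar> \<le> B" "\<And>x. norm (g x) \<le> C"
    using assms unfolding bounded_iff by auto
  then have "norm (f x *\<^sub>R g x) \<le> \<bar>B\<bar> * \<bar>C\<bar>" for x
    unfolding norm_scaleR by (intro mult_mono) (auto intro!: order_trans[OF _ abs_ge_self])
  then show ?thesis unfolding bounded_iff by blast
qed

lemma C1_bounded_mult:
  assumes "C1_bounded \<phi> D\<phi>" "C1_bounded \<psi> D\<psi>"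
  shows "C1_bounded (\<lambda>x. \<phi> x * \<psi> x) (\<lambda>x. \<phi> x *\<^sub>R D\<psi> x + \<psi> x *\<^sub>R D\<phi> x)"
proof -
  have "C1_with_gradient (\<lambda>x. \<phi> x * \<psi> x) (\<lambda>x. \<phi> x *\<^sub>R D\<psi> x + \<psi> x *\<^sub>R D\<phi> x)"
    using assms C1_continuous[of \<phi> D\<phi> UNIV] C1_continuous[of \<psi> D\<psi> UNIV]
    unfolding C1_bounded_def C1_with_gradient_def
    by (auto intro: GDERIV_mult continuous_on_add continuous_on_scaleR)
  moreover have "bounded (range (\<lambda>x. \<phi> x * \<psi> x))"
    using assms bounded_scaleR_range[of \<phi> \<psi>] by (simp add: C1_bounded_def)
  moreover have "bounded (range (\<lambda>x. \<phi> x *\<^sub>R D\<psi> x + \<psi> x *\<^sub>R D\<phi> x))"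
    using assms by (intro bounded_plus_comp bounded_scaleR_range) (auto simp: C1_bounded_def)
  ultimately show ?thesis by (simp add: C1_bounded_def)
qed

lemma bounded_trig: "bounded (range (\<lambda>x. c * sin (f x :: real)))" "bounded (range (\<lambda>x. c * cos (f x :: real)))"
proof -
  have "\<bar>c * sin s\<bar> \<le> \<bar>c\<bar>" "\<bar>c * cos s\<bar> \<le> \<bar>c\<bar>" for s :: real
    using mult_left_mono[OF abs_sin_le_one[of s], of "\<bar>c\<bar>"] mult_left_mono[OF abs_cos_le_one[of s], of "\<bar>c\<bar>"]
    by (auto simp: abs_mult)
  then show "bounded (range (\<lambda>x. c * sin (f x :: real)))" "bounded (range (\<lambda>x. c * cos (f x :: real)))"
    unfolding bounded_iff by auto
qed

lemma C1_bounded_sin: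
  "C1_bounded (\<lambda>x. c * sin_mode k \<alpha> x) (\<lambda>x. (c * (2 * pi) * cos_mode k \<alpha> x) *\<^sub>R k)"
proof -
  have "C1_with_gradient (\<lambda>x. c * sin_mode k \<alpha> x)
      (\<lambda>x. (c * (2 * pi) * cos_mode k \<alpha> x) *\<^sub>R k)"
    by (rule C1_ridge[of "\<lambda>s. c * sin (2 * pi * s + \<alpha>)" "\<lambda>s. c * (2 * pi) * cos (2 * pi * s + \<alpha>)"])
      (auto intro!: derivative_eq_intros continuous_intros)
  then show ?thesis unfolding C1_bounded_def
    by (intro conjI bounded_trig bounded_scaleR_range) auto
qed

lemma C1_bounded_cos:
  "C1_bounded (\<lambda>x. c * cos_mode k \<alpha> x) (\<lambda>x. (- c * (2 * pi) * sin_mode k \<alpha> x) *\<^sub>R k)"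
proof -
  have "C1_with_gradient (\<lambda>x. c * cos_mode k \<alpha> x)
      (\<lambda>x. (- c * (2 * pi) * sin_mode k \<alpha> x) *\<^sub>R k)"
    by (rule C1_ridge[of "\<lambda>s. c * cos (2 * pi * s + \<alpha>)" "\<lambda>s. - c * (2 * pi) * sin (2 * pi * s + \<alpha>)"])
      (auto intro!: derivative_eq_intros continuous_intros)
  then show ?thesis unfolding C1_bounded_def
    by (intro conjI bounded_trig bounded_scaleR_range) auto
qed

lemma C1_ansatz:
  assumes "C1_bounded \<phi>1 G1" "C1_bounded \<phi>2 G2"
  shows "C1_with_gradient (\<lambda>x. b * \<phi>1 x + c * \<phi>2 x) (\<lambda>x. b *\<^sub>R G1 x + c *\<^sub>R G2 x)"
  using assms unfolding C1_bounded_def by (intro C1_add C1_scale) auto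

text \<open>
  The two equations are the cell equation at orders 1 and t^(-2), so the remaining energy is the
  O(t^(-4)) of \<open>kinetic_energy_expansion\<close>.
\<close>

lemma critical_level_upper_expansion:
  assumes \<Lambda>: "cocompact \<Lambda>" and H: "\<And>p. critical_level \<Lambda> V p (H p)"
    and C1: "C1_bounded \<phi>1 G1" "C1_bounded \<phi>2 G2"
    and per: "periodic_under \<Lambda> \<phi>1" "periodic_under \<Lambda> \<phi>2"
    and eq: "\<And>x. q \<bullet> G1 x + V x = a"
      "\<And>x. q \<bullet> G2 x + (norm (G1 x))\<^sup>2 / 2 = c"
  shows "\<exists>C. \<forall>t\<ge>1. H (t *\<^sub>R q) \<le> t\<^sup>2 * (norm q)\<^sup>2 / 2 + a + c / t\<^sup>2 + C / t ^ 4"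
proof -
  obtain K1 K2 where K12: "\<And>x. norm (G1 x) \<le> K1" "\<And>x. norm (G2 x) \<le> K2"
    using C1 unfolding C1_bounded_def bounded_iff by auto
  define K where "K = max K1 K2"
  have K: "norm (G1 x) \<le> K" "norm (G2 x) \<le> K" for x
    using K12[of x] by (auto simp: K_def le_max_iff_disj)
  have "H (t *\<^sub>R q) \<le> t\<^sup>2 * (norm q)\<^sup>2 / 2 + a + c / t\<^sup>2 + 2 * K\<^sup>2 / t ^ 4" if t: "1 \<le> t" for t
  proof (rule critical_level_le[OF \<Lambda> H C1_ansatz[OF C1]])
    show "periodic_under \<Lambda> (\<lambda>x. inverse t * \<phi>1 x + inverse t ^ 3 * \<phi>2 x)"
      using per by (simp add: periodic_under_def)
    show "(norm (t *\<^sub>R q + (inverse t *\<^sub>R G1 x + inverse t ^ 3 *\<^sub>R G2 x)))\<^sup>2 / 2 + V x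
        \<le> t\<^sup>2 * (norm q)\<^sup>2 / 2 + a + c / t\<^sup>2 + 2 * K\<^sup>2 / t ^ 4" for x
      using kinetic_energy_expansion[OF t K(1)[of x] K(2)[of x], of q] eq(1)[of x] unfolding eq(2)
      by linarith
  qed
  then show ?thesis by blast
qed

text \<open>
  Here the correctors come in two branches which every period either fixes or exchanges, so that
  their minimum is periodic. A single periodic corrector is the case of equal branches.
\<close>

lemma critical_level_lower_expansion:
  assumes \<Lambda>: "cocompact \<Lambda>" and H: "\<And>p. critical_level \<Lambda> V p (H p)"
    and C1: "\<And>\<sigma>::bool. C1_bounded (\<phi>1 \<sigma>) (G1 \<sigma>)" "\<And>\<sigma>. C1_bounded (\<phi>2 \<sigma>) (G2 \<sigma>)"
    and per: "\<And>z. z \<in> \<Lambda> \<Longrightarrow>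
        (\<forall>x \<sigma>. \<phi>1 \<sigma> (x + z) = \<phi>1 \<sigma> x \<and> \<phi>2 \<sigma> (x + z) = \<phi>2 \<sigma> x) \<or>
        (\<forall>x \<sigma>. \<phi>1 \<sigma> (x + z) = \<phi>1 (\<not> \<sigma>) x \<and> \<phi>2 \<sigma> (x + z) = \<phi>2 (\<not> \<sigma>) x)"
    and eq: "\<And>\<sigma> x. q \<bullet> G1 \<sigma> x + V x = a"
      "\<And>\<sigma> x. q \<bullet> G2 \<sigma> x + (norm (G1 \<sigma> x))\<^sup>2 / 2 = c"
  shows "\<exists>C. \<forall>t\<ge>1. t\<^sup>2 * (norm q)\<^sup>2 / 2 + a + c / t\<^sup>2 - C / t ^ 4 \<le> H (t *\<^sub>R q)"
proof -
  have "\<exists>B. \<forall>x. norm (G1 \<sigma> x) \<le> B \<and> norm (G2 \<sigma> x) \<le> B" for \<sigma>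
  proof -
    obtain K1 K2 where "\<And>x. norm (G1 \<sigma> x) \<le> K1" "\<And>x. norm (G2 \<sigma> x) \<le> K2"
      using C1[of \<sigma>] unfolding C1_bounded_def bounded_iff by auto
    then show ?thesis by (intro exI[of _ "max K1 K2"]) (auto simp: le_max_iff_disj)
  qed
  then obtain B where B: "\<And>\<sigma> x. norm (G1 \<sigma> x) \<le> B \<sigma>" "\<And>\<sigma> x. norm (G2 \<sigma> x) \<le> B \<sigma>" by metis
  define K where "K = max (B True) (B False)"
  have BK: "B \<sigma> \<le> K" for \<sigma> by (cases \<sigma>) (auto simp: K_def)
  have K: "norm (G1 \<sigma> x) \<le> K" "norm (G2 \<sigma> x) \<le> K" for \<sigma> x
    using order_trans[OF B(1) BK] order_trans[OF B(2) BK] by auto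
  have "t\<^sup>2 * (norm q)\<^sup>2 / 2 + a + c / t\<^sup>2 - 2 * K\<^sup>2 / t ^ 4 \<le> H (t *\<^sub>R q)" if t: "1 \<le> t" for t
  proof (rule critical_level_ge[OF \<Lambda> H C1_ansatz[OF C1]])
    show "periodic_under \<Lambda> (\<lambda>x. min (inverse t * \<phi>1 True x + inverse t ^ 3 * \<phi>2 True x)
        (inverse t * \<phi>1 False x + inverse t ^ 3 * \<phi>2 False x))"
      unfolding periodic_under_def
    proof (intro allI ballI)
      fix x z assume "z \<in> \<Lambda>"
      from per[OF this] show "min (inverse t * \<phi>1 True (x + z) + inverse t ^ 3 * \<phi>2 True (x + z))
        (inverse t * \<phi>1 False (x + z) + inverse t ^ 3 * \<phi>2 False (x + z)) =
        min (inverse t * \<phi>1 True x + inverse t ^ 3 * \<phi>2 True x)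
        (inverse t * \<phi>1 False x + inverse t ^ 3 * \<phi>2 False x)"
        by (auto simp: min.commute)
    qed
    show "t\<^sup>2 * (norm q)\<^sup>2 / 2 + a + c / t\<^sup>2 - 2 * K\<^sup>2 / t ^ 4
       \<le> (norm (t *\<^sub>R q + (inverse t *\<^sub>R G1 \<sigma> x + inverse t ^ 3 *\<^sub>R G2 \<sigma> x)))\<^sup>2 / 2 + V x" for \<sigma> x
      using kinetic_energy_expansion[OF t K(1)[of \<sigma> x] K(2)[of \<sigma> x], of q] eq(1)[of \<sigma> x] unfolding eq(2)
      by linarith
  qed
  then show ?thesis by blast
qed

section \<open>Expansions for potentials with two modes\<close>

definition two_mode ::
    "real \<Rightarrow> real \<Rightarrow> real \<Rightarrow> 'a \<Rightarrow> real \<Rightarrow> real \<Rightarrow> 'a::real_inner \<Rightarrow> 'a \<Rightarrow> real" where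
  "two_mode a A1 \<alpha>1 k1 A2 \<alpha>2 k2 x =
     a + 2 * A1 * cos_mode k1 \<alpha>1 x + 2 * A2 * cos_mode k2 \<alpha>2 x"

lemma trig_mode_shift:
  assumes "k \<bullet> z \<in> \<int>"
  shows "sin_mode k \<alpha> (x + z) = sin_mode k \<alpha> x"
    and "cos_mode k \<alpha> (x + z) = cos_mode k \<alpha> x"
proof -
  obtain n where n: "k \<bullet> z = of_int n" using assms by (elim Ints_cases)
  have "2 * pi * (k \<bullet> (x + z)) + \<alpha> = (2 * pi * (k \<bullet> x) + \<alpha>) + 2 * pi * of_int n"
    by (simp add: inner_add_right n algebra_simps)
  then show "sin_mode k \<alpha> (x + z) = sin_mode k \<alpha> x"
    and "cos_mode k \<alpha> (x + z) = cos_mode k \<alpha> x"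
    by (simp_all only: sin_add cos_add sin_int_2pin cos_int_2pin mult_zero_right mult_1_right add_0_right diff_0_right)
qed

text \<open>
  Functions of the half frequency are periodic up to a sign; this sign exchanges the branches of
  the resonant corrector.
\<close>

lemma half_mode_shift:
  assumes "k \<bullet> z \<in> \<int>"
  obtains \<epsilon> :: real where "\<epsilon> \<in> {1, -1}"
    "\<And>x. sin_mode ((1/2) *\<^sub>R k) \<alpha> (x + z) = \<epsilon> * sin_mode ((1/2) *\<^sub>R k) \<alpha> x"
    "\<And>x. cos_mode ((1/2) *\<^sub>R k) \<alpha> (x + z) = \<epsilon> * cos_mode ((1/2) *\<^sub>R k) \<alpha> x"
proof -
  obtain n where n: "k \<bullet> z = of_int n" using assms by (elim Ints_cases)
  have eq: "2 * pi * ((1/2) *\<^sub>R k \<bullet> (x + z)) + \<alpha> = (2 * pi * ((1/2) *\<^sub>R k \<bullet> x) + \<alpha>) + of_int n * pi" for x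
    by (simp add: inner_add_right n algebra_simps)
  have c: "cos (of_int n * pi) \<in> {1, -1}" by (cases "even n") (auto simp: mult.commute)
  have s: "sin (of_int n * pi) = 0" by (simp add: sin_zero_iff_int2)
  have shift: "sin (y + of_int n * pi) = cos (of_int n * pi) * sin y"
      "cos (y + of_int n * pi) = cos (of_int n * pi) * cos y" for y
    unfolding sin_add cos_add s by simp_all
  show ?thesis by (rule that[OF c]) (simp_all only: eq shift)
qed

lemma norm_combination_sq:
  fixes u w :: "'a::real_inner"
  shows "(norm (a *\<^sub>R u + b *\<^sub>R w))\<^sup>2 = a\<^sup>2 * (norm u)\<^sup>2 + 2 * a * b * (u \<bullet> w) + b\<^sup>2 * (norm w)\<^sup>2"
  unfolding power2_norm_eq_inner
  by (simp add: inner_add_left inner_add_right inner_commute power2_eq_square algebra_simps)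

text \<open>
  With P_j = A_j/(q \<bullet> k_j) the first corrector is -\<Sum>_j (P_j/\<pi>) sin \<theta>_j.
  The square of its gradient has mean 2\<Sum>_j P_j^2|k_j|^2 and otherwise contains the modes
  2\<theta>_j and \<theta>1 \<plusminus> \<theta>2, each of which the second corrector removes
  after a division by q \<bullet> 2k_j or q \<bullet> (k1 \<plusminus> k2).
\<close>

lemma nonresonant_expansion:
  fixes k1 k2 q :: "'a::euclidean_space"
  assumes \<Lambda>: "cocompact \<Lambda>" and H: "\<And>p. critical_level \<Lambda> (two_mode a A1 \<alpha>1 k1 A2 \<alpha>2 k2) p (H p)"
    and int: "\<And>z. z \<in> \<Lambda> \<Longrightarrow> k1 \<bullet> z \<in> \<int>" "\<And>z. z \<in> \<Lambda> \<Longrightarrow> k2 \<bullet> z \<in> \<int>"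
    and q: "q \<bullet> k1 \<noteq> 0" "q \<bullet> k2 \<noteq> 0" "q \<bullet> (k1 + k2) \<noteq> 0" "q \<bullet> (k1 - k2) \<noteq> 0"
  shows "\<exists>C. \<forall>t\<ge>1. \<bar>H (t *\<^sub>R q) - (t\<^sup>2 * (norm q)\<^sup>2 / 2 + a +
     (A1\<^sup>2 * (norm k1)\<^sup>2 / (q \<bullet> k1)\<^sup>2 + A2\<^sup>2 * (norm k2)\<^sup>2 / (q \<bullet> k2)\<^sup>2) / t\<^sup>2)\<bar> \<le> C / t ^ 4"
proof -
  define \<kappa>1 where "\<kappa>1 = q \<bullet> k1"
  define \<kappa>2 where "\<kappa>2 = q \<bullet> k2"
  define P1 where "P1 = A1 / \<kappa>1"
  define P2 where "P2 = A2 / \<kappa>2"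
  have \<kappa>: "\<kappa>1 \<noteq> 0" "\<kappa>2 \<noteq> 0" "\<kappa>1 + \<kappa>2 \<noteq> 0" "\<kappa>1 - \<kappa>2 \<noteq> 0"
    using q by (auto simp: \<kappa>1_def \<kappa>2_def inner_add_right inner_diff_right)
  have P: "P1 * \<kappa>1 = A1" "P2 * \<kappa>2 = A2" using \<kappa> by (auto simp: P1_def P2_def)
  define n1 where "n1 = (norm k1)\<^sup>2"
  define n2 where "n2 = (norm k2)\<^sup>2"
  define g where "g = k1 \<bullet> k2"
  define c where "c = P1\<^sup>2 * n1 + P2\<^sup>2 * n2"
  have c: "c = A1\<^sup>2 * (norm k1)\<^sup>2 / (q \<bullet> k1)\<^sup>2 + A2\<^sup>2 * (norm k2)\<^sup>2 / (q \<bullet> k2)\<^sup>2"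
    by (simp add: c_def P1_def P2_def n1_def n2_def \<kappa>1_def \<kappa>2_def power_divide)
  \<comment> \<open>The coefficients of the second corrector for the modes 2k1, 2k2, k1+k2, k1-k2.\<close>
  define e1 where "e1 = - (P1\<^sup>2 * n1) / (4 * pi * \<kappa>1)"
  define e2 where "e2 = - (P2\<^sup>2 * n2) / (4 * pi * \<kappa>2)"
  define e3 where "e3 = - (P1 * P2 * g) / (pi * (\<kappa>1 + \<kappa>2))"
  define e4 where "e4 = - (P1 * P2 * g) / (pi * (\<kappa>1 - \<kappa>2))"
  have e: "e1 * (2 * pi) * (2 * \<kappa>1) = - (P1\<^sup>2 * n1)" "e2 * (2 * pi) * (2 * \<kappa>2) = - (P2\<^sup>2 * n2)"
     "e3 * (2 * pi) * (\<kappa>1 + \<kappa>2) = - 2 * (P1 * P2 * g)" "e4 * (2 * pi) * (\<kappa>1 - \<kappa>2) = - 2 * (P1 * P2 * g)"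
    unfolding e1_def e2_def e3_def e4_def using \<kappa> by (simp_all add: divide_simps)
  note F1 = C1_bounded_add[OF C1_bounded_sin[of "- P1 / pi" k1 \<alpha>1] C1_bounded_sin[of "- P2 / pi" k2 \<alpha>2]]
  note F2 = C1_bounded_add[OF
      C1_bounded_add[OF C1_bounded_sin[of e1 "2 *\<^sub>R k1" "2 * \<alpha>1"] C1_bounded_sin[of e2 "2 *\<^sub>R k2" "2 * \<alpha>2"]]
      C1_bounded_add[OF C1_bounded_sin[of e3 "k1 + k2" "\<alpha>1 + \<alpha>2"] C1_bounded_sin[of e4 "k1 - k2" "\<alpha>1 - \<alpha>2"]]]
  let ?\<phi>1 = "\<lambda>x. - P1 / pi * sin_mode k1 \<alpha>1 x + - P2 / pi * sin_mode k2 \<alpha>2 x"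
  let ?\<phi>2 = "\<lambda>x. e1 * sin_mode (2 *\<^sub>R k1) (2 * \<alpha>1) x + e2 * sin_mode (2 *\<^sub>R k2) (2 * \<alpha>2) x +
     (e3 * sin_mode (k1 + k2) (\<alpha>1 + \<alpha>2) x + e4 * sin_mode (k1 - k2) (\<alpha>1 - \<alpha>2) x)"
  have per1: "?\<phi>1 (x + z) = ?\<phi>1 x" if "z \<in> \<Lambda>" for x z
    by (simp only: trig_mode_shift(1)[OF int(1)[OF that]] trig_mode_shift(1)[OF int(2)[OF that]])
  have per2: "?\<phi>2 (x + z) = ?\<phi>2 x" if "z \<in> \<Lambda>" for x z
  proof -
    have "2 *\<^sub>R k1 \<bullet> z \<in> \<int>" "2 *\<^sub>R k2 \<bullet> z \<in> \<int>" "(k1 + k2) \<bullet> z \<in> \<int>" "(k1 - k2) \<bullet> z \<in> \<int>"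
      using int[OF that] by (auto simp: inner_add_left inner_diff_left)
    then show ?thesis by (simp only: trig_mode_shift(1))
  qed
  let ?G1 = "\<lambda>x. (- P1 / pi * (2 * pi) * cos_mode k1 \<alpha>1 x) *\<^sub>R k1
      + (- P2 / pi * (2 * pi) * cos_mode k2 \<alpha>2 x) *\<^sub>R k2"
  let ?G2 = "\<lambda>x. (e1 * (2 * pi) * cos_mode (2 *\<^sub>R k1) (2 * \<alpha>1) x) *\<^sub>R (2 *\<^sub>R k1)
      + (e2 * (2 * pi) * cos_mode (2 *\<^sub>R k2) (2 * \<alpha>2) x) *\<^sub>R (2 *\<^sub>R k2)
      + ((e3 * (2 * pi) * cos_mode (k1 + k2) (\<alpha>1 + \<alpha>2) x) *\<^sub>R (k1 + k2)
      + (e4 * (2 * pi) * cos_mode (k1 - k2) (\<alpha>1 - \<alpha>2) x) *\<^sub>R (k1 - k2))"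
  have eq1: "q \<bullet> ?G1 x + two_mode a A1 \<alpha>1 k1 A2 \<alpha>2 k2 x = a" for x
    by (simp add: two_mode_def inner_add_right inner_diff_right P[symmetric] \<kappa>1_def[symmetric] \<kappa>2_def[symmetric])
  have eq2: "q \<bullet> ?G2 x + (norm (?G1 x))\<^sup>2 / 2 = c" for x
  proof -
    define \<theta>1 where "\<theta>1 = 2 * pi * (k1 \<bullet> x) + \<alpha>1"
    define \<theta>2 where "\<theta>2 = 2 * pi * (k2 \<bullet> x) + \<alpha>2"
    have arg: "2 * pi * (2 *\<^sub>R k1 \<bullet> x) + 2 * \<alpha>1 = 2 * \<theta>1" "2 * pi * (2 *\<^sub>R k2 \<bullet> x) + 2 * \<alpha>2 = 2 * \<theta>2"
      "2 * pi * ((k1 + k2) \<bullet> x) + (\<alpha>1 + \<alpha>2) = \<theta>1 + \<theta>2" "2 * pi * ((k1 - k2) \<bullet> x) + (\<alpha>1 - \<alpha>2) = \<theta>1 - \<theta>2"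
      by (simp_all add: \<theta>1_def \<theta>2_def inner_add_left inner_diff_left algebra_simps)
    have "q \<bullet> ?G2 x = (e1 * (2 * pi) * (2 * \<kappa>1)) * cos (2 * \<theta>1) + (e2 * (2 * pi) * (2 * \<kappa>2)) * cos (2 * \<theta>2)
       + ((e3 * (2 * pi) * (\<kappa>1 + \<kappa>2)) * cos (\<theta>1 + \<theta>2) + (e4 * (2 * pi) * (\<kappa>1 - \<kappa>2)) * cos (\<theta>1 - \<theta>2))"
      unfolding arg by (simp add: inner_add_right inner_diff_right \<kappa>1_def \<kappa>2_def algebra_simps)
    also have "\<dots> = - (P1\<^sup>2 * n1) * (2 * (cos \<theta>1)\<^sup>2 - 1) - (P2\<^sup>2 * n2) * (2 * (cos \<theta>2)\<^sup>2 - 1)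
        - 4 * (P1 * P2 * g) * (cos \<theta>1 * cos \<theta>2)"
      unfolding e cos_add cos_diff cos_double_cos by (simp add: algebra_simps)
    finally have 1: "q \<bullet> ?G2 x = - (P1\<^sup>2 * n1) * (2 * (cos \<theta>1)\<^sup>2 - 1) - (P2\<^sup>2 * n2) * (2 * (cos \<theta>2)\<^sup>2 - 1)
        - 4 * (P1 * P2 * g) * (cos \<theta>1 * cos \<theta>2)" .
    have "?G1 x = (- 2 * P1 * cos \<theta>1) *\<^sub>R k1 + (- 2 * P2 * cos \<theta>2) *\<^sub>R k2"
      by (simp add: \<theta>1_def \<theta>2_def mult_ac)
    then have 2: "(norm (?G1 x))\<^sup>2 = (- 2 * P1 * cos \<theta>1)\<^sup>2 * n1 + 2 * (- 2 * P1 * cos \<theta>1) * (- 2 * P2 * cos \<theta>2) * g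
        + (- 2 * P2 * cos \<theta>2)\<^sup>2 * n2"
      by (simp only: norm_combination_sq n1_def n2_def g_def)
    show ?thesis unfolding 1 2 by (simp add: c_def power_mult_distrib algebra_simps)
  qed
  obtain C where C: "\<forall>t\<ge>1. H (t *\<^sub>R q) \<le> t\<^sup>2 * (norm q)\<^sup>2 / 2 + a + c / t\<^sup>2 + C / t ^ 4"
    using critical_level_upper_expansion[OF \<Lambda> H F1 F2 _ _ eq1 eq2] per1 per2
    unfolding periodic_under_def by blast
  obtain C' where C': "\<forall>t\<ge>1. t\<^sup>2 * (norm q)\<^sup>2 / 2 + a + c / t\<^sup>2 - C' / t ^ 4 \<le> H (t *\<^sub>R q)"
    using critical_level_lower_expansion[OF \<Lambda> H F1 F2 disjI1 eq1 eq2] per1 per2 by blast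
  have "\<bar>H (t *\<^sub>R q) - (t\<^sup>2 * (norm q)\<^sup>2 / 2 + a + c / t\<^sup>2)\<bar> \<le> max C C' / t ^ 4" if "1 \<le> t" for t
  proof -
    have "C / t ^ 4 \<le> max C C' / t ^ 4" "C' / t ^ 4 \<le> max C C' / t ^ 4"
      using that by (auto intro!: divide_right_mono)
    then show ?thesis using C[rule_format, OF that] C'[rule_format, OF that] by linarith
  qed
  then show ?thesis unfolding c by blast
qed

text \<open>
  When q is orthogonal to K = k1 + k2, the mode \<theta>1 + \<theta>2 of |\<nabla>\<phi>1|^2/2, of
  amplitude b = 2P1P2 k1 \<bullet> k2 > 0, is constant along q and cannot be removed by a second
  corrector. Instead a function \<psi> of \<theta>1 + \<theta>2 is added to \<phi>1, which costs
  nothing at order 1 and is chosen to solve the one-dimensional equation |\<nabla>\<psi>|^2/2 + b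
  cos (\<theta>1+\<theta>2) = b at the maximum of its potential. Its solution is \<psi> =
  \<minusplus> (D/\<pi>) cos ((\<theta>1+\<theta>2)/2); both signs solve the equation globally, a
  period may exchange them, and their minimum is periodic. The cross term \<nabla>\<phi>1
  \<bullet> \<nabla>\<psi> has no resonant part and is absorbed by the second corrector.
\<close>

lemma resonant_lower_bound:
  fixes k1 k2 q :: "'a::euclidean_space"
  assumes \<Lambda>: "cocompact \<Lambda>" and H: "\<And>p. critical_level \<Lambda> (two_mode a A1 \<alpha>1 k1 A2 \<alpha>2 k2) p (H p)"
    and int: "\<And>z. z \<in> \<Lambda> \<Longrightarrow> k1 \<bullet> z \<in> \<int>" "\<And>z. z \<in> \<Lambda> \<Longrightarrow> k2 \<bullet> z \<in> \<int>"
    and A: "0 < A1" "0 < A2" and obtuse: "k1 \<bullet> k2 < 0" and K0: "k1 + k2 \<noteq> 0"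
    and q: "q \<bullet> k1 \<noteq> 0" "q \<bullet> (k1 + k2) = 0"
  shows "\<exists>b>0. \<exists>C. \<forall>t\<ge>1. t\<^sup>2 * (norm q)\<^sup>2 / 2 + a +
     (A1\<^sup>2 * (norm k1)\<^sup>2 / (q \<bullet> k1)\<^sup>2 + A2\<^sup>2 * (norm k2)\<^sup>2 / (q \<bullet> k2)\<^sup>2 + b) / t\<^sup>2 - C / t ^ 4
     \<le> H (t *\<^sub>R q)"
proof -
  define \<kappa> where "\<kappa> = q \<bullet> k1"
  have \<kappa>2: "q \<bullet> k2 = - \<kappa>" using q(2) by (simp add: \<kappa>_def inner_add_right)
  have \<kappa>: "\<kappa> \<noteq> 0" using q(1) by (simp add: \<kappa>_def)
  define P1 where "P1 = A1 / \<kappa>"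
  define P2 where "P2 = - A2 / \<kappa>"
  have P: "P1 * \<kappa> = A1" "P2 * \<kappa> = - A2" using \<kappa> by (auto simp: P1_def P2_def)
  define K where "K = k1 + k2"
  define n1 where "n1 = (norm k1)\<^sup>2"
  define n2 where "n2 = (norm k2)\<^sup>2"
  define g where "g = k1 \<bullet> k2"
  define b where "b = 2 * (P1 * P2 * g)"
  have "P1 * P2 * g = A1 * A2 * (- g) / \<kappa>\<^sup>2" by (simp add: P1_def P2_def power2_eq_square)
  moreover have "0 < A1 * A2 * (- g) / \<kappa>\<^sup>2"
    using A obtuse \<kappa> by (intro divide_pos_pos mult_pos_pos) (auto simp: g_def)
  ultimately have b: "0 < b" by (simp add: b_def)
  \<comment> \<open>Chosen so that D^2|K|^2 (sin h)^2/2 = b (1 - cos 2h) with 2h = \<theta>1 + \<theta>2.\<close>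
  define D where "D = 2 * sqrt b / norm K"
  have D: "D\<^sup>2 * (norm K)\<^sup>2 = 4 * b"
    using b K0 by (simp add: D_def K_def power_divide power_mult_distrib)
  define c where "c = P1\<^sup>2 * n1 + P2\<^sup>2 * n2 + b"
  have c: "c = A1\<^sup>2 * (norm k1)\<^sup>2 / (q \<bullet> k1)\<^sup>2 + A2\<^sup>2 * (norm k2)\<^sup>2 / (q \<bullet> k2)\<^sup>2 + b"
    unfolding c_def P1_def P2_def n1_def n2_def \<kappa>2 by (simp add: \<kappa>_def power_divide)
  define sg where "sg = (\<lambda>\<sigma>. if \<sigma> then 1 else - 1 :: real)"
  have sg: "(sg \<sigma>)\<^sup>2 = 1" "sg (\<not> \<sigma>) = - sg \<sigma>" for \<sigma> by (auto simp: sg_def)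
  define h1 where "h1 = k1 \<bullet> K"
  define h2 where "h2 = k2 \<bullet> K"
  define e1 where "e1 = - (P1\<^sup>2 * n1) / (4 * pi * \<kappa>)"
  define e2 where "e2 = P2\<^sup>2 * n2 / (4 * pi * \<kappa>)"
  define e4 where "e4 = - (P1 * P2 * g) / (2 * pi * \<kappa>)"
  \<comment> \<open>These coefficients remove the cross term \<nabla>\<phi>1 \<bullet> \<nabla>\<psi>.\<close>
  define f1 where "f1 = P1 * h1 / (pi * \<kappa>)"
  define f2 where "f2 = - P2 * h2 / (pi * \<kappa>)"
  have e: "e1 * (2 * pi) * (2 * \<kappa>) = - (P1\<^sup>2 * n1)" "e2 * (2 * pi) * (2 * \<kappa>) = P2\<^sup>2 * n2"
     "e4 * (2 * pi) * (2 * \<kappa>) = - 2 * (P1 * P2 * g)"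
     "f1 * (2 * pi) * \<kappa> = 2 * P1 * h1" "f2 * (2 * pi) * \<kappa> = - (2 * P2 * h2)"
    unfolding e1_def e2_def e4_def f1_def f2_def using \<kappa> by (simp_all add: divide_simps)
  define \<beta> where "\<beta> = (\<alpha>1 + \<alpha>2) / 2"
  let ?\<phi>1 = "\<lambda>\<sigma> x. - P1 / pi * sin_mode k1 \<alpha>1 x + - P2 / pi * sin_mode k2 \<alpha>2 x
     + - (sg \<sigma> * D / pi) * cos_mode ((1/2) *\<^sub>R K) \<beta> x"
  let ?\<phi>2 = "\<lambda>\<sigma> x. e1 * sin_mode (2 *\<^sub>R k1) (2 * \<alpha>1) x + e2 * sin_mode (2 *\<^sub>R k2) (2 * \<alpha>2) x +
     e4 * sin_mode (k1 - k2) (\<alpha>1 - \<alpha>2) x +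
     (sg \<sigma> * D * sin_mode ((1/2) *\<^sub>R K) \<beta> x) *
       (f1 * sin_mode k1 \<alpha>1 x + f2 * sin_mode k2 \<alpha>2 x)"
  have per: "(\<forall>x \<sigma>. ?\<phi>1 \<sigma> (x + z) = ?\<phi>1 \<sigma> x \<and> ?\<phi>2 \<sigma> (x + z) = ?\<phi>2 \<sigma> x) \<or>
        (\<forall>x \<sigma>. ?\<phi>1 \<sigma> (x + z) = ?\<phi>1 (\<not> \<sigma>) x \<and> ?\<phi>2 \<sigma> (x + z) = ?\<phi>2 (\<not> \<sigma>) x)" if z: "z \<in> \<Lambda>" for z
  proof -
    have ints: "2 *\<^sub>R k1 \<bullet> z \<in> \<int>" "2 *\<^sub>R k2 \<bullet> z \<in> \<int>" "K \<bullet> z \<in> \<int>" "(k1 - k2) \<bullet> z \<in> \<int>"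
      using int[OF z] by (auto simp: inner_add_left inner_diff_left K_def)
    obtain \<epsilon> :: real where \<epsilon>: "\<epsilon> \<in> {1, -1}" and half:
      "\<And>x. sin_mode ((1/2) *\<^sub>R K) \<beta> (x + z) = \<epsilon> * sin_mode ((1/2) *\<^sub>R K) \<beta> x"
      "\<And>x. cos_mode ((1/2) *\<^sub>R K) \<beta> (x + z) = \<epsilon> * cos_mode ((1/2) *\<^sub>R K) \<beta> x"
      by (rule half_mode_shift[OF ints(3)]) blast
    note shifts = half trig_mode_shift(1)[OF ints(1)] trig_mode_shift(1)[OF ints(2)]
      trig_mode_shift(1)[OF ints(4)] trig_mode_shift(1)[OF int(1)[OF z]] trig_mode_shift(1)[OF int(2)[OF z]]
    from \<epsilon> consider "\<epsilon> = 1" | "\<epsilon> = -1" by blast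
    then show ?thesis
    proof cases
      case 1
      show ?thesis unfolding shifts 1 by (intro disjI1) simp
    next
      case 2
      show ?thesis unfolding shifts 2 sg by (intro disjI2) simp
    qed
  qed
  let ?G1 = "\<lambda>\<sigma> x. (- P1 / pi * (2 * pi) * cos_mode k1 \<alpha>1 x) *\<^sub>R k1
      + (- P2 / pi * (2 * pi) * cos_mode k2 \<alpha>2 x) *\<^sub>R k2
      + (- (- (sg \<sigma> * D / pi)) * (2 * pi) * sin_mode ((1/2) *\<^sub>R K) \<beta> x) *\<^sub>R ((1/2) *\<^sub>R K)"
  let ?G2 = "\<lambda>\<sigma> x. (e1 * (2 * pi) * cos_mode (2 *\<^sub>R k1) (2 * \<alpha>1) x) *\<^sub>R (2 *\<^sub>R k1)
      + (e2 * (2 * pi) * cos_mode (2 *\<^sub>R k2) (2 * \<alpha>2) x) *\<^sub>R (2 *\<^sub>R k2)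
      + (e4 * (2 * pi) * cos_mode (k1 - k2) (\<alpha>1 - \<alpha>2) x) *\<^sub>R (k1 - k2)
      + ((sg \<sigma> * D * sin_mode ((1/2) *\<^sub>R K) \<beta> x) *\<^sub>R
           ((f1 * (2 * pi) * cos_mode k1 \<alpha>1 x) *\<^sub>R k1 + (f2 * (2 * pi) * cos_mode k2 \<alpha>2 x) *\<^sub>R k2)
         + (f1 * sin_mode k1 \<alpha>1 x + f2 * sin_mode k2 \<alpha>2 x) *\<^sub>R
           ((sg \<sigma> * D * (2 * pi) * cos_mode ((1/2) *\<^sub>R K) \<beta> x) *\<^sub>R ((1/2) *\<^sub>R K)))"
  have F1: "C1_bounded (?\<phi>1 \<sigma>) (?G1 \<sigma>)" for \<sigma>
    by (intro C1_bounded_add C1_bounded_sin C1_bounded_cos)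
  have F2: "C1_bounded (?\<phi>2 \<sigma>) (?G2 \<sigma>)" for \<sigma>
    by (intro C1_bounded_add C1_bounded_mult C1_bounded_sin)
  have qK: "q \<bullet> K = 0" using q(2) by (simp add: K_def)
  have G1: "?G1 \<sigma> x = ((- 2 * P1 * cos_mode k1 \<alpha>1 x) *\<^sub>R k1 + (- 2 * P2 * cos_mode k2 \<alpha>2 x) *\<^sub>R k2)
      + (sg \<sigma> * D * sin_mode ((1/2) *\<^sub>R K) \<beta> x) *\<^sub>R K" for \<sigma> x
    by (simp add: mult_ac)
  have eq1: "q \<bullet> ?G1 \<sigma> x + two_mode a A1 \<alpha>1 k1 A2 \<alpha>2 k2 x = a" for \<sigma> x
  proof -
    have "q \<bullet> ?G1 \<sigma> x = - 2 * (P1 * \<kappa>) * cos_mode k1 \<alpha>1 x + 2 * (P2 * \<kappa>) * cos_mode k2 \<alpha>2 x"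
      unfolding G1 inner_add_right inner_scaleR_right qK \<kappa>2 \<kappa>_def[symmetric] by simp
    then show ?thesis unfolding P by (simp add: two_mode_def)
  qed
  have eq2: "q \<bullet> ?G2 \<sigma> x + (norm (?G1 \<sigma> x))\<^sup>2 / 2 = c" for \<sigma> x
  proof -
    define \<theta>1 where "\<theta>1 = 2 * pi * (k1 \<bullet> x) + \<alpha>1"
    define \<theta>2 where "\<theta>2 = 2 * pi * (k2 \<bullet> x) + \<alpha>2"
    define h where "h = 2 * pi * ((1/2) *\<^sub>R K \<bullet> x) + \<beta>"
    define Z where "Z = sg \<sigma> * D * sin h"
    have arg: "2 * pi * (2 *\<^sub>R k1 \<bullet> x) + 2 * \<alpha>1 = 2 * \<theta>1" "2 * pi * (2 *\<^sub>R k2 \<bullet> x) + 2 * \<alpha>2 = 2 * \<theta>2"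
      "2 * pi * ((k1 - k2) \<bullet> x) + (\<alpha>1 - \<alpha>2) = \<theta>1 - \<theta>2"
      by (simp_all add: \<theta>1_def \<theta>2_def inner_diff_left algebra_simps)
    have h2: "2 * h = \<theta>1 + \<theta>2"
      by (simp add: h_def \<theta>1_def \<theta>2_def \<beta>_def K_def inner_add_left algebra_simps)
    have "q \<bullet> ?G2 \<sigma> x = (e1 * (2 * pi) * (2 * \<kappa>)) * cos (2 * \<theta>1) - (e2 * (2 * pi) * (2 * \<kappa>)) * cos (2 * \<theta>2)
       + (e4 * (2 * pi) * (2 * \<kappa>)) * cos (\<theta>1 - \<theta>2)
       + Z * ((f1 * (2 * pi) * \<kappa>) * cos \<theta>1 - (f2 * (2 * pi) * \<kappa>) * cos \<theta>2)"
      unfolding arg \<theta>1_def[symmetric] \<theta>2_def[symmetric] h_def[symmetric] Z_def[symmetric]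
        inner_add_right inner_scaleR_right inner_diff_right qK \<kappa>2 \<kappa>_def[symmetric]
      by (simp add: algebra_simps)
    also have "\<dots> = - (P1\<^sup>2 * n1) * (2 * (cos \<theta>1)\<^sup>2 - 1) - (P2\<^sup>2 * n2) * (2 * (cos \<theta>2)\<^sup>2 - 1)
        - b * (cos \<theta>1 * cos \<theta>2 + sin \<theta>1 * sin \<theta>2) + Z * (2 * P1 * h1 * cos \<theta>1 + 2 * P2 * h2 * cos \<theta>2)"
      unfolding e cos_diff cos_double_cos b_def by (simp add: algebra_simps)
    finally have 1: "q \<bullet> ?G2 \<sigma> x = \<dots>" .
    let ?u = "(- 2 * P1 * cos \<theta>1) *\<^sub>R k1 + (- 2 * P2 * cos \<theta>2) *\<^sub>R k2"
    have "(norm (?G1 \<sigma> x))\<^sup>2 = (norm (1 *\<^sub>R ?u + Z *\<^sub>R K))\<^sup>2"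
      unfolding G1 \<theta>1_def \<theta>2_def h_def Z_def by (simp only: scaleR_one)
    also have "\<dots> = (norm ?u)\<^sup>2 + 2 * Z * (?u \<bullet> K) + Z\<^sup>2 * (norm K)\<^sup>2"
      by (simp only: norm_combination_sq power_one mult_1 mult_1_right)
    also have "?u \<bullet> K = - 2 * P1 * cos \<theta>1 * h1 - 2 * P2 * cos \<theta>2 * h2"
      by (simp add: inner_add_left inner_diff_left h1_def h2_def)
    also have "(norm ?u)\<^sup>2 = (- 2 * P1 * cos \<theta>1)\<^sup>2 * n1 + 2 * (- 2 * P1 * cos \<theta>1) * (- 2 * P2 * cos \<theta>2) * g
        + (- 2 * P2 * cos \<theta>2)\<^sup>2 * n2"
      by (simp only: norm_combination_sq n1_def n2_def g_def)
    also have "Z\<^sup>2 * (norm K)\<^sup>2 = (sg \<sigma>)\<^sup>2 * (D\<^sup>2 * (norm K)\<^sup>2) * (sin h)\<^sup>2"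
      by (simp add: Z_def power_mult_distrib)
    also have "\<dots> = 2 * b * (1 - cos (2 * h))"
      unfolding D sg cos_double_sin by (simp add: algebra_simps)
    also have "\<dots> = 2 * b * (1 - (cos \<theta>1 * cos \<theta>2 - sin \<theta>1 * sin \<theta>2))"
      unfolding h2 cos_add ..
    finally have 2: "(norm (?G1 \<sigma> x))\<^sup>2 = (- 2 * P1 * cos \<theta>1)\<^sup>2 * n1
        + 2 * (- 2 * P1 * cos \<theta>1) * (- 2 * P2 * cos \<theta>2) * g + (- 2 * P2 * cos \<theta>2)\<^sup>2 * n2
        + 2 * Z * (- 2 * P1 * cos \<theta>1 * h1 - 2 * P2 * cos \<theta>2 * h2)
        + 2 * b * (1 - (cos \<theta>1 * cos \<theta>2 - sin \<theta>1 * sin \<theta>2))" .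
    have g4: "2 * (- 2 * P1 * cos \<theta>1) * (- 2 * P2 * cos \<theta>2) * g = 4 * b * (cos \<theta>1 * cos \<theta>2)"
      by (simp add: b_def)
    show ?thesis unfolding 1 2 g4
      by (simp add: c_def power_mult_distrib add_divide_distrib diff_divide_distrib algebra_simps)
  qed
  obtain C where "\<forall>t\<ge>1. t\<^sup>2 * (norm q)\<^sup>2 / 2 + a + c / t\<^sup>2 - C / t ^ 4 \<le> H (t *\<^sub>R q)"
    using critical_level_lower_expansion[OF \<Lambda> H F1 F2 per eq1 eq2] by blast
  then show ?thesis using b unfolding c by blast
qed

section \<open>Dilations and orthogonal sums of solutions\<close>

text \<open>
  The sign \<sigma> = 1 gives subsolutions and \<sigma> = -1 supersolutions, so that arguments
  that treat both alike are carried out once.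
\<close>

definition viscosity_sided ::
    "real \<Rightarrow> ('a::euclidean_space \<Rightarrow> 'a \<Rightarrow> real) \<Rightarrow> ('a \<Rightarrow> real) \<Rightarrow> bool" where
  "viscosity_sided \<sigma> F u \<longleftrightarrow>
     (\<forall>\<phi> D\<phi> x. C1_with_gradient \<phi> D\<phi> \<longrightarrow>
        (\<forall>\<^sub>F y in nhds x. \<sigma> * (u y - \<phi> y) \<le> \<sigma> * (u x - \<phi> x)) \<longrightarrow> \<sigma> * F x (D\<phi> x) \<le> 0)"

lemma continuous_viscosity_solution_iff_sided:
  "continuous_viscosity_solution F u \<longleftrightarrow>
     continuous_on UNIV u \<and> viscosity_sided 1 F u \<and> viscosity_sided (-1) F u"
proof -
  have "(- 1 * (a - b) \<le> - 1 * (c - d)) = (c - d \<le> a - b)" "(- 1 * a \<le> 0) = (0 \<le> a)" for a b c d :: real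
    by auto
  then have "viscosity_sided (-1) F u \<longleftrightarrow> viscosity_supersolution F u"
    by (simp only: viscosity_sided_def viscosity_supersolution_def)
  moreover have "viscosity_sided 1 F u \<longleftrightarrow> viscosity_subsolution F u"
    by (simp only: viscosity_sided_def viscosity_subsolution_def mult_1)
  ultimately show ?thesis by (simp only: continuous_viscosity_solution_def)
qed

lemma eventually_nhds_continuous:
  assumes "continuous_on UNIV f" "\<forall>\<^sub>F y in nhds (f w). P y"
  shows "\<forall>\<^sub>F w' in nhds w. P (f w')"
proof -
  obtain S where S: "open S" "f w \<in> S" "\<And>y. y \<in> S \<Longrightarrow> P y"
    using assms(2) unfolding eventually_nhds by blast
  then have "open (f -` S)" using assms(1) by (simp add: open_vimage)
  then show ?thesis using S unfolding eventually_nhds by (intro exI[of _ "f -` S"]) auto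
qed

lemma C1_affine_compose:
  fixes \<phi> :: "'a::euclidean_space \<Rightarrow> real"
  assumes C1: "C1_with_gradient \<phi> D\<phi>" and c: "c \<noteq> 0"
  shows "C1_with_gradient (\<lambda>w. \<phi> (c *\<^sub>R (w - b)) / c) (\<lambda>w. D\<phi> (c *\<^sub>R (w - b)))"
  unfolding C1_with_gradient_def
proof (intro conjI allI)
  fix w
  have "((\<lambda>w. c *\<^sub>R (w - b)) has_derivative (\<lambda>h. c *\<^sub>R h)) (at w)"
    by (auto intro!: derivative_eq_intros)
  moreover have "(\<phi> has_derivative (\<lambda>v. v \<bullet> D\<phi> (c *\<^sub>R (w - b)))) (at (c *\<^sub>R (w - b)))"
    using C1 by (simp add: C1_with_gradient_def gderiv_def)
  ultimately have "((\<lambda>w. \<phi> (c *\<^sub>R (w - b))) has_derivative (\<lambda>h. (c *\<^sub>R h) \<bullet> D\<phi> (c *\<^sub>R (w - b)))) (at w)"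
    by (rule has_derivative_compose)
  from has_derivative_mult_right[OF this, of "1 / c"] c
  show "GDERIV (\<lambda>w. \<phi> (c *\<^sub>R (w - b)) / c) w :> D\<phi> (c *\<^sub>R (w - b))"
    by (simp add: gderiv_def)
  have "continuous_on UNIV D\<phi>" using C1 by (simp add: C1_with_gradient_def)
  then show "continuous_on UNIV (\<lambda>w. D\<phi> (c *\<^sub>R (w - b)))"
    by (rule continuous_on_compose2) (auto intro!: continuous_intros)
qed

lemma C1_along_line:
  fixes \<phi> :: "'a::euclidean_space \<Rightarrow> real"
  assumes C1: "C1_with_gradient \<phi> D\<phi>"
  shows "C1_with_gradient (\<lambda>s. c * \<phi> (x + (s - s0) *\<^sub>R w)) (\<lambda>s. c * (D\<phi> (x + (s - s0) *\<^sub>R w) \<bullet> w))"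
proof -
  have "GDERIV (\<lambda>s. \<phi> (x + (s - s0) *\<^sub>R w)) s :> D\<phi> (x + (s - s0) *\<^sub>R w) \<bullet> w" for s
  proof -
    have "((\<lambda>s. x + (s - s0) *\<^sub>R w) has_derivative (\<lambda>h. h *\<^sub>R w)) (at s)"
      by (auto intro!: derivative_eq_intros)
    moreover have "(\<phi> has_derivative (\<lambda>v. v \<bullet> D\<phi> (x + (s - s0) *\<^sub>R w))) (at (x + (s - s0) *\<^sub>R w))"
      using C1 by (simp add: C1_with_gradient_def gderiv_def)
    ultimately have "((\<lambda>s. \<phi> (x + (s - s0) *\<^sub>R w)) has_derivative (\<lambda>h. (h *\<^sub>R w) \<bullet> D\<phi> (x + (s - s0) *\<^sub>R w))) (at s)"
      by (rule has_derivative_compose)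
    then show ?thesis unfolding gderiv_def by (simp add: inner_commute)
  qed
  moreover have "continuous_on UNIV (\<lambda>s. D\<phi> (x + (s - s0) *\<^sub>R w) \<bullet> w)"
  proof -
    have "continuous_on UNIV D\<phi>" using C1 by (simp add: C1_with_gradient_def)
    then have "continuous_on UNIV (\<lambda>s. D\<phi> (x + (s - s0) *\<^sub>R w))"
      by (rule continuous_on_compose2) (auto intro!: continuous_intros)
    then show ?thesis by (intro continuous_intros)
  qed
  ultimately have "C1_with_gradient (\<lambda>s. \<phi> (x + (s - s0) *\<^sub>R w)) (\<lambda>s. D\<phi> (x + (s - s0) *\<^sub>R w) \<bullet> w)"
    by (simp add: C1_with_gradient_def)
  from C1_scale[OF this, of c] show ?thesis by simp
qed

text \<open>
  If v solves the problem for V2, then c v(x/c + x0) has the same gradients at corresponding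
  points and solves it for V1. For c < 0 the transformation would exchange sub- and
  supersolutions.
\<close>

lemma critical_level_rescale:
  fixes V1 V2 :: "'a::euclidean_space \<Rightarrow> real"
  assumes crit: "critical_level \<Lambda> V2 p \<mu>" and c: "0 < c"
    and V: "\<And>x. V1 x = V2 (x /\<^sub>R c + x0)"
    and \<Lambda>': "\<And>z. z \<in> \<Lambda>' \<Longrightarrow> z /\<^sub>R c \<in> \<Lambda>"
  shows "critical_level \<Lambda>' V1 p \<mu>"
proof -
  obtain v where v: "periodic_under \<Lambda> v" "continuous_on UNIV v"
    "viscosity_sided 1 (cell_operator V2 p \<mu>) v" "viscosity_sided (-1) (cell_operator V2 p \<mu>) v"
    using crit by (auto simp: critical_level_def continuous_viscosity_solution_iff_sided)
  define w where "w = (\<lambda>x. c * v (x /\<^sub>R c + x0))"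
  have "periodic_under \<Lambda>' w" unfolding periodic_under_def w_def
  proof (intro allI ballI)
    fix x z assume "z \<in> \<Lambda>'"
    then have "v ((x /\<^sub>R c + x0) + z /\<^sub>R c) = v (x /\<^sub>R c + x0)"
      using v(1) \<Lambda>' by (simp add: periodic_under_def)
    then show "c * v ((x + z) /\<^sub>R c + x0) = c * v (x /\<^sub>R c + x0)" by (simp add: algebra_simps)
  qed
  moreover have "continuous_on UNIV w" unfolding w_def
    by (intro continuous_intros continuous_on_compose2[OF v(2)]) auto
  moreover have "viscosity_sided \<sigma> (cell_operator V1 p \<mu>) w"
    if vs: "viscosity_sided \<sigma> (cell_operator V2 p \<mu>) v" for \<sigma>
    unfolding viscosity_sided_def
  proof (intro allI impI)
    fix \<phi> D\<phi> x
    assume C1: "C1_with_gradient \<phi> D\<phi>"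
      and touch: "\<forall>\<^sub>F y in nhds x. \<sigma> * (w y - \<phi> y) \<le> \<sigma> * (w x - \<phi> x)"
    let ?x = "x /\<^sub>R c + x0"
    let ?f = "\<lambda>y. c *\<^sub>R (y - x0)"
    have fx: "?f ?x = x" using c by simp
    have "continuous_on UNIV ?f" by (intro continuous_intros)
    then have "\<forall>\<^sub>F y in nhds ?x. \<sigma> * (w (?f y) - \<phi> (?f y)) \<le> \<sigma> * (w x - \<phi> x)"
      by (rule eventually_nhds_continuous[where P = "\<lambda>y. \<sigma> * (w y - \<phi> y) \<le> \<sigma> * (w x - \<phi> x)"])
        (simp only: fx touch)
    then have "\<forall>\<^sub>F y in nhds ?x. \<sigma> * (v y - \<phi> (?f y) / c) \<le> \<sigma> * (v ?x - \<phi> (?f ?x) / c)"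
    proof eventually_elim
      case (elim y)
      have "?f y /\<^sub>R c + x0 = y" using c by simp
      then have "c * (\<sigma> * (v y - \<phi> (?f y) / c)) \<le> c * (\<sigma> * (v ?x - \<phi> x / c))"
        using elim c by (simp add: w_def algebra_simps)
      then show ?case unfolding fx using c by (rule mult_left_le_imp_le)
    qed
    moreover have "C1_with_gradient (\<lambda>y. \<phi> (?f y) / c) (\<lambda>y. D\<phi> (?f y))"
      using c by (intro C1_affine_compose C1) simp
    ultimately have "\<sigma> * cell_operator V2 p \<mu> ?x (D\<phi> (?f ?x)) \<le> 0"
      using vs unfolding viscosity_sided_def by blast
    then show "\<sigma> * cell_operator V1 p \<mu> x (D\<phi> x) \<le> 0" unfolding fx V .
  qed
  ultimately show ?thesis
    using v(3,4) unfolding critical_level_def continuous_viscosity_solution_iff_sided by blast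
qed

text \<open>
  A test function for v, restricted to a line along which a multiple of v differs from u by a
  constant, is a test function for the one-dimensional function u.
\<close>

lemma viscosity_sided_restrict_line:
  fixes v :: "'a::euclidean_space \<Rightarrow> real"
  assumes u: "viscosity_sided \<sigma> F u" and C1: "C1_with_gradient \<phi> D\<phi>"
    and touch: "\<forall>\<^sub>F y in nhds x. \<sigma> * (v y - \<phi> y) \<le> \<sigma> * (v x - \<phi> x)"
    and c: "0 < c" and line: "\<And>s. c * v (x + (s - s0) *\<^sub>R w) = u s + b"
  shows "\<sigma> * F s0 (c * (D\<phi> x \<bullet> w)) \<le> 0"
proof -
  let ?f = "\<lambda>s. x + (s - s0) *\<^sub>R w"
  have fx: "?f s0 = x" by simp
  have "continuous_on UNIV ?f" by (intro continuous_intros)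
  then have "\<forall>\<^sub>F s in nhds s0. \<sigma> * (v (?f s) - \<phi> (?f s)) \<le> \<sigma> * (v x - \<phi> x)"
    by (rule eventually_nhds_continuous[where P = "\<lambda>y. \<sigma> * (v y - \<phi> y) \<le> \<sigma> * (v x - \<phi> x)"])
      (simp only: fx touch)
  then have "\<forall>\<^sub>F s in nhds s0. \<sigma> * (u s - c * \<phi> (?f s)) \<le> \<sigma> * (u s0 - c * \<phi> (?f s0))"
  proof eventually_elim
    case (elim s)
    then have "c * (\<sigma> * (v (?f s) - \<phi> (?f s))) \<le> c * (\<sigma> * (v x - \<phi> x))"
      using c by simp
    then have "\<sigma> * (c * v (?f s) - c * \<phi> (?f s)) \<le> \<sigma> * (c * v (?f s0) - c * \<phi> (?f s0))"
      by (simp add: algebra_simps)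
    then show ?case unfolding line by (simp add: algebra_simps)
  qed
  with u C1_along_line[OF C1, of c x s0 w]
  have "\<sigma> * F s0 (c * (D\<phi> (?f s0) \<bullet> w)) \<le> 0" unfolding viscosity_sided_def by blast
  then show ?thesis by simp
qed

text \<open>
  A test function touching a constant has vanishing derivative. Applied with F = q and F = -q
  along a line on which a solution is constant, this shows that the gradient of a test function
  has no component along it.
\<close>

lemma viscosity_sided_constant:
  fixes F :: "real \<Rightarrow> real \<Rightarrow> real"
  assumes \<sigma>: "\<sigma> \<in> {1, -1}" and F: "\<And>s. F s 0 = 0"
  shows "viscosity_sided \<sigma> F (\<lambda>_. 0)"
  unfolding viscosity_sided_def
proof (intro allI impI)
  fix \<phi> D\<phi> :: "real \<Rightarrow> real" and s
  assume C1: "C1_with_gradient \<phi> D\<phi>"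
    and touch: "\<forall>\<^sub>F y in nhds s. \<sigma> * (0 - \<phi> y) \<le> \<sigma> * (0 - \<phi> s)"
  have "DERIV \<phi> s :> D\<phi> s" using C1 by (simp add: C1_with_gradient_def)
  then have der: "DERIV (\<lambda>y. \<sigma> * \<phi> y) s :> \<sigma> * D\<phi> s" by (rule DERIV_cmult)
  obtain d where d: "d > 0" "\<And>y. dist y s < d \<Longrightarrow> \<sigma> * (0 - \<phi> y) \<le> \<sigma> * (0 - \<phi> s)"
    using touch unfolding eventually_nhds_metric by blast
  have "\<forall>y. \<bar>s - y\<bar> < d \<longrightarrow> \<sigma> * \<phi> s \<le> \<sigma> * \<phi> y"
  proof (intro allI impI)
    fix y assume "\<bar>s - y\<bar> < d"
    then show "\<sigma> * \<phi> s \<le> \<sigma> * \<phi> y" using d(2)[of y] by (simp add: dist_real_def abs_minus_commute)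
  qed
  with der d(1) have "\<sigma> * D\<phi> s = 0" by (rule DERIV_local_min)
  then have "D\<phi> s = 0" using \<sigma> by auto
  then show "\<sigma> * F s (D\<phi> s) \<le> 0" by (simp add: F)
qed

text \<open>
  The solution is w1(k1 \<bullet> x + \<beta>1)/|k1| + w2(k2 \<bullet> x + \<beta>2)/|k2|.
  Restriction to the lines in directions k1 and k2 yields the one-dimensional inequalities, and a
  test gradient has no component orthogonal to both, so Pythagoras adds the energies. The
  normalisation by |k_j| makes the one-dimensional problems independent of the lengths of k1 and
  k2.
\<close>

lemma critical_level_orthogonal_sum:
  fixes k1 k2 p :: "'a::euclidean_space"
  assumes k: "k1 \<noteq> 0" "k2 \<noteq> 0" "k1 \<bullet> k2 = 0"
    and int: "\<And>z. z \<in> \<Lambda> \<Longrightarrow> k1 \<bullet> z \<in> \<int>" "\<And>z. z \<in> \<Lambda> \<Longrightarrow> k2 \<bullet> z \<in> \<int>"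
    and crit1: "critical_level \<int> f1 (p \<bullet> k1 / norm k1) \<mu>1"
    and crit2: "critical_level \<int> f2 (p \<bullet> k2 / norm k2) \<mu>2"
    and V: "\<And>x. V x = a + f1 (k1 \<bullet> x + \<beta>1) + f2 (k2 \<bullet> x + \<beta>2)"
  shows "critical_level \<Lambda> V p
     (a + ((norm p)\<^sup>2 - (p \<bullet> k1 / norm k1)\<^sup>2 - (p \<bullet> k2 / norm k2)\<^sup>2) / 2 + \<mu>1 + \<mu>2)"
proof -
  define P1 where "P1 = p \<bullet> k1 / norm k1"
  define P2 where "P2 = p \<bullet> k2 / norm k2"
  define \<mu> where "\<mu> = a + ((norm p)\<^sup>2 - P1\<^sup>2 - P2\<^sup>2) / 2 + \<mu>1 + \<mu>2"
  have n: "norm k1 > 0" "norm k2 > 0" using k by auto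
  have k21: "k2 \<bullet> k1 = 0" using k(3) by (simp add: inner_commute)
  obtain w1 where w1: "periodic_under \<int> w1" "continuous_on UNIV w1"
    "viscosity_sided 1 (cell_operator f1 P1 \<mu>1) w1" "viscosity_sided (-1) (cell_operator f1 P1 \<mu>1) w1"
    using crit1 by (auto simp: critical_level_def continuous_viscosity_solution_iff_sided P1_def)
  obtain w2 where w2: "periodic_under \<int> w2" "continuous_on UNIV w2"
    "viscosity_sided 1 (cell_operator f2 P2 \<mu>2) w2" "viscosity_sided (-1) (cell_operator f2 P2 \<mu>2) w2"
    using crit2 by (auto simp: critical_level_def continuous_viscosity_solution_iff_sided P2_def)
  define v where "v = (\<lambda>x. w1 (k1 \<bullet> x + \<beta>1) / norm k1 + w2 (k2 \<bullet> x + \<beta>2) / norm k2)"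
  have "periodic_under \<Lambda> v" unfolding periodic_under_def v_def
  proof (intro allI ballI)
    fix x z assume z: "z \<in> \<Lambda>"
    have "w1 ((k1 \<bullet> x + \<beta>1) + k1 \<bullet> z) = w1 (k1 \<bullet> x + \<beta>1)" "w2 ((k2 \<bullet> x + \<beta>2) + k2 \<bullet> z) = w2 (k2 \<bullet> x + \<beta>2)"
      using w1(1) w2(1) int[OF z] by (auto simp: periodic_under_def)
    then show "w1 (k1 \<bullet> (x + z) + \<beta>1) / norm k1 + w2 (k2 \<bullet> (x + z) + \<beta>2) / norm k2
        = w1 (k1 \<bullet> x + \<beta>1) / norm k1 + w2 (k2 \<bullet> x + \<beta>2) / norm k2"
      by (simp add: inner_add_right algebra_simps)
  qed
  moreover have "continuous_on UNIV v" unfolding v_def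
    by (intro continuous_intros continuous_on_compose2[OF w1(2)] continuous_on_compose2[OF w2(2)]) (use k in auto)
  moreover have "viscosity_sided \<sigma> (cell_operator V p \<mu>) v"
    if \<sigma>: "\<sigma> \<in> {1, -1}" and s1: "viscosity_sided \<sigma> (cell_operator f1 P1 \<mu>1) w1"
      and s2: "viscosity_sided \<sigma> (cell_operator f2 P2 \<mu>2) w2" for \<sigma>
    unfolding viscosity_sided_def
  proof (intro allI impI)
    fix \<phi> D\<phi> x
    assume C1: "C1_with_gradient \<phi> D\<phi>"
      and touch: "\<forall>\<^sub>F y in nhds x. \<sigma> * (v y - \<phi> y) \<le> \<sigma> * (v x - \<phi> x)"
    define d where "d = D\<phi> x"
    define D1 where "D1 = d \<bullet> k1 / norm k1"
    define D2 where "D2 = d \<bullet> k2 / norm k2"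
    define t1 where "t1 = k1 \<bullet> x + \<beta>1"
    define t2 where "t2 = k2 \<bullet> x + \<beta>2"
    have sq: "norm k1 * norm k1 = k1 \<bullet> k1" "norm k2 * norm k2 = k2 \<bullet> k2"
      by (simp_all add: dot_square_norm power2_eq_square)
    have kk: "k1 \<bullet> k1 \<noteq> 0" "k2 \<bullet> k2 \<noteq> 0" using k by auto
    have "k1 \<bullet> (x + (s - t1) *\<^sub>R ((1 / (k1 \<bullet> k1)) *\<^sub>R k1)) + \<beta>1 = s"
      "k2 \<bullet> (x + (s - t1) *\<^sub>R ((1 / (k1 \<bullet> k1)) *\<^sub>R k1)) + \<beta>2 = t2" for s
      using kk(1) by (simp_all add: inner_add_right k21 t1_def t2_def del: inner_eq_zero_iff)
    then have line1: "norm k1 * v (x + (s - t1) *\<^sub>R ((1 / (k1 \<bullet> k1)) *\<^sub>R k1))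
        = w1 s + norm k1 * (w2 t2 / norm k2)" for s
      unfolding v_def using n by (simp add: distrib_left)
    have "k2 \<bullet> (x + (s - t2) *\<^sub>R ((1 / (k2 \<bullet> k2)) *\<^sub>R k2)) + \<beta>2 = s"
      "k1 \<bullet> (x + (s - t2) *\<^sub>R ((1 / (k2 \<bullet> k2)) *\<^sub>R k2)) + \<beta>1 = t1" for s
      using kk(2) by (simp_all add: inner_add_right k(3) t1_def t2_def del: inner_eq_zero_iff)
    then have line2: "norm k2 * v (x + (s - t2) *\<^sub>R ((1 / (k2 \<bullet> k2)) *\<^sub>R k2))
        = w2 s + norm k2 * (w1 t1 / norm k1)" for s
      unfolding v_def using n by (simp add: distrib_left)
    have "\<sigma> * cell_operator f1 P1 \<mu>1 t1 (norm k1 * (D\<phi> x \<bullet> ((1 / (k1 \<bullet> k1)) *\<^sub>R k1))) \<le> 0"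
      by (rule viscosity_sided_restrict_line[OF s1 C1 touch n(1) line1])
    moreover have "norm k1 * (D\<phi> x \<bullet> ((1 / (k1 \<bullet> k1)) *\<^sub>R k1)) = D1"
      using n unfolding D1_def d_def sq[symmetric] by (simp add: field_simps)
    ultimately have 1: "\<sigma> * (1/2 * (P1 + D1)\<^sup>2 + f1 t1 - \<mu>1) \<le> 0" by simp
    have "\<sigma> * cell_operator f2 P2 \<mu>2 t2 (norm k2 * (D\<phi> x \<bullet> ((1 / (k2 \<bullet> k2)) *\<^sub>R k2))) \<le> 0"
      by (rule viscosity_sided_restrict_line[OF s2 C1 touch n(2) line2])
    moreover have "norm k2 * (D\<phi> x \<bullet> ((1 / (k2 \<bullet> k2)) *\<^sub>R k2)) = D2"
      using n unfolding D2_def d_def sq[symmetric] by (simp add: field_simps)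
    ultimately have 2: "\<sigma> * (1/2 * (P2 + D2)\<^sup>2 + f2 t2 - \<mu>2) \<le> 0" by simp
    \<comment> \<open>The component of the test gradient orthogonal to both modes.\<close>
    define e where "e = d - (D1 / norm k1) *\<^sub>R k1 - (D2 / norm k2) *\<^sub>R k2"
    have dk: "d \<bullet> k1 = D1 * norm k1" "d \<bullet> k2 = D2 * norm k2" using n by (auto simp: D1_def D2_def)
    have ek: "k1 \<bullet> e = 0" "k2 \<bullet> e = 0"
      using n by (simp_all add: e_def inner_diff_right k(3) k21 inner_commute[of _ d] dk sq[symmetric])
    have line3: "1 * v (x + (s - 0) *\<^sub>R e) = 0 + v x" for s
      unfolding v_def by (simp add: inner_add_right ek)
    have "\<sigma> * (1 * (D\<phi> x \<bullet> e)) \<le> 0"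
      by (rule viscosity_sided_restrict_line[where F = "\<lambda>_ q. q", OF viscosity_sided_constant[OF \<sigma>] C1 touch zero_less_one line3]) simp
    moreover have "\<sigma> * - (1 * (D\<phi> x \<bullet> e)) \<le> 0"
      by (rule viscosity_sided_restrict_line[where F = "\<lambda>_ q. - q", OF viscosity_sided_constant[OF \<sigma>] C1 touch zero_less_one line3]) simp
    ultimately have "d \<bullet> e = 0" using \<sigma> by (auto simp: d_def)
    then have "e \<bullet> e = 0" using ek by (simp add: e_def inner_diff_left ek[unfolded e_def])
    then have "e = 0" by simp
    then have deq: "d = (D1 / norm k1) *\<^sub>R k1 + (D2 / norm k2) *\<^sub>R k2" by (simp add: e_def algebra_simps)
    have pd: "p \<bullet> d = P1 * D1 + P2 * D2" unfolding deq by (simp add: inner_add_right P1_def P2_def mult.commute)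
    have dd: "d \<bullet> d = D1\<^sup>2 + D2\<^sup>2"
    proof -
      have "d \<bullet> d = (D1 / norm k1) * (d \<bullet> k1) + (D2 / norm k2) * (d \<bullet> k2)"
        by (subst (2) deq) (simp add: inner_add_right)
      then show ?thesis using n unfolding dk by (simp add: power2_eq_square)
    qed
    have "(norm (p + d))\<^sup>2 = (norm p)\<^sup>2 + 2 * (p \<bullet> d) + d \<bullet> d"
      unfolding power2_norm_eq_inner by (simp add: inner_add_left inner_add_right inner_commute)
    then have half: "1/2 * (norm (p + d))\<^sup>2 = ((norm p)\<^sup>2 - P1\<^sup>2 - P2\<^sup>2) / 2 + 1/2 * (P1 + D1)\<^sup>2 + 1/2 * (P2 + D2)\<^sup>2"
      unfolding pd dd by (simp add: power2_sum add_divide_distrib diff_divide_distrib algebra_simps)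
    have "cell_operator V p \<mu> x d = (1/2 * (P1 + D1)\<^sup>2 + f1 t1 - \<mu>1) + (1/2 * (P2 + D2)\<^sup>2 + f2 t2 - \<mu>2)"
      using half unfolding V t1_def t2_def \<mu>_def by linarith
    then have "\<sigma> * cell_operator V p \<mu> x d
       = \<sigma> * (1/2 * (P1 + D1)\<^sup>2 + f1 t1 - \<mu>1) + \<sigma> * (1/2 * (P2 + D2)\<^sup>2 + f2 t2 - \<mu>2)"
      by (simp only: distrib_left)
    then show "\<sigma> * cell_operator V p \<mu> x (D\<phi> x) \<le> 0" using 1 2 unfolding d_def by linarith
  qed
  ultimately have "critical_level \<Lambda> V p \<mu>"
    using w1(3,4) w2(3,4) unfolding critical_level_def continuous_viscosity_solution_iff_sided by blast
  then show ?thesis by (simp only: \<mu>_def P1_def P2_def)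
qed

section \<open>The integer lattice and the effective Hamiltonian\<close>

definition integer_lattice :: "int \<Rightarrow> (real ^ 'n) set" where
  "integer_lattice N = range (\<lambda>z. of_int N *\<^sub>R of_int_vec z)"

lemma of_int_vec_inner_Ints: "of_int_vec k \<bullet> of_int_vec z \<in> \<int>"
  by (auto simp: of_int_vec_def inner_vec_def intro!: Ints_sum Ints_mult)

lemma scaled_of_int_vec: "of_int N *\<^sub>R of_int_vec z = of_int_vec (\<chi> i. N * z $ i)"
  by (simp add: of_int_vec_def vec_eq_iff)

lemma integer_lattice_subset: "z \<in> integer_lattice N \<Longrightarrow> z \<in> range of_int_vec"
  by (auto simp: integer_lattice_def scaled_of_int_vec)

lemma integer_lattice_1: "integer_lattice 1 = range of_int_vec"
  by (simp add: integer_lattice_def)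

lemma mode_integral_on_lattice: "z \<in> integer_lattice N \<Longrightarrow> of_int_vec k \<bullet> z \<in> \<int>"
  using integer_lattice_subset of_int_vec_inner_Ints by fastforce

text \<open>
  Rounding each coordinate of x down to a multiple of N leaves a remainder in the cube [0,N]^n.
\<close>

lemma cocompact_integer_lattice:
  assumes N: "0 < N"
  shows "cocompact (integer_lattice N :: (real ^ 'n) set)"
  unfolding cocompact_def
proof (intro exI allI)
  fix x :: "real ^ 'n"
  define z :: "int ^ 'n" where "z = (\<chi> i. - \<lfloor>x $ i / of_int N\<rfloor>)"
  have "norm (x + of_int N *\<^sub>R of_int_vec z) \<le> (\<Sum>i\<in>UNIV. \<bar>(x + of_int N *\<^sub>R of_int_vec z) $ i\<bar>)"
    by (rule norm_le_l1_cart)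
  also have "\<dots> \<le> (\<Sum>i\<in>(UNIV :: 'n set). of_int N)"
  proof (rule sum_mono)
    fix i
    define y where "y = x $ i / of_int N"
    have xy: "x $ i = of_int N * y" using N by (simp add: y_def)
    have "(x + of_int N *\<^sub>R of_int_vec z) $ i = of_int N * (y - of_int \<lfloor>y\<rfloor>)"
      by (simp add: z_def of_int_vec_def xy[symmetric] y_def[symmetric] right_diff_distrib)
    moreover have "0 \<le> y - of_int \<lfloor>y\<rfloor>" "y - of_int \<lfloor>y\<rfloor> \<le> 1" by linarith+
    ultimately show "\<bar>(x + of_int N *\<^sub>R of_int_vec z) $ i\<bar> \<le> of_int N"
      using N by (simp add: abs_mult mult_left_le)
  qed
  finally show "\<exists>z\<in>integer_lattice N. norm (x + z) \<le> (\<Sum>i\<in>(UNIV :: 'n set). of_int N)"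
    unfolding integer_lattice_def by blast
qed

lemma cocompact_Ints: "cocompact (\<int> :: real set)"
  unfolding cocompact_def
proof (intro exI allI)
  fix x :: real
  have "norm (x + of_int (- \<lfloor>x\<rfloor>)) \<le> 1" by (simp add: abs_le_iff) linarith
  then show "\<exists>z\<in>\<int>. norm (x + z) \<le> 1" by (meson Ints_of_int)
qed

lemma cos_lipschitz: "\<bar>cos x - cos y\<bar> \<le> \<bar>x - y\<bar>" for x y :: real
proof -
  have "norm (cos x - cos y) \<le> 1 * norm (x - y)"
    by (rule field_differentiable_bound[of UNIV cos "\<lambda>x. - sin x"])
      (auto intro!: derivative_eq_intros)
  then show ?thesis by simp
qed

lemma two_mode_lipschitz:
  fixes k1 k2 :: "'a::euclidean_space"
  shows "\<exists>M. \<forall>x y. \<bar>two_mode a A1 \<alpha>1 k1 A2 \<alpha>2 k2 x - two_mode a A1 \<alpha>1 k1 A2 \<alpha>2 k2 y\<bar> \<le> M * norm (x - y)"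
proof -
  have mode: "\<bar>2 * A * cos_mode k \<alpha> x - 2 * A * cos_mode k \<alpha> y\<bar>
      \<le> 4 * pi * \<bar>A\<bar> * norm k * norm (x - y)" for A \<alpha> and k x y :: 'a
  proof -
    have arg: "(2 * pi * (k \<bullet> x) + \<alpha>) - (2 * pi * (k \<bullet> y) + \<alpha>) = 2 * pi * (k \<bullet> (x - y))"
      by (simp add: inner_diff_right algebra_simps)
    have "\<bar>cos_mode k \<alpha> x - cos_mode k \<alpha> y\<bar> \<le> \<bar>2 * pi * (k \<bullet> (x - y))\<bar>"
      unfolding arg[symmetric] by (rule cos_lipschitz)
    also have "\<dots> = 2 * pi * \<bar>k \<bullet> (x - y)\<bar>" by (simp add: abs_mult)
    also have "\<dots> \<le> 2 * pi * (norm k * norm (x - y))"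
      using Cauchy_Schwarz_ineq2[of k "x - y"] by (intro mult_left_mono) auto
    finally have le: "2 * \<bar>A\<bar> * \<bar>cos_mode k \<alpha> x - cos_mode k \<alpha> y\<bar>
        \<le> 2 * \<bar>A\<bar> * (2 * pi * (norm k * norm (x - y)))" by (intro mult_left_mono) auto
    have "2 * A * cos_mode k \<alpha> x - 2 * A * cos_mode k \<alpha> y
        = 2 * A * (cos_mode k \<alpha> x - cos_mode k \<alpha> y)"
      by (rule right_diff_distrib[symmetric])
    then have "\<bar>2 * A * cos_mode k \<alpha> x - 2 * A * cos_mode k \<alpha> y\<bar>
        = 2 * \<bar>A\<bar> * \<bar>cos_mode k \<alpha> x - cos_mode k \<alpha> y\<bar>"
      by (simp only: abs_mult abs_numeral)
    with le show ?thesis by (simp only: mult_ac)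
  qed
  show ?thesis
  proof (intro exI allI)
    fix x y
    show "\<bar>two_mode a A1 \<alpha>1 k1 A2 \<alpha>2 k2 x - two_mode a A1 \<alpha>1 k1 A2 \<alpha>2 k2 y\<bar>
      \<le> (4 * pi * \<bar>A1\<bar> * norm k1 + 4 * pi * \<bar>A2\<bar> * norm k2) * norm (x - y)"
      using mode[of A1 k1 x \<alpha>1 y] mode[of A2 k2 x \<alpha>2 y]
      unfolding two_mode_def distrib_right by linarith
  qed
qed

lemma two_mode_periodic:
  assumes "\<And>z. z \<in> \<Lambda> \<Longrightarrow> k1 \<bullet> z \<in> \<int>" "\<And>z. z \<in> \<Lambda> \<Longrightarrow> k2 \<bullet> z \<in> \<int>"
  shows "periodic_under \<Lambda> (two_mode a A1 \<alpha>1 k1 A2 \<alpha>2 k2)"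
  unfolding periodic_under_def two_mode_def
proof (intro allI ballI)
  fix x z assume z: "z \<in> \<Lambda>"
  show "a + 2 * A1 * cos_mode k1 \<alpha>1 (x + z) + 2 * A2 * cos_mode k2 \<alpha>2 (x + z)
      = a + 2 * A1 * cos_mode k1 \<alpha>1 x + 2 * A2 * cos_mode k2 \<alpha>2 x"
    by (simp only: trig_mode_shift(2)[OF assms(1)[OF z]] trig_mode_shift(2)[OF assms(2)[OF z]])
qed

lemma cell_problem_solution_iff_critical:
  "(\<exists>v. cell_problem_solution V p \<mu> v) \<longleftrightarrow> critical_level (integer_lattice 1) V p \<mu>"
proof -
  have eq: "Zn_periodic v \<longleftrightarrow> periodic_under (integer_lattice 1) v" for v :: "real ^ 'n \<Rightarrow> real"
    unfolding Zn_periodic_def periodic_under_def integer_lattice_1 by blast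
  show ?thesis by (simp only: cell_problem_solution_def critical_level_def eq)
qed

lemma critical_level_sublattice:
  fixes V :: "'a::euclidean_space \<Rightarrow> real"
  assumes "critical_level \<Lambda> V p \<mu>" "\<Lambda>' \<subseteq> \<Lambda>"
  shows "critical_level \<Lambda>' V p \<mu>"
proof -
  have "periodic_under \<Lambda> v \<Longrightarrow> periodic_under \<Lambda>' v" for v :: "'a \<Rightarrow> real"
    using assms(2) by (auto simp: periodic_under_def)
  then show ?thesis using assms(1) unfolding critical_level_def by blast
qed

text \<open>
  Each of the two levels dominates the other by comparison.
\<close>

lemma critical_level_unique:
  fixes V :: "'a::euclidean_space \<Rightarrow> real"
  assumes "cocompact \<Lambda>" "\<And>x y. \<bar>V x - V y\<bar> \<le> M * norm (x - y)"
    "critical_level \<Lambda> V p \<mu>" "critical_level \<Lambda> V p \<nu>"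
  shows "\<mu> = \<nu>"
proof (rule order_antisym)
  have le: "\<nu> \<le> \<mu>" if crit: "critical_level \<Lambda> V p \<mu>" "critical_level \<Lambda> V p \<nu>" for \<mu> \<nu>
  proof -
    obtain u where u: "periodic_under \<Lambda> u" "continuous_on UNIV u"
        "viscosity_subsolution (cell_operator V p \<mu>) u"
      using crit(1) unfolding critical_level_def continuous_viscosity_solution_def by blast
    obtain v where v: "periodic_under \<Lambda> v" "continuous_on UNIV v"
        "viscosity_supersolution (cell_operator V p \<nu>) v"
      using crit(2) unfolding critical_level_def continuous_viscosity_solution_def by blast
    show ?thesis by (rule cell_levels_compare[OF assms(1) u(1,2) v(1,2) assms(2) u(3) v(3)])
  qed
  show "\<mu> \<le> \<nu>" "\<nu> \<le> \<mu>" using le assms(3,4) by blast+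
qed

text \<open>
  Existence and uniqueness together make the definite description in the definition meaningful.
\<close>

lemma effective_Hamiltonian_critical:
  fixes V :: "real ^ 'n \<Rightarrow> real"
  assumes per: "periodic_under (integer_lattice 1) V" and lip: "\<And>x y. \<bar>V x - V y\<bar> \<le> M * norm (x - y)"
  shows "critical_level (integer_lattice 1) V p (effective_Hamiltonian V p)"
proof -
  note co = cocompact_integer_lattice[of 1, OF zero_less_one]
  have "\<exists>\<mu>. critical_level (integer_lattice 1) V p \<mu>"
    using cell_problem_solvable[OF co per lip, of p] unfolding critical_level_def .
  then have "\<exists>!\<mu>. critical_level (integer_lattice 1) V p \<mu>"
    using critical_level_unique[OF co lip] by blast
  then show ?thesis unfolding effective_Hamiltonian_def cell_problem_solution_iff_critical by (rule theI')
qed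

text \<open>
  A solution that is periodic only on a coarser lattice NZ^n still detects the effective
  Hamiltonian, as Z^n-periodic solutions compete on that lattice too.
\<close>

lemma effective_Hamiltonian_eqI:
  fixes V :: "real ^ 'n \<Rightarrow> real"
  assumes per: "periodic_under (integer_lattice 1) V" and lip: "\<And>x y. \<bar>V x - V y\<bar> \<le> M * norm (x - y)"
    and N: "0 < N" and \<mu>: "critical_level (integer_lattice N) V p \<mu>"
  shows "effective_Hamiltonian V p = \<mu>"
proof -
  have "integer_lattice N \<subseteq> integer_lattice 1"
    using integer_lattice_subset unfolding integer_lattice_1 by blast
  with effective_Hamiltonian_critical[OF per lip, of p]
  have "critical_level (integer_lattice N) V p (effective_Hamiltonian V p)"
    by (rule critical_level_sublattice)
  then show ?thesis using critical_level_unique[OF cocompact_integer_lattice[OF N] lip] \<mu> by blast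
qed

lemma trig_mode_polar:
  "Re (z * exp (\<i> * of_real t) + cnj z * exp (- \<i> * of_real t)) = 2 * cmod z * cos (t + Arg z)"
proof -
  have "cnj z * exp (- \<i> * of_real t) = cnj (z * exp (\<i> * of_real t))"
    by (simp add: exp_cnj)
  moreover have "z * exp (\<i> * of_real t) = rcis (cmod z) (t + Arg z)"
  proof -
    have "z * exp (\<i> * of_real t) = rcis (cmod z) (Arg z) * cis t"
      by (simp add: rcis_cmod_Arg cis_conv_exp)
    then show ?thesis by (simp add: rcis_def cis_mult mult.assoc add.commute)
  qed
  ultimately show ?thesis by (simp add: rcis_def)
qed

lemma trig_potential_polar:
  "trig_potential m a lam k x =
     a + (\<Sum>j=1..m. 2 * cmod (lam j) * cos (2 * pi * (of_int_vec (k j) \<bullet> x) + Arg (lam j)))"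
proof -
  have "Re (of_real a + S) = a + Re S" for S by simp
  then show ?thesis unfolding trig_potential_def by (simp only: Re_sum trig_mode_polar)
qed

lemma trig_potential_two_mode:
  "trig_potential 2 a lam k = two_mode a (cmod (lam 1)) (Arg (lam 1)) (of_int_vec (k 1))
     (cmod (lam 2)) (Arg (lam 2)) (of_int_vec (k 2))"
proof
  fix x
  have "{1..2::nat} = {1, 2}" by auto
  then show "trig_potential 2 a lam k x = two_mode a (cmod (lam 1)) (Arg (lam 1)) (of_int_vec (k 1))
     (cmod (lam 2)) (Arg (lam 2)) (of_int_vec (k 2)) x"
    unfolding trig_potential_polar two_mode_def by simp
qed

text \<open>
  A single mode is presented as two, the second with amplitude 0. Its wave vector w stays free so
  that it can be chosen nonresonant: for w = 2k the vectors k, w and k \<plusminus> w are nonzero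
  multiples of one vector.
\<close>

lemma trig_potential_one_mode:
  "trig_potential 1 a lam k = two_mode a (cmod (lam 1)) (Arg (lam 1)) (of_int_vec (k 1)) 0 0 w"
  unfolding fun_eq_iff trig_potential_polar two_mode_def by simp

section \<open>Recovering directions and amplitudes\<close>

lemma parallel_sym: "parallel u w \<Longrightarrow> parallel w u"
  unfolding parallel_def by (metis add.commute)

lemma parallel_scaleR: "parallel (r *\<^sub>R w) w"
  unfolding parallel_def by (rule exI[of _ 1], rule exI[of _ "- r"]) simp

lemma parallel_nonzeroE:
  fixes u w :: "'a::real_vector"
  assumes "parallel u w" "u \<noteq> 0" "w \<noteq> 0"
  obtains r where "r \<noteq> 0" "u = r *\<^sub>R w"
proof -
  obtain a b where ab: "a \<noteq> 0 \<or> b \<noteq> 0" "a *\<^sub>R u + b *\<^sub>R w = 0"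
    using assms(1) by (auto simp: parallel_def)
  have a: "a \<noteq> 0" using ab assms(3) by auto
  have "a *\<^sub>R u = - b *\<^sub>R w" using ab(2) by (simp add: add_eq_0_iff2)
  then have "(1 / a) *\<^sub>R (a *\<^sub>R u) = (1 / a) *\<^sub>R (- b *\<^sub>R w)" by simp
  then have u: "u = (- b / a) *\<^sub>R w" using a by simp
  then have "- b / a \<noteq> 0" using assms(2) by auto
  then show ?thesis using that u by blast
qed

lemma parallel_trans:
  fixes u w x :: "'a::real_vector"
  assumes "parallel u w" "parallel w x" "u \<noteq> 0" "w \<noteq> 0" "x \<noteq> 0"
  shows "parallel u x"
proof -
  obtain r where r: "u = r *\<^sub>R w" using parallel_nonzeroE[OF assms(1,3,4)] by metis
  obtain s where s: "w = s *\<^sub>R x" using parallel_nonzeroE[OF assms(2,4,5)] by metis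
  have "u = (r * s) *\<^sub>R x" using r s by simp
  then show ?thesis using parallel_scaleR by metis
qed

text \<open>
  The Gram determinant of two linearly independent vectors is nonzero, so the system can be solved
  in their span.
\<close>

lemma not_parallel_solve:
  fixes u w :: "'a::real_inner"
  assumes "\<not> parallel u w"
  shows "\<exists>y. u \<bullet> y = \<alpha> \<and> w \<bullet> y = \<beta>"
proof -
  define D where "D = (u \<bullet> u) * (w \<bullet> w) - (u \<bullet> w)\<^sup>2"
  have w: "w \<noteq> 0"
    using assms unfolding parallel_def by (metis add_0 scaleR_zero_left scaleR_zero_right zero_neq_one)
  define r where "r = (w \<bullet> w) *\<^sub>R u - (u \<bullet> w) *\<^sub>R w"
  have "r \<noteq> 0"
  proof
    assume "r = 0"
    then have "(w \<bullet> w) *\<^sub>R u + (- (u \<bullet> w)) *\<^sub>R w = 0" by (simp add: r_def)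
    then show False using assms w unfolding parallel_def by (metis inner_eq_zero_iff)
  qed
  moreover have "r \<bullet> r = (w \<bullet> w) * D"
    by (simp add: r_def D_def inner_diff_left inner_diff_right inner_commute power2_eq_square algebra_simps)
  ultimately have D: "D \<noteq> 0" by auto
  define y where "y = ((\<alpha> * (w \<bullet> w) - \<beta> * (u \<bullet> w)) / D) *\<^sub>R u + ((\<beta> * (u \<bullet> u) - \<alpha> * (u \<bullet> w)) / D) *\<^sub>R w"
  have "D * (u \<bullet> y) = D * \<alpha>" "D * (w \<bullet> y) = D * \<beta>"
    using D by (simp_all add: y_def inner_add_right inner_commute[of w u] distrib_left)
      (simp_all add: D_def power2_eq_square algebra_simps)
  then show ?thesis using D by (intro exI[of _ y]) simp
qed

text \<open>
  The hyperplane orthogonal to e is not covered by finitely many others. In the induction step a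
  vector that fails for the new s is moved along a direction u orthogonal to e with u \<bullet> s
  \<noteq> 0; only finitely many step lengths are forbidden.
\<close>

lemma generic_perpendicular_vector:
  fixes e :: "'a::real_inner"
  assumes "finite F"
  shows "\<exists>q. q \<bullet> e = 0 \<and> (\<forall>s\<in>F. \<not> parallel s e \<longrightarrow> q \<bullet> s \<noteq> 0)"
  using assms
proof induction
  case empty
  show ?case by (intro exI[of _ 0]) simp
next
  case (insert s F)
  then obtain q where q: "q \<bullet> e = 0" "\<And>s. s \<in> F \<Longrightarrow> \<not> parallel s e \<Longrightarrow> q \<bullet> s \<noteq> 0" by blast
  show ?case
  proof (cases "parallel s e")
    case True
    then show ?thesis using q by blast
  next
    case False
    obtain u where u: "s \<bullet> u = 1" "e \<bullet> u = 0" using not_parallel_solve[OF False] by blast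
    have "finite ((\<lambda>s. - (q \<bullet> s) / (u \<bullet> s)) ` insert s F)" using insert by simp
    then obtain \<epsilon> where \<epsilon>: "\<epsilon> \<notin> (\<lambda>s. - (q \<bullet> s) / (u \<bullet> s)) ` insert s F"
      using ex_new_if_finite[OF infinite_UNIV_char_0] by blast
    have "(q + \<epsilon> *\<^sub>R u) \<bullet> s' \<noteq> 0" if s': "s' \<in> insert s F" "\<not> parallel s' e" for s'
    proof (cases "u \<bullet> s' = 0")
      case True
      then have "s' \<in> F" using s'(1) u(1) by (auto simp: inner_commute)
      then show ?thesis using True q(2) s'(2) by (simp add: inner_add_left)
    next
      case False
      have "\<epsilon> \<noteq> - (q \<bullet> s') / (u \<bullet> s')" using \<epsilon> s'(1) by blast
      then show ?thesis using False by (auto simp: inner_add_left field_simps add_eq_0_iff)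
    qed
    moreover have "(q + \<epsilon> *\<^sub>R u) \<bullet> e = 0" using q(1) u(2) by (simp add: inner_add_left inner_commute[of u])
    ultimately show ?thesis by blast
  qed
qed

lemma eventually_nonresonant:
  fixes e :: "'a::real_inner"
  assumes "e \<noteq> 0" "k \<noteq> 0" "q \<bullet> e = 0" "\<not> parallel k e \<Longrightarrow> q \<bullet> k \<noteq> 0"
  shows "\<forall>\<^sub>F \<epsilon> in at_right 0. (q + \<epsilon> *\<^sub>R e) \<bullet> k \<noteq> 0"
proof (cases "parallel k e")
  case True
  then obtain r where r: "r \<noteq> 0" "k = r *\<^sub>R e" using assms by (elim parallel_nonzeroE)
  have "\<forall>\<^sub>F \<epsilon> in at_right 0. (\<epsilon>::real) > 0" by (rule eventually_at_right_less)
  then show ?thesis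
    by eventually_elim (use r assms in \<open>simp add: inner_add_left\<close>)
next
  case False
  have "((\<lambda>\<epsilon>. (q + \<epsilon> *\<^sub>R e) \<bullet> k) \<longlongrightarrow> (q + 0 *\<^sub>R e) \<bullet> k) (at_right 0)"
    by (intro tendsto_intros)
  then show ?thesis using assms(4)[OF False] by (intro tendsto_imp_eventually_ne) auto
qed

text \<open>
  What one mode contributes to the double pole of the second order coefficient c(q) along the
  hyperplane orthogonal to e.
\<close>

definition mode_weight :: "real \<Rightarrow> 'a::real_vector \<Rightarrow> 'a \<Rightarrow> real" where
  "mode_weight A k e = (if parallel k e then A\<^sup>2 else 0)"

text \<open>
  A mode parallel to e has q \<bullet> k proportional to \<epsilon> on the ray q + \<epsilon> e,
  which gives the double pole; the other modes stay bounded there. The length of k cancels there,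
  and the factor |e|^2 compensates for the length of e.
\<close>

lemma mode_weight_limit:
  fixes e :: "'a::real_inner"
  assumes "e \<noteq> 0" "k \<noteq> 0" "q \<bullet> e = 0" "\<not> parallel k e \<Longrightarrow> q \<bullet> k \<noteq> 0"
  shows "((\<lambda>\<epsilon>. \<epsilon>\<^sup>2 * (norm e)\<^sup>2 * (A\<^sup>2 * (norm k)\<^sup>2 / ((q + \<epsilon> *\<^sub>R e) \<bullet> k)\<^sup>2)) \<longlongrightarrow> mode_weight A k e) (at_right 0)"
proof (cases "parallel k e")
  case True
  then obtain r where r: "r \<noteq> 0" "k = r *\<^sub>R e" using assms by (elim parallel_nonzeroE)
  have "\<forall>\<^sub>F \<epsilon> in at_right 0. (\<epsilon>::real) > 0" by (rule eventually_at_right_less)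
  then have "\<forall>\<^sub>F \<epsilon> in at_right 0. A\<^sup>2 = \<epsilon>\<^sup>2 * (norm e)\<^sup>2 * (A\<^sup>2 * (norm k)\<^sup>2 / ((q + \<epsilon> *\<^sub>R e) \<bullet> k)\<^sup>2)"
  proof eventually_elim
    case (elim \<epsilon>)
    have "(q + \<epsilon> *\<^sub>R e) \<bullet> k = \<epsilon> * r * (norm e)\<^sup>2"
      using assms(3) by (simp add: r(2) inner_add_left dot_square_norm)
    moreover have "(norm k)\<^sup>2 = r\<^sup>2 * (norm e)\<^sup>2" by (simp add: r(2) power_mult_distrib)
    ultimately show ?case using elim r(1) assms(1) by (simp add: field_simps power2_eq_square)
  qed
  then have "((\<lambda>\<epsilon>. \<epsilon>\<^sup>2 * (norm e)\<^sup>2 * (A\<^sup>2 * (norm k)\<^sup>2 / ((q + \<epsilon> *\<^sub>R e) \<bullet> k)\<^sup>2)) \<longlongrightarrow> A\<^sup>2) (at_right 0)"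
    by (rule tendsto_eventually[OF eventually_mono]) simp
  then show ?thesis using True by (simp add: mode_weight_def)
next
  case False
  have "((\<lambda>\<epsilon>. \<epsilon>\<^sup>2 * (norm e)\<^sup>2 * (A\<^sup>2 * (norm k)\<^sup>2 / ((q + \<epsilon> *\<^sub>R e) \<bullet> k)\<^sup>2))
     \<longlongrightarrow> 0\<^sup>2 * (norm e)\<^sup>2 * (A\<^sup>2 * (norm k)\<^sup>2 / ((q + 0 *\<^sub>R e) \<bullet> k)\<^sup>2)) (at_right 0)"
    using assms(4)[OF False] by (intro tendsto_intros) auto
  then show ?thesis using False by (simp add: mode_weight_def)
qed

lemma small_imp_zero:
  fixes e :: real
  assumes "\<And>t. 1 \<le> t \<Longrightarrow> \<bar>e\<bar> \<le> B / t\<^sup>2"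
  shows "e = 0"
proof -
  have "((\<lambda>t. B / t\<^sup>2) \<longlongrightarrow> 0) at_top"
    by (intro tendsto_divide_0[OF tendsto_const] filterlim_at_top_imp_at_infinity filterlim_pow_at_top filterlim_ident) simp
  moreover have "\<forall>\<^sub>F t in at_top. \<bar>e\<bar> \<le> B / t\<^sup>2"
    using eventually_ge_at_top[of 1] by eventually_elim (rule assms)
  ultimately have "\<bar>e\<bar> \<le> 0" by (rule tendsto_lowerbound) simp
  then show ?thesis by simp
qed

lemma expansion_coefficients_unique:
  fixes h X :: "real \<Rightarrow> real"
  assumes 1: "\<And>t. 1 \<le> t \<Longrightarrow> \<bar>h t - (X t + a + c / t\<^sup>2)\<bar> \<le> C / t ^ 4"
    and 2: "\<And>t. 1 \<le> t \<Longrightarrow> \<bar>h t - (X t + a' + c' / t\<^sup>2)\<bar> \<le> C' / t ^ 4"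
  shows "a = a'" "c = c'"
proof -
  have est: "\<bar>(a - a') + (c - c') / t\<^sup>2\<bar> \<le> (\<bar>C\<bar> + \<bar>C'\<bar>) / t ^ 4" if "1 \<le> t" for t
  proof -
    have "C / t ^ 4 + C' / t ^ 4 \<le> (\<bar>C\<bar> + \<bar>C'\<bar>) / t ^ 4"
      unfolding add_divide_distrib[symmetric] using that by (intro divide_right_mono) auto
    then show ?thesis using 1[OF that] 2[OF that] unfolding diff_divide_distrib by linarith
  qed
  have t4: "x / t ^ 4 \<le> x / t\<^sup>2" "x / t ^ 4 = x / t\<^sup>2 / t\<^sup>2" if "1 \<le> t" "0 \<le> x" for t x :: real
  proof -
    have "t ^ 2 \<le> t ^ 4" using that by (intro power_increasing) auto
    moreover have "0 < t ^ 2" using that by simp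
    ultimately show "x / t ^ 4 \<le> x / t\<^sup>2" using that by (intro divide_left_mono) auto
    show "x / t ^ 4 = x / t\<^sup>2 / t\<^sup>2" by (simp flip: power_add)
  qed
  have "a - a' = 0"
  proof (rule small_imp_zero)
    fix t :: real assume t: "1 \<le> t"
    have "\<bar>(c - c') / t\<^sup>2\<bar> = \<bar>c - c'\<bar> / t\<^sup>2" by simp
    moreover have "(\<bar>C\<bar> + \<bar>C'\<bar>) / t ^ 4 \<le> (\<bar>C\<bar> + \<bar>C'\<bar>) / t\<^sup>2" using t by (intro t4) auto
    ultimately have "\<bar>a - a'\<bar> \<le> \<bar>c - c'\<bar> / t\<^sup>2 + (\<bar>C\<bar> + \<bar>C'\<bar>) / t\<^sup>2" using est[OF t] by linarith
    then show "\<bar>a - a'\<bar> \<le> (\<bar>c - c'\<bar> + (\<bar>C\<bar> + \<bar>C'\<bar>)) / t\<^sup>2" by (simp add: add_divide_distrib)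
  qed
  then show "a = a'" by simp
  have "c - c' = 0"
  proof (rule small_imp_zero)
    fix t :: real assume t: "1 \<le> t"
    have t2: "0 < t\<^sup>2" using t by simp
    have "(\<bar>C\<bar> + \<bar>C'\<bar>) / t ^ 4 = (\<bar>C\<bar> + \<bar>C'\<bar>) / t\<^sup>2 / t\<^sup>2" using t by (intro t4) auto
    moreover have "\<bar>(a - a') + (c - c') / t\<^sup>2\<bar> = \<bar>c - c'\<bar> / t\<^sup>2" using \<open>a = a'\<close> by simp
    ultimately have "\<bar>c - c'\<bar> / t\<^sup>2 \<le> (\<bar>C\<bar> + \<bar>C'\<bar>) / t\<^sup>2 / t\<^sup>2" using est[OF t] by linarith
    then show "\<bar>c - c'\<bar> \<le> (\<bar>C\<bar> + \<bar>C'\<bar>) / t\<^sup>2"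
      using divide_strict_right_mono[OF _ t2, of "(\<bar>C\<bar> + \<bar>C'\<bar>) / t\<^sup>2" "\<bar>c - c'\<bar>"] by linarith
  qed
  then show "c = c'" by simp
qed

text \<open>
  The second order coefficients of the two expansions agree wherever both potentials are
  nonresonant, in particular for all small \<epsilon> > 0 on a ray q + \<epsilon> e that starts at
  a generic point q of the hyperplane orthogonal to e. Multiplication by \<epsilon>^2|e|^2 and
  \<epsilon> \<rightarrow> 0 extract the pole.
\<close>

lemma equal_levels_imp_equal_weights:
  fixes k1 k2 k1' k2' :: "'a::euclidean_space"
  assumes \<Lambda>: "cocompact \<Lambda>"
    and H: "\<And>p. critical_level \<Lambda> (two_mode a A1 \<alpha>1 k1 A2 \<alpha>2 k2) p (H p)"
    and H': "\<And>p. critical_level \<Lambda> (two_mode a' A1' \<alpha>1' k1' A2' \<alpha>2' k2') p (H p)"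
    and int: "\<And>z. z \<in> \<Lambda> \<Longrightarrow> k1 \<bullet> z \<in> \<int>" "\<And>z. z \<in> \<Lambda> \<Longrightarrow> k2 \<bullet> z \<in> \<int>"
    and int': "\<And>z. z \<in> \<Lambda> \<Longrightarrow> k1' \<bullet> z \<in> \<int>" "\<And>z. z \<in> \<Lambda> \<Longrightarrow> k2' \<bullet> z \<in> \<int>"
    and k: "k1 \<noteq> 0" "k2 \<noteq> 0" "k1 + k2 \<noteq> 0" "k1 - k2 \<noteq> 0"
    and k': "k1' \<noteq> 0" "k2' \<noteq> 0" "k1' + k2' \<noteq> 0" "k1' - k2' \<noteq> 0"
    and e: "e \<noteq> 0"
  shows "a = a'"
    and "mode_weight A1 k1 e + mode_weight A2 k2 e = mode_weight A1' k1' e + mode_weight A2' k2' e"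
proof -
  define F where "F = {k1, k2, k1 + k2, k1 - k2, k1', k2', k1' + k2', k1' - k2'}"
  have "finite F" by (simp add: F_def)
  from generic_perpendicular_vector[OF this, of e]
  obtain q where q: "q \<bullet> e = 0" "\<And>s. s \<in> F \<Longrightarrow> \<not> parallel s e \<Longrightarrow> q \<bullet> s \<noteq> 0" by blast
  let ?c = "\<lambda>q. A1\<^sup>2 * (norm k1)\<^sup>2 / (q \<bullet> k1)\<^sup>2 + A2\<^sup>2 * (norm k2)\<^sup>2 / (q \<bullet> k2)\<^sup>2"
  let ?c' = "\<lambda>q. A1'\<^sup>2 * (norm k1')\<^sup>2 / (q \<bullet> k1')\<^sup>2 + A2'\<^sup>2 * (norm k2')\<^sup>2 / (q \<bullet> k2')\<^sup>2"
  have id: "a = a' \<and> ?c q = ?c' q" if nr: "\<And>s. s \<in> F \<Longrightarrow> q \<bullet> s \<noteq> 0" for q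
  proof -
    have nz: "q \<bullet> k1 \<noteq> 0" "q \<bullet> k2 \<noteq> 0" "q \<bullet> (k1 + k2) \<noteq> 0" "q \<bullet> (k1 - k2) \<noteq> 0"
      "q \<bullet> k1' \<noteq> 0" "q \<bullet> k2' \<noteq> 0" "q \<bullet> (k1' + k2') \<noteq> 0" "q \<bullet> (k1' - k2') \<noteq> 0"
      by (rule nr, simp add: F_def)+
    have "\<exists>C. \<forall>t\<ge>1. \<bar>H (t *\<^sub>R q) - (t\<^sup>2 * (norm q)\<^sup>2 / 2 + a + ?c q / t\<^sup>2)\<bar> \<le> C / t ^ 4"
      by (rule nonresonant_expansion[OF \<Lambda> H int nz(1-4)])
    then obtain C where C: "\<And>t. 1 \<le> t \<Longrightarrow>
        \<bar>H (t *\<^sub>R q) - (t\<^sup>2 * (norm q)\<^sup>2 / 2 + a + ?c q / t\<^sup>2)\<bar> \<le> C / t ^ 4"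
      by blast
    have "\<exists>C. \<forall>t\<ge>1. \<bar>H (t *\<^sub>R q) - (t\<^sup>2 * (norm q)\<^sup>2 / 2 + a' + ?c' q / t\<^sup>2)\<bar> \<le> C / t ^ 4"
      by (rule nonresonant_expansion[OF \<Lambda> H' int' nz(5-8)])
    then obtain C' where C': "\<And>t. 1 \<le> t \<Longrightarrow>
        \<bar>H (t *\<^sub>R q) - (t\<^sup>2 * (norm q)\<^sup>2 / 2 + a' + ?c' q / t\<^sup>2)\<bar> \<le> C' / t ^ 4"
      by blast
    show ?thesis
      by (intro conjI expansion_coefficients_unique[where h = "\<lambda>t. H (t *\<^sub>R q)" and X = "\<lambda>t. t\<^sup>2 * (norm q)\<^sup>2 / 2", OF C C'])
  qed
  have "\<forall>\<^sub>F \<epsilon> in at_right 0. \<forall>s\<in>F. (q + \<epsilon> *\<^sub>R e) \<bullet> s \<noteq> 0"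
  proof (rule eventually_ball_finite[OF \<open>finite F\<close>], rule ballI)
    fix s assume s: "s \<in> F"
    then have "s \<noteq> 0" using k k' by (auto simp: F_def)
    then show "\<forall>\<^sub>F \<epsilon> in at_right 0. (q + \<epsilon> *\<^sub>R e) \<bullet> s \<noteq> 0"
      using eventually_nonresonant[OF e _ q(1) q(2)[OF s]] by blast
  qed
  then have ev: "\<forall>\<^sub>F \<epsilon> in at_right 0. a = a' \<and> ?c (q + \<epsilon> *\<^sub>R e) = ?c' (q + \<epsilon> *\<^sub>R e)"
    by eventually_elim (intro id, blast)
  then show "a = a'" using eventually_happens[OF ev] by (auto simp: trivial_limit_at_right_real)
  have inF: "k1 \<in> F" "k2 \<in> F" "k1' \<in> F" "k2' \<in> F" by (auto simp: F_def)
  note lim = mode_weight_limit[OF e _ q(1) q(2)]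
  have l: "((\<lambda>\<epsilon>. \<epsilon>\<^sup>2 * (norm e)\<^sup>2 * ?c (q + \<epsilon> *\<^sub>R e)) \<longlongrightarrow> mode_weight A1 k1 e + mode_weight A2 k2 e) (at_right 0)"
    unfolding distrib_left by (intro tendsto_add lim k inF)
  have l': "((\<lambda>\<epsilon>. \<epsilon>\<^sup>2 * (norm e)\<^sup>2 * ?c' (q + \<epsilon> *\<^sub>R e)) \<longlongrightarrow> mode_weight A1' k1' e + mode_weight A2' k2' e) (at_right 0)"
    unfolding distrib_left by (intro tendsto_add lim k' inF)
  have "((\<lambda>\<epsilon>. \<epsilon>\<^sup>2 * (norm e)\<^sup>2 * ?c' (q + \<epsilon> *\<^sub>R e)) \<longlongrightarrow> mode_weight A1 k1 e + mode_weight A2 k2 e) (at_right 0)"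
    using l by (rule Lim_transform_eventually) (use ev in \<open>eventually_elim, simp\<close>)
  then show "mode_weight A1 k1 e + mode_weight A2 k2 e = mode_weight A1' k1' e + mode_weight A2' k2' e"
    using l' by (rule tendsto_unique[rotated]) simp
qed

section \<open>Dilations of two modes\<close>

lemma two_mode_swap: "two_mode a A1 \<alpha>1 k1 A2 \<alpha>2 k2 = two_mode a A2 \<alpha>2 k2 A1 \<alpha>1 k1"
  by (simp add: two_mode_def fun_eq_iff)

lemma cos_mode_flip:
  "s \<in> {1, -1} \<Longrightarrow> cos (2 * pi * ((s *\<^sub>R k) \<bullet> x) + s * \<alpha>) = cos_mode k \<alpha> x"
  using cos_minus[of "2 * pi * (k \<bullet> x) + \<alpha>"] by auto

text \<open>
  Since V is real, k and -k describe the same mode. This freedom is used to make dilation factors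
  positive and the angle between the modes obtuse.
\<close>

lemma two_mode_flip:
  assumes "s1 \<in> {1, -1}" "s2 \<in> {1, -1}"
  shows "two_mode a A1 (s1 * \<alpha>1) (s1 *\<^sub>R k1) A2 (s2 * \<alpha>2) (s2 *\<^sub>R k2) = two_mode a A1 \<alpha>1 k1 A2 \<alpha>2 k2"
  unfolding two_mode_def cos_mode_flip[OF assms(1)] cos_mode_flip[OF assms(2)] ..

lemma cos_mode_reflect:
  assumes "k \<bullet> y = - \<alpha> / pi"
  shows "cos_mode k \<alpha> (y - x) = cos_mode k \<alpha> x"
proof -
  have "2 * pi * (k \<bullet> (y - x)) + \<alpha> = - (2 * pi * (k \<bullet> x) + \<alpha>)"
    using assms by (simp add: inner_diff_right algebra_simps)
  then show ?thesis by (simp only: cos_minus)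
qed

lemma single_solve:
  fixes k :: "'a::real_inner"
  assumes "k \<noteq> 0" shows "\<exists>y. k \<bullet> y = \<alpha>"
  by (rule exI[of _ "(\<alpha> / (k \<bullet> k)) *\<^sub>R k"]) (use assms in simp)

text \<open>
  Each mode is even about a point where its phase vanishes; two independent phases vanish
  simultaneously at some point.
\<close>

lemma two_mode_reflect:
  fixes k1 k2 :: "'a::real_inner"
  assumes "\<not> parallel k1 k2"
  shows "\<exists>y. \<forall>x. two_mode a A1 \<alpha>1 k1 A2 \<alpha>2 k2 (y - x) = two_mode a A1 \<alpha>1 k1 A2 \<alpha>2 k2 x"
proof -
  obtain y where y: "k1 \<bullet> y = - \<alpha>1 / pi" "k2 \<bullet> y = - \<alpha>2 / pi"
    using not_parallel_solve[OF assms] by blast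
  show ?thesis unfolding two_mode_def
    by (intro exI[of _ y] allI) (simp only: cos_mode_reflect[OF y(1)] cos_mode_reflect[OF y(2)])
qed

lemma one_mode_reflect:
  fixes k1 k2 :: "'a::real_inner"
  assumes "k1 \<noteq> 0"
  shows "\<exists>y. \<forall>x. two_mode a A1 \<alpha>1 k1 0 \<alpha>2 k2 (y - x) = two_mode a A1 \<alpha>1 k1 0 \<alpha>2 k2 x"
proof -
  obtain y where y: "k1 \<bullet> y = - \<alpha>1 / pi" using single_solve[OF assms] by blast
  show ?thesis unfolding two_mode_def
    by (intro exI[of _ y] allI) (simp only: cos_mode_reflect[OF y] mult_zero_right mult_zero_left)
qed

text \<open>
  For c = N/D the dilated solution is periodic on NZ^n, because z \<in> NZ^n implies z/c \<in>
  DZ^n.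
\<close>

lemma effective_Hamiltonian_rescale_pos:
  fixes V1 V2 :: "real ^ 'n \<Rightarrow> real"
  assumes V1: "periodic_under (integer_lattice 1) V1" "\<And>x y. \<bar>V1 x - V1 y\<bar> \<le> M1 * norm (x - y)"
    and V2: "periodic_under (integer_lattice 1) V2" "\<And>x y. \<bar>V2 x - V2 y\<bar> \<le> M2 * norm (x - y)"
    and c: "c \<in> \<rat>" "0 < c" and eq: "\<And>x. V1 x = V2 (x /\<^sub>R c + x0)"
  shows "effective_Hamiltonian V1 = effective_Hamiltonian V2"
proof
  fix p
  obtain N D :: int where ND: "0 < D" "c = of_int N / of_int D"
    using c(1) by (metis Rats_cases' of_int_0_less_iff)
  then have N: "0 < N" using c(2) by (simp add: zero_less_divide_iff)
  have "critical_level (integer_lattice N) V1 p (effective_Hamiltonian V2 p)"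
  proof (rule critical_level_rescale[OF effective_Hamiltonian_critical[OF V2] c(2) eq])
    fix z :: "real ^ 'n" assume "z \<in> integer_lattice N"
    then obtain w where "z = of_int N *\<^sub>R of_int_vec w" by (auto simp: integer_lattice_def)
    then have "z /\<^sub>R c = of_int D *\<^sub>R of_int_vec w" using N ND by simp
    then show "z /\<^sub>R c \<in> integer_lattice 1"
      by (simp add: integer_lattice_1 scaled_of_int_vec)
  qed
  then show "effective_Hamiltonian V1 p = effective_Hamiltonian V2 p"
    by (rule effective_Hamiltonian_eqI[OF V1 N])
qed

lemma effective_Hamiltonian_rescale:
  fixes V1 V2 :: "real ^ 'n \<Rightarrow> real"
  assumes V1: "periodic_under (integer_lattice 1) V1" "\<And>x y. \<bar>V1 x - V1 y\<bar> \<le> M1 * norm (x - y)"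
    and V2: "periodic_under (integer_lattice 1) V2" "\<And>x y. \<bar>V2 x - V2 y\<bar> \<le> M2 * norm (x - y)"
    and c: "c \<in> \<rat> - {0}" and eq: "\<And>x. V1 x = V2 (x /\<^sub>R c + x0)"
    and reflect: "\<And>x. V2 (y - x) = V2 x"
  shows "effective_Hamiltonian V1 = effective_Hamiltonian V2"
proof (cases "0 < c")
  case True
  then show ?thesis using effective_Hamiltonian_rescale_pos[OF V1 V2 _ True eq] c by blast
next
  case False
  \<comment> \<open>By evenness V2(x/c + x0) = V2(y - x/c - x0), a dilation by -c > 0.\<close>
  have eq': "V1 x = V2 (x /\<^sub>R (- c) + (y - x0))" for x
    using eq[of x] reflect[of "x /\<^sub>R c + x0"] by (simp add: algebra_simps)
  show ?thesis by (rule effective_Hamiltonian_rescale_pos[OF V1 V2 _ _ eq']) (use c False in auto)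
qed

text \<open>
  At q with q \<bullet> k1 = 1 and q \<bullet> k2 = -1 the first potential is resonant. The second
  one has q \<bullet> (r1k1) = r1 and q \<bullet> (r2k2) = -r2, so for r1 \<noteq> r2 it is
  nonresonant with the same coefficient of t^(-2) that the first would have without its resonance.
\<close>

lemma equal_levels_imp_equal_dilations_obtuse:
  fixes k1 k2 :: "'a::euclidean_space"
  assumes \<Lambda>: "cocompact \<Lambda>"
    and H: "\<And>p. critical_level \<Lambda> (two_mode a A1 \<alpha>1 k1 A2 \<alpha>2 k2) p (H p)"
    and H': "\<And>p. critical_level \<Lambda> (two_mode a A1 \<beta>1 (r1 *\<^sub>R k1) A2 \<beta>2 (r2 *\<^sub>R k2)) p (H p)"
    and int: "\<And>z. z \<in> \<Lambda> \<Longrightarrow> k1 \<bullet> z \<in> \<int>" "\<And>z. z \<in> \<Lambda> \<Longrightarrow> k2 \<bullet> z \<in> \<int>"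
    and int': "\<And>z. z \<in> \<Lambda> \<Longrightarrow> r1 *\<^sub>R k1 \<bullet> z \<in> \<int>" "\<And>z. z \<in> \<Lambda> \<Longrightarrow> r2 *\<^sub>R k2 \<bullet> z \<in> \<int>"
    and A: "0 < A1" "0 < A2" and k: "\<not> parallel k1 k2" "k1 \<bullet> k2 < 0" and r: "0 < r1" "0 < r2"
  shows "r1 = r2"
proof (rule ccontr)
  assume ne: "r1 \<noteq> r2"
  obtain q where "k1 \<bullet> q = 1" "k2 \<bullet> q = - 1" using not_parallel_solve[OF k(1)] by blast
  then have q: "q \<bullet> k1 = 1" "q \<bullet> k2 = - 1" by (auto simp: inner_commute)
  have sum0: "k1 + k2 \<noteq> 0"
  proof
    assume "k1 + k2 = 0"
    then have "k1 = (-1) *\<^sub>R k2" by (simp add: eq_neg_iff_add_eq_0)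
    then show False using parallel_scaleR[of "-1" k2] k(1) by simp
  qed
  have res: "q \<bullet> k1 \<noteq> 0" "q \<bullet> (k1 + k2) = 0" using q by (auto simp: inner_add_right)
  let ?c = "A1\<^sup>2 * (norm k1)\<^sup>2 + A2\<^sup>2 * (norm k2)\<^sup>2"
  have "\<exists>b>0. \<exists>C. \<forall>t\<ge>1. t\<^sup>2 * (norm q)\<^sup>2 / 2 + a +
     (A1\<^sup>2 * (norm k1)\<^sup>2 / (q \<bullet> k1)\<^sup>2 + A2\<^sup>2 * (norm k2)\<^sup>2 / (q \<bullet> k2)\<^sup>2 + b) / t\<^sup>2 - C / t ^ 4
     \<le> H (t *\<^sub>R q)"
    by (rule resonant_lower_bound[OF \<Lambda> H int A k(2) sum0 res])
  then obtain b C where b: "0 < b" and lower: "\<And>t. 1 \<le> t \<Longrightarrow>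
     t\<^sup>2 * (norm q)\<^sup>2 / 2 + a + (?c + b) / t\<^sup>2 - C / t ^ 4 \<le> H (t *\<^sub>R q)"
    unfolding q by auto
  have nr: "q \<bullet> (r1 *\<^sub>R k1) \<noteq> 0" "q \<bullet> (r2 *\<^sub>R k2) \<noteq> 0"
    "q \<bullet> (r1 *\<^sub>R k1 + r2 *\<^sub>R k2) \<noteq> 0" "q \<bullet> (r1 *\<^sub>R k1 - r2 *\<^sub>R k2) \<noteq> 0"
    using r ne q by (auto simp: inner_add_right inner_diff_right)
  have c': "A1\<^sup>2 * (norm (r1 *\<^sub>R k1))\<^sup>2 / (q \<bullet> (r1 *\<^sub>R k1))\<^sup>2 + A2\<^sup>2 * (norm (r2 *\<^sub>R k2))\<^sup>2 / (q \<bullet> (r2 *\<^sub>R k2))\<^sup>2 = ?c"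
    using r q by (simp add: power_mult_distrib)
  have "\<exists>C. \<forall>t\<ge>1. \<bar>H (t *\<^sub>R q) - (t\<^sup>2 * (norm q)\<^sup>2 / 2 + a +
     (A1\<^sup>2 * (norm (r1 *\<^sub>R k1))\<^sup>2 / (q \<bullet> (r1 *\<^sub>R k1))\<^sup>2 + A2\<^sup>2 * (norm (r2 *\<^sub>R k2))\<^sup>2 / (q \<bullet> (r2 *\<^sub>R k2))\<^sup>2) / t\<^sup>2)\<bar> \<le> C / t ^ 4"
    by (rule nonresonant_expansion[OF \<Lambda> H' int' nr])
  then obtain C' where upper: "\<And>t. 1 \<le> t \<Longrightarrow>
     \<bar>H (t *\<^sub>R q) - (t\<^sup>2 * (norm q)\<^sup>2 / 2 + a + ?c / t\<^sup>2)\<bar> \<le> C' / t ^ 4"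
    unfolding c' by blast
  have "b = 0"
  proof (rule small_imp_zero)
    fix t :: real assume t: "1 \<le> t"
    then have t2: "0 < t\<^sup>2" by simp
    have "b / t\<^sup>2 \<le> C / t ^ 4 + C' / t ^ 4"
      using lower[OF t] upper[OF t] unfolding add_divide_distrib by linarith
    also have "\<dots> = (C + C') / t\<^sup>2 / t\<^sup>2" by (simp add: add_divide_distrib flip: power_add)
    finally have "b \<le> (C + C') / t\<^sup>2"
      using divide_strict_right_mono[OF _ t2, of "(C + C') / t\<^sup>2" b] by linarith
    then show "\<bar>b\<bar> \<le> (C + C') / t\<^sup>2" using b by simp
  qed
  then show False using b by simp
qed

lemma equal_levels_imp_equal_dilations:
  fixes k1 k2 :: "'a::euclidean_space"
  assumes \<Lambda>: "cocompact \<Lambda>"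
    and H: "\<And>p. critical_level \<Lambda> (two_mode a A1 \<alpha>1 k1 A2 \<alpha>2 k2) p (H p)"
    and H': "\<And>p. critical_level \<Lambda> (two_mode a A1 \<beta>1 (r1 *\<^sub>R k1) A2 \<beta>2 (r2 *\<^sub>R k2)) p (H p)"
    and int: "\<And>z. z \<in> \<Lambda> \<Longrightarrow> k1 \<bullet> z \<in> \<int>" "\<And>z. z \<in> \<Lambda> \<Longrightarrow> k2 \<bullet> z \<in> \<int>"
    and int': "\<And>z. z \<in> \<Lambda> \<Longrightarrow> r1 *\<^sub>R k1 \<bullet> z \<in> \<int>" "\<And>z. z \<in> \<Lambda> \<Longrightarrow> r2 *\<^sub>R k2 \<bullet> z \<in> \<int>"
    and A: "0 < A1" "0 < A2" and k: "\<not> parallel k1 k2" "k1 \<bullet> k2 \<noteq> 0" and r: "r1 \<noteq> 0" "r2 \<noteq> 0"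
  shows "\<bar>r1\<bar> = \<bar>r2\<bar>"
proof -
  \<comment> \<open>Reversing the second mode by this sign makes the angle obtuse.\<close>
  define s where "s = - sgn (k1 \<bullet> k2)"
  have s: "s \<in> {1, -1}" using k(2) by (auto simp: s_def sgn_if)
  have ss: "s * s = 1" using s by auto
  have sr: "sgn r1 \<in> {1, -1}" "s * sgn r2 \<in> {1, -1}" using r s by (auto simp: sgn_if)
  have one: "(1::real) \<in> {1, -1}" by simp
  have e1: "sgn r1 *\<^sub>R (r1 *\<^sub>R k1) = \<bar>r1\<bar> *\<^sub>R k1" by (simp add: abs_sgn mult.commute)
  have e2: "(s * sgn r2) *\<^sub>R (r2 *\<^sub>R k2) = \<bar>r2\<bar> *\<^sub>R (s *\<^sub>R k2)" by (simp add: abs_sgn mult_ac)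
  have H1: "\<And>p. critical_level \<Lambda> (two_mode a A1 \<alpha>1 k1 A2 (s * \<alpha>2) (s *\<^sub>R k2)) p (H p)"
    using H two_mode_flip[OF one s, of a A1 \<alpha>1 k1 A2 \<alpha>2 k2] by simp
  have H2: "\<And>p. critical_level \<Lambda> (two_mode a A1 (sgn r1 * \<beta>1) (\<bar>r1\<bar> *\<^sub>R k1) A2 (s * sgn r2 * \<beta>2) (\<bar>r2\<bar> *\<^sub>R (s *\<^sub>R k2))) p (H p)"
    using H' two_mode_flip[OF sr, of a A1 \<beta>1 "r1 *\<^sub>R k1" A2 \<beta>2 "r2 *\<^sub>R k2", unfolded e1 e2] by simp
  have flip_int: "(s' *\<^sub>R k) \<bullet> z \<in> \<int>" if "s' \<in> {1, -1}" "k \<bullet> z \<in> \<int>" for s' and k z :: 'a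
    using that by auto
  show ?thesis
  proof (rule equal_levels_imp_equal_dilations_obtuse[OF \<Lambda> H1 H2 int(1) _ _ _ A])
    show "s *\<^sub>R k2 \<bullet> z \<in> \<int>" if "z \<in> \<Lambda>" for z by (rule flip_int[OF s int(2)[OF that]])
    show "\<bar>r1\<bar> *\<^sub>R k1 \<bullet> z \<in> \<int>" if "z \<in> \<Lambda>" for z
      using flip_int[OF sr(1) int'(1)[OF that]] unfolding e1 .
    show "\<bar>r2\<bar> *\<^sub>R (s *\<^sub>R k2) \<bullet> z \<in> \<int>" if "z \<in> \<Lambda>" for z
      using flip_int[OF sr(2) int'(2)[OF that]] unfolding e2 .
    show "\<not> parallel k1 (s *\<^sub>R k2)"
    proof
      assume par: "parallel k1 (s *\<^sub>R k2)"
      have "k1 \<noteq> 0" "s *\<^sub>R k2 \<noteq> 0" using k(2) s by auto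
      then obtain r where "k1 = r *\<^sub>R (s *\<^sub>R k2)" using parallel_nonzeroE[OF par] by metis
      then have "k1 = (r * s) *\<^sub>R k2" by simp
      then show False using k(1) parallel_scaleR by metis
    qed
    show "k1 \<bullet> (s *\<^sub>R k2) < 0" using k(2) by (auto simp: s_def sgn_if)
    show "0 < \<bar>r1\<bar>" "0 < \<bar>r2\<bar>" using r by auto
  qed
qed

lemma cos_mode_translate:
  assumes "s \<in> {1, -1}" "r \<noteq> 0" "r' = s * r" "(r' *\<^sub>R k) \<bullet> y = (s * \<alpha> - \<beta>) / (2 * pi)"
  shows "cos (2 * pi * ((r' *\<^sub>R k) \<bullet> (x /\<^sub>R r + y)) + \<beta>) = cos_mode k \<alpha> x"
proof -
  have "inverse r * r' = s" using assms(2,3) by simp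
  then have scal: "(r' *\<^sub>R k) \<bullet> (x /\<^sub>R r) = s * (k \<bullet> x)" by (simp flip: mult.assoc)
  have "2 * pi * ((r' *\<^sub>R k) \<bullet> (x /\<^sub>R r + y)) + \<beta> = 2 * pi * ((s *\<^sub>R k) \<bullet> x) + s * \<alpha>"
    unfolding inner_add_right assms(4) scal by (simp add: field_simps)
  then show ?thesis using cos_mode_flip[OF assms(1)] by simp
qed

text \<open>
  Dilation by r1 undoes the factors r1 and, up to a reversal of the second wave vector, r2. The
  two phases are then matched by a translation, which is possible because k1 and k2 are linearly
  independent.
\<close>

lemma two_mode_rescaled:
  fixes k1 k2 :: "'a::real_inner"
  assumes k: "\<not> parallel k1 k2" and r: "r1 \<noteq> 0" "\<bar>r1\<bar> = \<bar>r2\<bar>"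
  shows "\<exists>x0. \<forall>x. two_mode a A1 \<alpha>1 k1 A2 \<alpha>2 k2 x
     = two_mode a A1 \<beta>1 (r1 *\<^sub>R k1) A2 \<beta>2 (r2 *\<^sub>R k2) (x /\<^sub>R r1 + x0)"
proof -
  define s where "s = r2 / r1"
  have s: "s \<in> {1, -1}" "r2 = s * r1" using r by (auto simp: s_def abs_if split: if_splits)
  have one: "(1::real) \<in> {1, -1}" "r1 = 1 * r1" by auto
  have r2: "r2 \<noteq> 0" using r by auto
  obtain y where y: "k1 \<bullet> y = ((1 * \<alpha>1 - \<beta>1) / (2 * pi)) / r1" "k2 \<bullet> y = ((s * \<alpha>2 - \<beta>2) / (2 * pi)) / r2"
    using not_parallel_solve[OF k] by blast
  then have y': "(r1 *\<^sub>R k1) \<bullet> y = (1 * \<alpha>1 - \<beta>1) / (2 * pi)" "(r2 *\<^sub>R k2) \<bullet> y = (s * \<alpha>2 - \<beta>2) / (2 * pi)"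
    using r r2 by auto
  show ?thesis
    unfolding two_mode_def
    by (intro exI[of _ y] allI)
      (simp only: cos_mode_translate[OF one(1) r(1) one(2) y'(1)] cos_mode_translate[OF s(1) r(1) s(2) y'(2)])
qed

lemma one_mode_rescaled:
  fixes k1 :: "'a::real_inner"
  assumes k: "k1 \<noteq> 0" and r: "r \<noteq> 0"
  shows "\<exists>x0. \<forall>x. two_mode a A1 \<alpha>1 k1 0 \<alpha>2 k2 x
     = two_mode a A1 \<beta>1 (r *\<^sub>R k1) 0 \<beta>2 k2' (x /\<^sub>R r + x0)"
proof -
  have one: "(1::real) \<in> {1, -1}" "r = 1 * r" by auto
  obtain y where "k1 \<bullet> y = ((1 * \<alpha>1 - \<beta>1) / (2 * pi)) / r" using single_solve[OF k] by blast
  then have y': "(r *\<^sub>R k1) \<bullet> y = (1 * \<alpha>1 - \<beta>1) / (2 * pi)" using r by auto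
  show ?thesis unfolding two_mode_def
    by (intro exI[of _ y] allI)
      (simp only: cos_mode_translate[OF one(1) r one(2) y'] mult_zero_right mult_zero_left)
qed

text \<open>
  The separated problems involve only the amplitudes and the numbers p \<bullet> k_j/|k_j|, which
  a dilation of k_j by a positive factor does not change.
\<close>

lemma orthogonal_levels_depend_on_directions:
  fixes k1 k2 p :: "'a::euclidean_space"
  assumes k: "k1 \<noteq> 0" "k2 \<noteq> 0" "k1 \<bullet> k2 = 0" and r: "r1 \<noteq> 0" "r2 \<noteq> 0"
    and int: "\<And>z. z \<in> \<Lambda> \<Longrightarrow> k1 \<bullet> z \<in> \<int>" "\<And>z. z \<in> \<Lambda> \<Longrightarrow> k2 \<bullet> z \<in> \<int>"
    and int': "\<And>z. z \<in> \<Lambda> \<Longrightarrow> r1 *\<^sub>R k1 \<bullet> z \<in> \<int>" "\<And>z. z \<in> \<Lambda> \<Longrightarrow> r2 *\<^sub>R k2 \<bullet> z \<in> \<int>"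
  shows "\<exists>\<mu>. critical_level \<Lambda> (two_mode a A1 \<alpha>1 k1 A2 \<alpha>2 k2) p \<mu> \<and>
     critical_level \<Lambda> (two_mode a A1 \<beta>1 (r1 *\<^sub>R k1) A2 \<beta>2 (r2 *\<^sub>R k2)) p \<mu>"
proof -
  define f where "f = (\<lambda>A s :: real. 2 * A * cos (2 * pi * s))"
  have level: "\<exists>\<mu>. critical_level \<int> (f A) P \<mu>" for A P
  proof -
    have f: "f A = two_mode 0 A 0 1 0 0 1" by (simp add: fun_eq_iff f_def two_mode_def)
    obtain M where M: "\<And>x y. \<bar>f A x - f A y\<bar> \<le> M * norm (x - y)" unfolding f using two_mode_lipschitz by blast
    have "periodic_under \<int> (f A)" unfolding f by (rule two_mode_periodic) auto
    from cell_problem_solvable[OF cocompact_Ints this M] show ?thesis unfolding critical_level_def by blast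
  qed
  have repr: "two_mode a A1 \<alpha>1 k1 A2 \<alpha>2 k2 x
      = a + f A1 (k1 \<bullet> x + \<alpha>1 / (2 * pi)) + f A2 (k2 \<bullet> x + \<alpha>2 / (2 * pi))" for \<alpha>1 \<alpha>2 k1 k2 and x :: 'a
    by (simp add: two_mode_def f_def distrib_left)
  obtain \<mu>1 where \<mu>1: "critical_level \<int> (f A1) (p \<bullet> k1 / norm k1) \<mu>1" using level by blast
  obtain \<mu>2 where \<mu>2: "critical_level \<int> (f A2) (p \<bullet> k2 / norm k2) \<mu>2" using level by blast
  define s1 where "s1 = sgn r1"
  define s2 where "s2 = sgn r2"
  have s: "s1 \<in> {1, -1}" "s2 \<in> {1, -1}" using r by (auto simp: s1_def s2_def sgn_if)
  have e: "s1 *\<^sub>R (r1 *\<^sub>R k1) = \<bar>r1\<bar> *\<^sub>R k1" "s2 *\<^sub>R (r2 *\<^sub>R k2) = \<bar>r2\<bar> *\<^sub>R k2"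
    by (simp_all add: s1_def s2_def abs_sgn mult.commute)
  have P: "p \<bullet> (\<bar>r1\<bar> *\<^sub>R k1) / norm (\<bar>r1\<bar> *\<^sub>R k1) = p \<bullet> k1 / norm k1"
    "p \<bullet> (\<bar>r2\<bar> *\<^sub>R k2) / norm (\<bar>r2\<bar> *\<^sub>R k2) = p \<bullet> k2 / norm k2" using r by auto
  have flip_int: "(s' *\<^sub>R k) \<bullet> z \<in> \<int>" if "s' \<in> {1, -1}" "k \<bullet> z \<in> \<int>" for s' and k z :: 'a
    using that by auto
  have int1: "\<bar>r1\<bar> *\<^sub>R k1 \<bullet> z \<in> \<int>" if "z \<in> \<Lambda>" for z
    using flip_int[OF s(1) int'(1)[OF that]] unfolding e .
  have int2: "\<bar>r2\<bar> *\<^sub>R k2 \<bullet> z \<in> \<int>" if "z \<in> \<Lambda>" for z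
    using flip_int[OF s(2) int'(2)[OF that]] unfolding e .
  have k': "\<bar>r1\<bar> *\<^sub>R k1 \<noteq> 0" "\<bar>r2\<bar> *\<^sub>R k2 \<noteq> 0" "(\<bar>r1\<bar> *\<^sub>R k1) \<bullet> (\<bar>r2\<bar> *\<^sub>R k2) = 0"
    using k r by auto
  define \<mu> where "\<mu> = a + ((norm p)\<^sup>2 - (p \<bullet> k1 / norm k1)\<^sup>2 - (p \<bullet> k2 / norm k2)\<^sup>2) / 2 + \<mu>1 + \<mu>2"
  have "critical_level \<Lambda> (two_mode a A1 \<alpha>1 k1 A2 \<alpha>2 k2) p \<mu>"
    unfolding \<mu>_def by (rule critical_level_orthogonal_sum[OF k int \<mu>1 \<mu>2 repr])
  moreover have "critical_level \<Lambda> (two_mode a A1 (s1 * \<beta>1) (\<bar>r1\<bar> *\<^sub>R k1) A2 (s2 * \<beta>2) (\<bar>r2\<bar> *\<^sub>R k2)) p \<mu>"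
  proof -
    have "critical_level \<int> (f A1) (p \<bullet> (\<bar>r1\<bar> *\<^sub>R k1) / norm (\<bar>r1\<bar> *\<^sub>R k1)) \<mu>1"
      "critical_level \<int> (f A2) (p \<bullet> (\<bar>r2\<bar> *\<^sub>R k2) / norm (\<bar>r2\<bar> *\<^sub>R k2)) \<mu>2"
      unfolding P by (rule \<mu>1, rule \<mu>2)
    from critical_level_orthogonal_sum[OF k' int1 int2 this repr]
    show ?thesis unfolding P \<mu>_def .
  qed
  then have "critical_level \<Lambda> (two_mode a A1 \<beta>1 (r1 *\<^sub>R k1) A2 \<beta>2 (r2 *\<^sub>R k2)) p \<mu>"
    using two_mode_flip[OF s, of a A1 \<beta>1 "r1 *\<^sub>R k1" A2 \<beta>2 "r2 *\<^sub>R k2", unfolded e] by simp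
  ultimately show ?thesis by blast
qed

text \<open>
  At most one of the two nonparallel vectors k1, k2 is parallel to k, and it must carry the whole
  weight A^2.
\<close>

lemma matched_mode:
  fixes k k0 k1 k2 :: "'a::real_vector"
  assumes w: "mode_weight A k k + mode_weight A0 k0 k = mode_weight A1 k1 k + mode_weight A2 k2 k"
    and A: "0 < A" "0 < A1" "0 < A2" and nz: "k \<noteq> 0" "k0 \<noteq> 0" "k1 \<noteq> 0" "k2 \<noteq> 0"
    and np: "\<not> parallel k0 k" "\<not> parallel k1 k2"
  shows "(parallel k k1 \<and> A = A1) \<or> (parallel k k2 \<and> A = A2)"
proof -
  have "parallel k k" using parallel_scaleR[of 1 k] by simp
  then have w': "A\<^sup>2 = mode_weight A1 k1 k + mode_weight A2 k2 k" using w np(1) by (simp add: mode_weight_def)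
  have not_both: "\<not> (parallel k1 k \<and> parallel k2 k)"
    using np(2) parallel_trans[OF _ parallel_sym nz(3,1,4)] by blast
  have A2: "0 < A\<^sup>2" using A by simp
  show ?thesis
  proof (cases "parallel k1 k")
    case True
    then have "A\<^sup>2 = A1\<^sup>2" using w' not_both by (simp add: mode_weight_def)
    then have "A = A1" using A by (simp add: power2_eq_iff_nonneg)
    then show ?thesis using True parallel_sym by blast
  next
    case False
    then have "A\<^sup>2 = mode_weight A2 k2 k" using w' by (simp add: mode_weight_def)
    then have par: "parallel k2 k" "A\<^sup>2 = A2\<^sup>2" using A2 by (auto simp: mode_weight_def split: if_splits)
    then have "A = A2" using A by (simp add: power2_eq_iff_nonneg)
    then show ?thesis using par parallel_sym by blast
  qed
qed

lemma of_int_vec_eq_0_iff: "of_int_vec z = 0 \<longleftrightarrow> z = 0"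
  by (simp add: of_int_vec_def vec_eq_iff)

lemma of_int_vec_ratio_rational:
  assumes "of_int_vec w = r *\<^sub>R of_int_vec z" "z \<noteq> 0"
  shows "r \<in> \<rat>"
proof -
  obtain i where i: "z $ i \<noteq> 0" using assms(2) by (auto simp: vec_eq_iff)
  have "of_int (w $ i) = r * of_int (z $ i)"
    using arg_cong[OF assms(1), of "\<lambda>v. v $ i"] by (simp add: of_int_vec_def)
  then have "r = of_int (w $ i) / of_int (z $ i)" using i by (simp add: field_simps)
  then show ?thesis by simp
qed

section \<open>Rigidity of effective Hamiltonians\<close>

lemma two_mode_effective_Hamiltonian:
  fixes k1 k2 :: "real ^ 'n" and a A1 A2 \<alpha>1 \<alpha>2 :: real
  assumes "\<And>z. z \<in> integer_lattice 1 \<Longrightarrow> k1 \<bullet> z \<in> \<int>" "\<And>z. z \<in> integer_lattice 1 \<Longrightarrow> k2 \<bullet> z \<in> \<int>"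
  defines "V \<equiv> two_mode a A1 \<alpha>1 k1 A2 \<alpha>2 k2"
  shows "critical_level (integer_lattice 1) V p (effective_Hamiltonian V p)"
    and "critical_level (integer_lattice 1) V p \<mu> \<Longrightarrow> effective_Hamiltonian V p = \<mu>"
proof -
  have per: "periodic_under (integer_lattice 1) V" unfolding V_def by (rule two_mode_periodic[OF assms(1,2)])
  obtain M where lip: "\<And>x y. \<bar>V x - V y\<bar> \<le> M * norm (x - y)" unfolding V_def using two_mode_lipschitz by blast
  show "critical_level (integer_lattice 1) V p (effective_Hamiltonian V p)"
    by (rule effective_Hamiltonian_critical[OF per lip])
  show "critical_level (integer_lattice 1) V p \<mu> \<Longrightarrow> effective_Hamiltonian V p = \<mu>"
    by (rule effective_Hamiltonian_eqI[OF per lip zero_less_one])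
qed

lemma two_mode_effective_rescale:
  fixes k1 k2 k1' k2' :: "real ^ 'n"
  assumes int: "\<And>z. z \<in> integer_lattice 1 \<Longrightarrow> k1 \<bullet> z \<in> \<int>" "\<And>z. z \<in> integer_lattice 1 \<Longrightarrow> k2 \<bullet> z \<in> \<int>"
    and int': "\<And>z. z \<in> integer_lattice 1 \<Longrightarrow> k1' \<bullet> z \<in> \<int>" "\<And>z. z \<in> integer_lattice 1 \<Longrightarrow> k2' \<bullet> z \<in> \<int>"
    and c: "c \<in> \<rat> - {0}"
    and eq: "\<And>x. two_mode a A1 \<alpha>1 k1 A2 \<alpha>2 k2 x = two_mode a' A1' \<alpha>1' k1' A2' \<alpha>2' k2' (x /\<^sub>R c + x0)"
    and reflect: "\<And>x. two_mode a' A1' \<alpha>1' k1' A2' \<alpha>2' k2' (y - x) = two_mode a' A1' \<alpha>1' k1' A2' \<alpha>2' k2' x"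
  shows "effective_Hamiltonian (two_mode a A1 \<alpha>1 k1 A2 \<alpha>2 k2)
    = effective_Hamiltonian (two_mode a' A1' \<alpha>1' k1' A2' \<alpha>2' k2')"
proof -
  let ?V = "two_mode a A1 \<alpha>1 k1 A2 \<alpha>2 k2" and ?V' = "two_mode a' A1' \<alpha>1' k1' A2' \<alpha>2' k2'"
  obtain M where lip: "\<And>x y. \<bar>?V x - ?V y\<bar> \<le> M * norm (x - y)" using two_mode_lipschitz by blast
  obtain M' where lip': "\<And>x y. \<bar>?V' x - ?V' y\<bar> \<le> M' * norm (x - y)" using two_mode_lipschitz by blast
  show ?thesis
    by (rule effective_Hamiltonian_rescale[OF two_mode_periodic[OF int] lip two_mode_periodic[OF int'] lip' c eq reflect])
qed

lemma one_mode_rigidity: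
  fixes k k' :: "int ^ 'n"
  assumes A: "0 < A" "0 < A'" and nz: "k \<noteq> 0" "k' \<noteq> 0"
    and V: "V = two_mode a A \<alpha> (of_int_vec k) 0 0 (2 *\<^sub>R of_int_vec k)"
    and V': "V' = two_mode a' A' \<alpha>' (of_int_vec k') 0 0 (2 *\<^sub>R of_int_vec k')"
  shows "effective_Hamiltonian V = effective_Hamiltonian V'
    \<longleftrightarrow> (\<exists>c x0. c \<in> \<rat> - {0} \<and> (\<forall>x. V x = V' (x /\<^sub>R c + x0)))"
proof
  let ?k = "of_int_vec k" and ?k' = "of_int_vec k'"
  have nz': "?k \<noteq> 0" "?k' \<noteq> 0" using nz by (simp_all add: of_int_vec_eq_0_iff)
  have int: "?k \<bullet> z \<in> \<int>" "(2 *\<^sub>R ?k) \<bullet> z \<in> \<int>" "?k' \<bullet> z \<in> \<int>" "(2 *\<^sub>R ?k') \<bullet> z \<in> \<int>"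
    if "z \<in> integer_lattice 1" for z
    using mode_integral_on_lattice[OF that] by auto
  \<comment> \<open>The auxiliary second mode 2k of amplitude 0 meets the nonvanishing conditions of the two-mode
    lemmas.\<close>
  have sums: "w + 2 *\<^sub>R w \<noteq> 0" "w - 2 *\<^sub>R w \<noteq> 0" "2 *\<^sub>R w \<noteq> 0" if "w \<noteq> 0" for w :: "real ^ 'n"
  proof -
    have "w + 2 *\<^sub>R w = 3 *\<^sub>R w" "w - 2 *\<^sub>R w = (-1) *\<^sub>R w"
      by (simp_all add: vec_eq_iff)
    then show "w + 2 *\<^sub>R w \<noteq> 0" "w - 2 *\<^sub>R w \<noteq> 0" "2 *\<^sub>R w \<noteq> 0" using that by auto
  qed
  {
    assume H: "effective_Hamiltonian V = effective_Hamiltonian V'"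
    define E where "E = effective_Hamiltonian V"
    have crit: "critical_level (integer_lattice 1) (two_mode a A \<alpha> ?k 0 0 (2 *\<^sub>R ?k)) p (E p)" for p
      unfolding E_def V by (rule two_mode_effective_Hamiltonian(1)[OF int(1,2)])
    have crit': "critical_level (integer_lattice 1) (two_mode a' A' \<alpha>' ?k' 0 0 (2 *\<^sub>R ?k')) p (E p)" for p
      unfolding E_def H unfolding V' by (rule two_mode_effective_Hamiltonian(1)[OF int(3,4)])
    note eqs = equal_levels_imp_equal_weights[OF cocompact_integer_lattice[OF zero_less_one]
        crit crit' int nz'(1) sums(3,1,2)[OF nz'(1)] nz'(2) sums(3,1,2)[OF nz'(2)] nz'(1)]
    have a: "a = a'" by (rule eqs(1))
    have w: "mode_weight A ?k ?k + mode_weight 0 (2 *\<^sub>R ?k) ?k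
        = mode_weight A' ?k' ?k + mode_weight 0 (2 *\<^sub>R ?k') ?k" by (rule eqs(2))
    have "parallel ?k ?k" using parallel_scaleR[of 1 ?k] by simp
    then have "mode_weight A ?k ?k = A\<^sup>2" by (simp add: mode_weight_def)
    moreover have "mode_weight 0 u ?k = 0" for u by (simp add: mode_weight_def)
    ultimately have "A\<^sup>2 = mode_weight A' ?k' ?k" using w by simp
    moreover have "0 < A\<^sup>2" using A by simp
    ultimately have par: "parallel ?k' ?k" and "A\<^sup>2 = A'\<^sup>2"
      by (auto simp: mode_weight_def split: if_splits)
    then have AA: "A = A'" using A by (simp add: power2_eq_iff_nonneg)
    obtain r where r: "r \<noteq> 0" "?k' = r *\<^sub>R ?k" by (rule parallel_nonzeroE[OF par nz'(2,1)])
    have "r \<in> \<rat>" by (rule of_int_vec_ratio_rational[OF r(2) nz(1)])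
    moreover have "\<exists>x0. \<forall>x. V x = V' (x /\<^sub>R r + x0)"
      unfolding V V' a AA r(2) by (rule one_mode_rescaled[OF nz'(1) r(1)])
    ultimately show "\<exists>c x0. c \<in> \<rat> - {0} \<and> (\<forall>x. V x = V' (x /\<^sub>R c + x0))" using r(1) by blast
  }
  assume "\<exists>c x0. c \<in> \<rat> - {0} \<and> (\<forall>x. V x = V' (x /\<^sub>R c + x0))"
  then obtain c x0 where c: "c \<in> \<rat> - {0}" "\<And>x. V x = V' (x /\<^sub>R c + x0)" by blast
  obtain y where "\<And>x. V' (y - x) = V' x" unfolding V' using one_mode_reflect[OF nz'(2)] by blast
  then show "effective_Hamiltonian V = effective_Hamiltonian V'"
    using c unfolding V V' by (intro two_mode_effective_rescale[OF int])
qed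

lemma equal_effective_Hamiltonians_match:
  fixes k1 k2 k1' k2' :: "int ^ 'n"
  assumes A: "0 < A1" "0 < A2" "0 < A1'" "0 < A2'"
    and nz: "k1 \<noteq> 0" "k2 \<noteq> 0" "k1' \<noteq> 0" "k2' \<noteq> 0"
    and np: "\<not> parallel (of_int_vec k1) (of_int_vec k2)"
      "\<not> parallel (of_int_vec k1') (of_int_vec k2')"
    and H: "effective_Hamiltonian (two_mode a A1 \<alpha>1 (of_int_vec k1) A2 \<alpha>2 (of_int_vec k2))
      = effective_Hamiltonian (two_mode a' A1' \<alpha>1' (of_int_vec k1') A2' \<alpha>2' (of_int_vec k2'))"
  shows "a = a' \<and>
     ((parallel (of_int_vec k1) (of_int_vec k1') \<and> A1 = A1' \<and>
       parallel (of_int_vec k2) (of_int_vec k2') \<and> A2 = A2') \<or>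
      (parallel (of_int_vec k1) (of_int_vec k2') \<and> A1 = A2' \<and>
       parallel (of_int_vec k2) (of_int_vec k1') \<and> A2 = A1'))"
proof -
  let ?k1 = "of_int_vec k1" and ?k2 = "of_int_vec k2"
  let ?k1' = "of_int_vec k1'" and ?k2' = "of_int_vec k2'"
  have nz': "?k1 \<noteq> 0" "?k2 \<noteq> 0" "?k1' \<noteq> 0" "?k2' \<noteq> 0" using nz by (simp_all add: of_int_vec_eq_0_iff)
  have sums: "u + w \<noteq> 0" "u - w \<noteq> 0" if "\<not> parallel u w" for u w :: "real ^ 'n"
  proof
    assume "u + w = 0"
    then have "u = (-1) *\<^sub>R w" by (simp add: eq_neg_iff_add_eq_0)
    then show False using that parallel_scaleR by metis
  next
    show "u - w \<noteq> 0" using that parallel_scaleR[of 1 w] by auto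
  qed
  have int: "?k1 \<bullet> z \<in> \<int>" "?k2 \<bullet> z \<in> \<int>" "?k1' \<bullet> z \<in> \<int>" "?k2' \<bullet> z \<in> \<int>"
    if "z \<in> integer_lattice 1" for z
    using mode_integral_on_lattice[OF that] by blast+
  have crit: "critical_level (integer_lattice 1) (two_mode a A1 \<alpha>1 ?k1 A2 \<alpha>2 ?k2) p
        (effective_Hamiltonian (two_mode a A1 \<alpha>1 ?k1 A2 \<alpha>2 ?k2) p)" for p
    by (rule two_mode_effective_Hamiltonian(1)[OF int(1,2)])
  have crit': "critical_level (integer_lattice 1) (two_mode a' A1' \<alpha>1' ?k1' A2' \<alpha>2' ?k2') p
        (effective_Hamiltonian (two_mode a A1 \<alpha>1 ?k1 A2 \<alpha>2 ?k2) p)" for p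
    unfolding H by (rule two_mode_effective_Hamiltonian(1)[OF int(3,4)])
  note eqs = equal_levels_imp_equal_weights[OF cocompact_integer_lattice[OF zero_less_one]
        crit crit' int nz'(1,2) sums[OF np(1)] nz'(3,4) sums[OF np(2)]]
  have a: "a = a'" by (rule eqs(1)[of ?k1]) (use nz' in auto)
  have w: "mode_weight A1 ?k1 e + mode_weight A2 ?k2 e = mode_weight A1' ?k1' e + mode_weight A2' ?k2' e"
    if "e \<noteq> 0" for e by (rule eqs(2)) (use that in auto)
  have np': "\<not> parallel ?k2 ?k1" using np(1) parallel_sym by blast
  have 1: "(parallel ?k1 ?k1' \<and> A1 = A1') \<or> (parallel ?k1 ?k2' \<and> A1 = A2')"
    by (rule matched_mode[OF w[OF nz'(1)] A(1,3,4) nz'(1,2,3,4) np' np(2)])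
  have "mode_weight A2 ?k2 ?k2 + mode_weight A1 ?k1 ?k2 = mode_weight A1' ?k1' ?k2 + mode_weight A2' ?k2' ?k2"
    using w[OF nz'(2)] by simp
  then have 2: "(parallel ?k2 ?k1' \<and> A2 = A1') \<or> (parallel ?k2 ?k2' \<and> A2 = A2')"
    by (rule matched_mode[OF _ A(2,3,4) nz'(2,1,3,4) np(1) np(2)])
  have "\<not> (parallel ?k1 w \<and> parallel ?k2 w)" if "w \<noteq> 0" for w
    using np(1) parallel_trans[OF _ parallel_sym nz'(1) that nz'(2)] by blast
  then show ?thesis using a 1 2 nz'(3,4) by blast
qed

lemma aligned_nonorthogonal_rescaled:
  fixes k1 k2 k1' k2' :: "int ^ 'n"
  assumes A: "0 < A1" "0 < A2"
    and nz: "k1 \<noteq> 0" "k2 \<noteq> 0" "k1' \<noteq> 0" "k2' \<noteq> 0"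
    and np: "\<not> parallel (of_int_vec k1) (of_int_vec k2)"
    and par: "parallel (of_int_vec k1) (of_int_vec k1')"
      "parallel (of_int_vec k2) (of_int_vec k2')"
    and no: "of_int_vec k1 \<bullet> (of_int_vec k2) \<noteq> 0"
    and V: "V = two_mode a A1 \<alpha>1 (of_int_vec k1) A2 \<alpha>2 (of_int_vec k2)"
    and V': "V' = two_mode a A1 \<alpha>1' (of_int_vec k1') A2 \<alpha>2' (of_int_vec k2')"
    and H: "effective_Hamiltonian V = effective_Hamiltonian V'"
  shows "\<exists>c x0. c \<in> \<rat> - {0} \<and> (\<forall>x. V x = V' (x /\<^sub>R c + x0))"
proof -
  let ?k1 = "of_int_vec k1" and ?k2 = "of_int_vec k2"
  let ?k1' = "of_int_vec k1'" and ?k2' = "of_int_vec k2'"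
  have nz': "?k1 \<noteq> 0" "?k2 \<noteq> 0" "?k1' \<noteq> 0" "?k2' \<noteq> 0" using nz by (simp_all add: of_int_vec_eq_0_iff)
  obtain r1 where r1: "r1 \<noteq> 0" "?k1' = r1 *\<^sub>R ?k1"
    by (rule parallel_nonzeroE[OF parallel_sym[OF par(1)] nz'(3,1)])
  obtain r2 where r2: "r2 \<noteq> 0" "?k2' = r2 *\<^sub>R ?k2"
    by (rule parallel_nonzeroE[OF parallel_sym[OF par(2)] nz'(4,2)])
  have int: "?k1 \<bullet> z \<in> \<int>" "?k2 \<bullet> z \<in> \<int>" "?k1' \<bullet> z \<in> \<int>" "?k2' \<bullet> z \<in> \<int>"
    if "z \<in> integer_lattice 1" for z
    using mode_integral_on_lattice[OF that] by blast+
  have int': "r1 *\<^sub>R ?k1 \<bullet> z \<in> \<int>" "r2 *\<^sub>R ?k2 \<bullet> z \<in> \<int>" if "z \<in> integer_lattice 1" for z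
    using int[OF that] unfolding r1(2)[symmetric] r2(2)[symmetric] by blast+
  define E where "E = effective_Hamiltonian V"
  have crit: "critical_level (integer_lattice 1) (two_mode a A1 \<alpha>1 ?k1 A2 \<alpha>2 ?k2) p (E p)" for p
    unfolding E_def V by (rule two_mode_effective_Hamiltonian(1)[OF int(1,2)])
  have crit': "critical_level (integer_lattice 1) (two_mode a A1 \<alpha>1' (r1 *\<^sub>R ?k1) A2 \<alpha>2' (r2 *\<^sub>R ?k2)) p (E p)" for p
    unfolding E_def H V' r1(2)[symmetric] r2(2)[symmetric]
    by (rule two_mode_effective_Hamiltonian(1)[OF int(3,4)])
  have "\<bar>r1\<bar> = \<bar>r2\<bar>"
    by (rule equal_levels_imp_equal_dilations[OF cocompact_integer_lattice[OF zero_less_one]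
          crit crit' int(1,2) int' A np no r1(1) r2(1)])
  from two_mode_rescaled[OF np r1(1) this]
  have "\<exists>x0. \<forall>x. V x = V' (x /\<^sub>R r1 + x0)" unfolding V V' r1(2) r2(2) .
  moreover have "r1 \<in> \<rat>" by (rule of_int_vec_ratio_rational[OF r1(2) nz(1)])
  ultimately show ?thesis using r1(1) by blast
qed

lemma two_mode_rigidity:
  fixes k1 k2 k1' k2' :: "int ^ 'n"
  assumes A: "0 < A1" "0 < A2" "0 < A1'" "0 < A2'"
    and nz: "k1 \<noteq> 0" "k2 \<noteq> 0" "k1' \<noteq> 0" "k2' \<noteq> 0"
    and np: "\<not> parallel (of_int_vec k1) (of_int_vec k2)"
      "\<not> parallel (of_int_vec k1') (of_int_vec k2')"
    and no: "of_int_vec k1 \<bullet> (of_int_vec k2) \<noteq> 0"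
    and V: "V = two_mode a A1 \<alpha>1 (of_int_vec k1) A2 \<alpha>2 (of_int_vec k2)"
    and V': "V' = two_mode a' A1' \<alpha>1' (of_int_vec k1') A2' \<alpha>2' (of_int_vec k2')"
  shows "effective_Hamiltonian V = effective_Hamiltonian V'
    \<longleftrightarrow> (\<exists>c x0. c \<in> \<rat> - {0} \<and> (\<forall>x. V x = V' (x /\<^sub>R c + x0)))"
proof
  assume H: "effective_Hamiltonian V = effective_Hamiltonian V'"
  note match = equal_effective_Hamiltonians_match[OF A nz np H[unfolded V V']]
  then have a: "a = a'" by blast
  from match consider
    "parallel (of_int_vec k1) (of_int_vec k1')" "A1 = A1'"
      "parallel (of_int_vec k2) (of_int_vec k2')" "A2 = A2'"
    | "parallel (of_int_vec k1) (of_int_vec k2')" "A1 = A2'"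
      "parallel (of_int_vec k2) (of_int_vec k1')" "A2 = A1'" by blast
  then show "\<exists>c x0. c \<in> \<rat> - {0} \<and> (\<forall>x. V x = V' (x /\<^sub>R c + x0))"
  proof cases
    case 1
    show ?thesis
      by (rule aligned_nonorthogonal_rescaled[OF A(1,2) nz np(1) 1(1,3) no V _ H]) (simp add: V' a 1)
  next
    case 2
    show ?thesis
      by (rule aligned_nonorthogonal_rescaled[OF A(1,2) nz(1,2,4,3) np(1) 2(1,3) no V _ H])
        (simp add: V' a 2 two_mode_swap[of a' A1'])
  qed
next
  assume "\<exists>c x0. c \<in> \<rat> - {0} \<and> (\<forall>x. V x = V' (x /\<^sub>R c + x0))"
  then obtain c x0 where c: "c \<in> \<rat> - {0}" "\<And>x. V x = V' (x /\<^sub>R c + x0)" by blast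
  obtain y where "\<And>x. V' (y - x) = V' x" unfolding V' using two_mode_reflect[OF np(2)] by blast
  then show "effective_Hamiltonian V = effective_Hamiltonian V'"
    using c unfolding V V' by (intro two_mode_effective_rescale[OF mode_integral_on_lattice mode_integral_on_lattice
       mode_integral_on_lattice mode_integral_on_lattice])
qed

lemma aligned_orthogonal_equal:
  fixes k1 k2 k1' k2' :: "int ^ 'n"
  assumes nz: "k1 \<noteq> 0" "k2 \<noteq> 0" "k1' \<noteq> 0" "k2' \<noteq> 0"
    and par: "parallel (of_int_vec k1) (of_int_vec k1')"
      "parallel (of_int_vec k2) (of_int_vec k2')"
    and orth: "of_int_vec k1 \<bullet> (of_int_vec k2) = 0"
  shows "effective_Hamiltonian (two_mode a A1 \<alpha>1 (of_int_vec k1) A2 \<alpha>2 (of_int_vec k2))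
    = effective_Hamiltonian (two_mode a A1 \<alpha>1' (of_int_vec k1') A2 \<alpha>2' (of_int_vec k2'))"
proof
  fix p :: "real ^ 'n"
  let ?k1 = "of_int_vec k1" and ?k2 = "of_int_vec k2"
  let ?k1' = "of_int_vec k1'" and ?k2' = "of_int_vec k2'"
  have nz': "?k1 \<noteq> 0" "?k2 \<noteq> 0" "?k1' \<noteq> 0" "?k2' \<noteq> 0" using nz by (simp_all add: of_int_vec_eq_0_iff)
  obtain r1 where r1: "r1 \<noteq> 0" "?k1' = r1 *\<^sub>R ?k1"
    by (rule parallel_nonzeroE[OF parallel_sym[OF par(1)] nz'(3,1)])
  obtain r2 where r2: "r2 \<noteq> 0" "?k2' = r2 *\<^sub>R ?k2"
    by (rule parallel_nonzeroE[OF parallel_sym[OF par(2)] nz'(4,2)])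
  have int: "?k1 \<bullet> z \<in> \<int>" "?k2 \<bullet> z \<in> \<int>" "?k1' \<bullet> z \<in> \<int>" "?k2' \<bullet> z \<in> \<int>"
    if "z \<in> integer_lattice 1" for z
    using mode_integral_on_lattice[OF that] by blast+
  have int': "r1 *\<^sub>R ?k1 \<bullet> z \<in> \<int>" "r2 *\<^sub>R ?k2 \<bullet> z \<in> \<int>" if "z \<in> integer_lattice 1" for z
    using int[OF that] unfolding r1(2)[symmetric] r2(2)[symmetric] by blast+
  have "\<exists>\<mu>. critical_level (integer_lattice 1) (two_mode a A1 \<alpha>1 ?k1 A2 \<alpha>2 ?k2) p \<mu> \<and>
      critical_level (integer_lattice 1) (two_mode a A1 \<alpha>1' ?k1' A2 \<alpha>2' ?k2') p \<mu>"
    unfolding r1(2) r2(2)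
    by (rule orthogonal_levels_depend_on_directions[OF nz'(1,2) orth r1(1) r2(1) int(1,2) int'])
  then obtain \<mu> where \<mu>: "critical_level (integer_lattice 1) (two_mode a A1 \<alpha>1 ?k1 A2 \<alpha>2 ?k2) p \<mu>"
      "critical_level (integer_lattice 1) (two_mode a A1 \<alpha>1' ?k1' A2 \<alpha>2' ?k2') p \<mu>" by blast
  have "effective_Hamiltonian (two_mode a A1 \<alpha>1 ?k1 A2 \<alpha>2 ?k2) p = \<mu>"
    by (rule two_mode_effective_Hamiltonian(2)[OF int(1,2) \<mu>(1)])
  moreover have "effective_Hamiltonian (two_mode a A1 \<alpha>1' ?k1' A2 \<alpha>2' ?k2') p = \<mu>"
    by (rule two_mode_effective_Hamiltonian(2)[OF int(3,4) \<mu>(2)])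
  ultimately show "effective_Hamiltonian (two_mode a A1 \<alpha>1 ?k1 A2 \<alpha>2 ?k2) p
    = effective_Hamiltonian (two_mode a A1 \<alpha>1' ?k1' A2 \<alpha>2' ?k2') p" by simp
qed

lemma bij_betw_two_points:
  "(\<exists>\<sigma>. bij_betw \<sigma> {1, 2} {1, 2 :: nat} \<and> (\<forall>j\<in>{1, 2 :: nat}. P j (\<sigma> j)))
     \<longleftrightarrow> (P 1 1 \<and> P 2 2) \<or> (P 1 2 \<and> P 2 1)"
proof
  assume "\<exists>\<sigma>. bij_betw \<sigma> {1, 2} {1, 2 :: nat} \<and> (\<forall>j\<in>{1, 2 :: nat}. P j (\<sigma> j))"
  then obtain \<sigma> :: "nat \<Rightarrow> nat" where "bij_betw \<sigma> {1, 2} {1, 2 :: nat}" and P: "P 1 (\<sigma> 1)" "P 2 (\<sigma> 2)" by auto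
  then have "\<sigma> 1 \<in> {1, 2}" "\<sigma> 2 \<in> {1, 2}" "\<sigma> 1 \<noteq> \<sigma> 2"
    using bij_betw_apply[of \<sigma> "{1, 2}" "{1, 2}"] by (auto simp: bij_betw_def inj_on_def)
  then have "(\<sigma> 1 = 1 \<and> \<sigma> 2 = 2) \<or> (\<sigma> 1 = 2 \<and> \<sigma> 2 = 1)" by auto
  then show "(P 1 1 \<and> P 2 2) \<or> (P 1 2 \<and> P 2 1)" using P by auto
next
  assume "(P 1 1 \<and> P 2 2) \<or> (P 1 2 \<and> P 2 1)"
  then show "\<exists>\<sigma>. bij_betw \<sigma> {1, 2} {1, 2 :: nat} \<and> (\<forall>j\<in>{1, 2 :: nat}. P j (\<sigma> j))"
  proof
    assume "P 1 1 \<and> P 2 2"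
    then show ?thesis by (intro exI[of _ id]) auto
  next
    assume "P 1 2 \<and> P 2 1"
    \<comment> \<open>The map j \<mapsto> 3 - j exchanges the two indices.\<close>
    then show ?thesis by (intro exI[of _ "\<lambda>j. 3 - j"]) (auto simp: bij_betw_def)
  qed
qed

theorem theorem1p3:
  fixes m :: nat
    and a :: "nat \<Rightarrow> real"
    and lam :: "nat \<Rightarrow> nat \<Rightarrow> complex"
    and k :: "nat \<Rightarrow> nat \<Rightarrow> int ^ 'n"
    and V H :: "nat \<Rightarrow> real ^ 'n \<Rightarrow> real"
  assumes "m \<in> {1, 2}"
    and "\<And>l j. l \<in> {1, 2} \<Longrightarrow> j \<in> {1..m} \<Longrightarrow> lam l j \<noteq> 0"
    and "\<And>l j. l \<in> {1, 2} \<Longrightarrow> j \<in> {1..m} \<Longrightarrow> k l j \<noteq> 0"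
    and "\<And>l i j. l \<in> {1, 2} \<Longrightarrow> i \<in> {1..m} \<Longrightarrow> j \<in> {1..m} \<Longrightarrow> i \<noteq> j \<Longrightarrow>
           \<not> parallel (of_int_vec (k l i)) (of_int_vec (k l j))"
    and "\<And>l. l \<in> {1, 2} \<Longrightarrow> V l = trig_potential m (a l) (lam l) (k l)"
    and "\<And>l. l \<in> {1, 2} \<Longrightarrow> H l = effective_Hamiltonian (V l)"
  shows "(m = 1 \<longrightarrow>
            (H 1 = H 2 \<longleftrightarrow>
               (\<exists>c x0. c \<in> \<rat> - {0} \<and> (\<forall>x. V 1 x = V 2 (x /\<^sub>R c + x0)))))
       \<and> (m = 2 \<longrightarrow>
            (orthogonal (of_int_vec (k 1 1)) (of_int_vec (k 1 2)) \<longrightarrow>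
               (H 1 = H 2 \<longleftrightarrow>
                  a 1 = a 2 \<and>
                  (\<exists>\<sigma>. bij_betw \<sigma> {1, 2} {1, 2} \<and>
                     (\<forall>j\<in>{1, 2}. parallel (of_int_vec (k 1 j)) (of_int_vec (k 2 (\<sigma> j))) \<and>
                                 cmod (lam 1 j) = cmod (lam 2 (\<sigma> j))))))
          \<and> (\<not> orthogonal (of_int_vec (k 1 1)) (of_int_vec (k 1 2)) \<longrightarrow>
               (H 1 = H 2 \<longleftrightarrow>
                  (\<exists>c x0. c \<in> \<rat> - {0} \<and> (\<forall>x. V 1 x = V 2 (x /\<^sub>R c + x0))))))"
proof (intro conjI impI)
  have l: "(1 :: nat) \<in> {1, 2}" "(2 :: nat) \<in> {1, 2}" by auto
  have H: "H 1 = effective_Hamiltonian (V 1)" "H 2 = effective_Hamiltonian (V 2)"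
    using assms(6) by auto
  {
    assume m: "m = 1"
    have "V 1 = two_mode (a 1) (cmod (lam 1 1)) (Arg (lam 1 1)) (of_int_vec (k 1 1))
        0 0 (2 *\<^sub>R of_int_vec (k 1 1))"
      "V 2 = two_mode (a 2) (cmod (lam 2 1)) (Arg (lam 2 1)) (of_int_vec (k 2 1))
        0 0 (2 *\<^sub>R of_int_vec (k 2 1))"
      unfolding assms(5)[OF l(1)] assms(5)[OF l(2)] m by (rule trig_potential_one_mode)+
    moreover have "0 < cmod (lam 1 1)" "0 < cmod (lam 2 1)" "k 1 1 \<noteq> 0" "k 2 1 \<noteq> 0"
      using assms(2,3)[of 1 1] assms(2,3)[of 2 1] m by auto
    ultimately show "H 1 = H 2 \<longleftrightarrow> (\<exists>c x0. c \<in> \<rat> - {0} \<and> (\<forall>x. V 1 x = V 2 (x /\<^sub>R c + x0)))"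
      unfolding H by (intro one_mode_rigidity)
  }
  assume m: "m = 2"
  have A: "0 < cmod (lam 1 1)" "0 < cmod (lam 1 2)" "0 < cmod (lam 2 1)" "0 < cmod (lam 2 2)"
    using assms(2)[of 1 1] assms(2)[of 1 2] assms(2)[of 2 1] assms(2)[of 2 2] m by auto
  have nz: "k 1 1 \<noteq> 0" "k 1 2 \<noteq> 0" "k 2 1 \<noteq> 0" "k 2 2 \<noteq> 0"
    using assms(3)[of 1 1] assms(3)[of 1 2] assms(3)[of 2 1] assms(3)[of 2 2] m by auto
  have np: "\<not> parallel (of_int_vec (k 1 1)) (of_int_vec (k 1 2))"
    "\<not> parallel (of_int_vec (k 2 1)) (of_int_vec (k 2 2))"
    using assms(4)[of 1 1 2] assms(4)[of 2 1 2] m by auto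
  have V: "V 1 = two_mode (a 1) (cmod (lam 1 1)) (Arg (lam 1 1)) (of_int_vec (k 1 1))
      (cmod (lam 1 2)) (Arg (lam 1 2)) (of_int_vec (k 1 2))"
    "V 2 = two_mode (a 2) (cmod (lam 2 1)) (Arg (lam 2 1)) (of_int_vec (k 2 1))
      (cmod (lam 2 2)) (Arg (lam 2 2)) (of_int_vec (k 2 2))"
    unfolding assms(5)[OF l(1)] assms(5)[OF l(2)] m by (rule trig_potential_two_mode)+
  {
    assume orth: "orthogonal (of_int_vec (k 1 1)) (of_int_vec (k 1 2))"
    then have orth': "of_int_vec (k 1 1) \<bullet> (of_int_vec (k 1 2)) = 0" by (simp add: orthogonal_def)
    define P where "P i j \<longleftrightarrow>
      parallel (of_int_vec (k 1 i)) (of_int_vec (k 2 j)) \<and> cmod (lam 1 i) = cmod (lam 2 j)" for i j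
    have "H 1 = H 2 \<longleftrightarrow> a 1 = a 2 \<and> ((P 1 1 \<and> P 2 2) \<or> (P 1 2 \<and> P 2 1))"
    proof
      assume "H 1 = H 2"
      from equal_effective_Hamiltonians_match[OF A nz np this[unfolded H V]]
      show "a 1 = a 2 \<and> ((P 1 1 \<and> P 2 2) \<or> (P 1 2 \<and> P 2 1))" unfolding P_def by blast
    next
      assume *: "a 1 = a 2 \<and> ((P 1 1 \<and> P 2 2) \<or> (P 1 2 \<and> P 2 1))"
      then have a: "a 2 = a 1" by simp
      from * consider "P 1 1" "P 2 2" | "P 1 2" "P 2 1" by blast
      then show "H 1 = H 2"
      proof cases
        case 1
        then have par: "parallel (of_int_vec (k 1 1)) (of_int_vec (k 2 1))"
            "parallel (of_int_vec (k 1 2)) (of_int_vec (k 2 2))"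
          and eq: "cmod (lam 1 1) = cmod (lam 2 1)" "cmod (lam 1 2) = cmod (lam 2 2)"
          unfolding P_def by blast+
        show ?thesis unfolding H V a eq by (rule aligned_orthogonal_equal[OF nz par orth'])
      next
        case 2
        then have par: "parallel (of_int_vec (k 1 1)) (of_int_vec (k 2 2))"
            "parallel (of_int_vec (k 1 2)) (of_int_vec (k 2 1))"
          and eq: "cmod (lam 1 1) = cmod (lam 2 2)" "cmod (lam 1 2) = cmod (lam 2 1)"
          unfolding P_def by blast+
        show ?thesis unfolding H V a eq two_mode_swap[of _ "cmod (lam 2 1)"]
          by (rule aligned_orthogonal_equal[OF nz(1,2,4,3) par orth'])
      qed
    qed
    then show "H 1 = H 2 \<longleftrightarrow> a 1 = a 2 \<and>
       (\<exists>\<sigma>. bij_betw \<sigma> {1, 2} {1, 2} \<and>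
          (\<forall>j\<in>{1, 2}. parallel (of_int_vec (k 1 j)) (of_int_vec (k 2 (\<sigma> j))) \<and>
                      cmod (lam 1 j) = cmod (lam 2 (\<sigma> j))))"
      unfolding P_def[symmetric] bij_betw_two_points[of P] .
  }
  assume "\<not> orthogonal (of_int_vec (k 1 1)) (of_int_vec (k 1 2))"
  then have no: "of_int_vec (k 1 1) \<bullet> (of_int_vec (k 1 2)) \<noteq> 0" by (simp add: orthogonal_def)
  show "H 1 = H 2 \<longleftrightarrow> (\<exists>c x0. c \<in> \<rat> - {0} \<and> (\<forall>x. V 1 x = V 2 (x /\<^sub>R c + x0)))"
    unfolding H by (rule two_mode_rigidity[OF A nz np no V])
qed

end
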